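(* The homology of the species of chain complexes $C_\bullet^{CE}(\mathcal L)$ is concentrated in degree zero. Moreover, $$\dim H_0^{CE}(\mathcal L)(n)=\begin{cases}(n-1)^n,& n\ge 2,\\ 0,&\text{otherwise,}\end{cases}$$ and $H_0^{CE}(\mathcal L)$ is identified with the (linear) species of endofunctions without fixed points.
   Context: All vector spaces are over a field $\Bbbk$ of characteristic zero; complexes are homologically graded (differentials have degree $-1$); $s$ is a formal symbol of degree $1$, $sC=\Bbbk s\otimes C$. A species is a functor from finite sets and bijections to graded vector spaces; its arity $n$ component is its value on $\{1,\dots,n\}$. The tensor product is $(\mathcal A\otimes\mathcal B)(I)=\bigoplus_{I=J\sqcup K}\mathcal A(J)\otimes\mathcal B(K)$ with Koszul signs in the symmetry, and (dg) Lie algebras in species are defined with respect to it. Rooted trees are directed graphs with all edges directed towards the root. $\mathrm{RT}(I)$ has basis the rooted trees with vertex set $I$. $\mathrm{Cyc}(\mathrm{RT})(I)$, for $I\neq\varnothing$, has basis the directed cycles of rooted trees on $I$: connected directed graphs with vertex set $I$ in which every vertex has exactly one outgoing edge (loops allowed). For rooted trees $T_1,T_2$ on disjoint vertex sets, $T_1\triangleleft T_2$ is the sum over all vertices $v$ of $T_1$ of the tree obtained by adding an edge from the root of $T_2$ to $v$; $[T_1,T_2]=T_1\triangleleft T_2-T_2\triangleleft T_1$ makes $\mathrm{RT}$ a Lie algebra in species. For a directed cycle of rooted trees $C$ and a rooted tree $T$ on disjoint vertex sets, $C\blacktriangleleft T$ is the sum over all vertices $v$ of $C$ of the graph obtained by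 adding an edge from the root of $T$ to $v$; this makes $\mathrm{Cyc}(\mathrm{RT})$ a right module over the Lie algebra $\mathrm{RT}$. The divergence $\mathrm{div}\colon\mathrm{RT}\to\mathrm{Cyc}(\mathrm{RT})$ sends $T$ to the sum over all vertices $v$ of $T$ (including the root) of the graph obtained by adding an edge from the root of $T$ to $v$; it is a $1$-cocycle: $\mathrm{div}([T_1,T_2])=\mathrm{div}(T_1)\blacktriangleleft T_2-\mathrm{div}(T_2)\blacktriangleleft T_1$. $\mathcal L$ is the dg Lie algebra in species $\mathrm{RT}\oplus s^{-1}\mathrm{Cyc}(\mathrm{RT})$ with differential $d(T)=s^{-1}\mathrm{div}(T)$, $d(s^{-1}C)=0$, and brackets given by $[T_1,T_2]$ on $\mathrm{RT}$, by $[T,s^{-1}C]=-s^{-1}(C\blacktriangleleft T)$ (the left action corresponding to the right one), and zero on $s^{-1}\mathrm{Cyc}(\mathrm{RT})$. For a dg Lie algebra $(L,d)$, the Chevalley--Eilenberg complex is $C^{CE}_\bullet(L)=(\mathrm{Com}^c(sL),d_1^{CE}+d_2^{CE})$, where $\mathrm{Com}^c(sL)=\bigoplus_{n\ge1}S^n(sL)$ is the cofree (non-counital) cocommutative coalgebra, $d_1^{CE}$ is the coderivation extending the differential of $sL$ induced by $d$, and $d_2^{CE}$ is the coderivation extending the degree $-1$ map $S^2(sL)\to sL$ induced by the Lie bracket; in terms of antisymmetric tensors, $d_2^{CE}(x_1\wedge\cdots\wedge x_n)=\sum_{i<j}(-1)^{i+j-1}[x_i,x_j]\wedge x_1\wedge\cdots\widehat{x_i}\cdots\widehat{x_j}\cdots\wedge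 x_n$ (with additional Koszul signs for elements of nonzero degree). $H^{CE}_\bullet(L)$ denotes its homology. The linear species of endofunctions without fixed points assigns to a finite non-empty set $I$ the span of maps $g\colon I\to I$ with $g(i)\ne i$ for all $i$. *)

theory Defs
  imports
    "HOL-Algebra.AbelCoset"
    "HOL-Library.Poly_Mapping"
    "Graph_Theory.Digraph_Component"
    "Jordan_Normal_Form.VS_Connect"
begin

section \<open>Free vector spaces, quotients and linear species\<close>

text \<open>
  The vector space with basis a type \<open>'b\<close> is \<open>'b \<Rightarrow>\<^sub>0 'k\<close>; the basis vector of \<open>b\<close> is \<open>single b 1\<close>.
\<close>

definition pm_scale :: "'k::field \<Rightarrow> ('b \<Rightarrow>\<^sub>0 'k) \<Rightarrow> ('b \<Rightarrow>\<^sub>0 'k)" where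
  "pm_scale c x = Poly_Mapping.map (\<lambda>a. c * a) x"

definition lin_ext :: "('b \<Rightarrow> ('c \<Rightarrow>\<^sub>0 'k)) \<Rightarrow> ('b \<Rightarrow>\<^sub>0 'k::field) \<Rightarrow> ('c \<Rightarrow>\<^sub>0 'k)" where
  "lin_ext f x = (\<Sum>b\<in>Poly_Mapping.keys x. pm_scale (Poly_Mapping.lookup x b) (f b))"

definition lin_map :: "('b \<Rightarrow> 'c) \<Rightarrow> ('b \<Rightarrow>\<^sub>0 'k::field) \<Rightarrow> ('c \<Rightarrow>\<^sub>0 'k)" where
  "lin_map f = lin_ext (\<lambda>b. Poly_Mapping.single (f b) 1)"

text \<open>
  The multiplicative fields of the module records below are junk: the record type extends that
  of rings, but \<open>vectorspace\<close> only looks at the additive structure and at \<open>smult\<close>.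
\<close>

definition free_space :: "'b set \<Rightarrow> ('k::field, 'b \<Rightarrow>\<^sub>0 'k) module" where
  "free_space B = \<lparr>carrier = {x. Poly_Mapping.keys x \<subseteq> B}, monoid.mult = undefined, one = undefined,
     zero = 0, add = (+), smult = pm_scale\<rparr>"

text \<open>
  \<open>quot_space V U\<close> is \<open>V/U\<close>, realised on the cosets of \<open>U\<close>. The map between quotients induced by
  \<open>f : V \<rightarrow> W\<close> sends the coset \<open>X\<close> to the coset \<open>f(x) + U\<close>, \<open>x \<in> X\<close>; for \<open>f\<close> respecting the
  subspaces all sets in the union agree.
\<close>

definition quot_space :: "('k, 'a) module \<Rightarrow> 'a set \<Rightarrow> ('k, 'a set) module" where
  "quot_space V U = \<lparr>carrier = a_rcosets\<^bsub>V\<^esub> U, monoid.mult = undefined, one = undefined,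
     zero = U, add = (<+>\<^bsub>V\<^esub>), smult = (\<lambda>c X. \<Union>x\<in>X. U +>\<^bsub>V\<^esub> (c \<odot>\<^bsub>V\<^esub> x))\<rparr>"

definition quot_map :: "('k, 'b) module \<Rightarrow> 'b set \<Rightarrow> ('a \<Rightarrow> 'b) \<Rightarrow> 'a set \<Rightarrow> 'b set" where
  "quot_map W U f X = (\<Union>x\<in>X. U +>\<^bsub>W\<^esub> f x)"

text \<open>
  The data of a species in vector spaces: the value on a finite set, and the transport
  \<open>sp_act I J \<sigma>\<close> along a bijection \<open>\<sigma> : I \<rightarrow> J\<close>.
\<close>

record ('v, 'k, 'a) lin_species =
  sp_val :: "'v set \<Rightarrow> ('k, 'a) module"
  sp_act :: "'v set \<Rightarrow> 'v set \<Rightarrow> ('v \<Rightarrow> 'v) \<Rightarrow> 'a \<Rightarrow> 'a"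

definition species_iso ::
  "('v, 'k::field, 'a) lin_species \<Rightarrow> ('v, 'k, 'b) lin_species \<Rightarrow> ('v set \<Rightarrow> 'a \<Rightarrow> 'b) \<Rightarrow> bool" where
  "species_iso F G \<Phi> \<longleftrightarrow>
     (\<forall>I. finite I \<longrightarrow> linear_map class_ring (sp_val F I) (sp_val G I) (\<Phi> I) \<and>
        bij_betw (\<Phi> I) (carrier (sp_val F I)) (carrier (sp_val G I))) \<and>
     (\<forall>I J \<sigma>. finite I \<and> finite J \<and> bij_betw \<sigma> I J \<longrightarrow>
        (\<forall>x\<in>carrier (sp_val F I). \<Phi> J (sp_act F I J \<sigma> x) = sp_act G I J \<sigma> (\<Phi> I x)))"


section \<open>Chevalley--Eilenberg complex of a dg Lie algebra in species\<close>

text \<open>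
  The data of a dg Lie algebra in species with a chosen homogeneous basis permuted by the
  bijections: \<open>L(I)\<close> is the span of the basis elements \<open>b\<close> with underlying set \<open>supp b = I\<close>,
  and the bracket \<open>L(J) \<otimes> L(K) \<rightarrow> L(J \<squnion> K)\<close> is given on pairs of basis elements.
  The tensor power \<open>L\<^sup>\<otimes>\<^sup>n(I)\<close> then has as basis the words of length \<open>n\<close> in basis elements whose
  underlying sets form a decomposition of \<open>I\<close>. The record carries only the data; the dg Lie axioms
  are what makes the complex below well defined with square-zero differential.
\<close>

record (overloaded) ('v, 'b, 'k::zero) dgl_species =
  basis :: "'b set"
  supp :: "'b \<Rightarrow> 'v set"
  deg :: "'b \<Rightarrow> int"
  relabel :: "('v \<Rightarrow> 'v) \<Rightarrow> 'b \<Rightarrow> 'b"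
  diff :: "'b \<Rightarrow> ('b \<Rightarrow>\<^sub>0 'k)"
  brk :: "'b \<Rightarrow> 'b \<Rightarrow> ('b \<Rightarrow>\<^sub>0 'k)"

text \<open>The degree of \<open>s b\<close>. A word \<open>[b\<^sub>1, \<dots>, b\<^sub>n]\<close> stands for \<open>s b\<^sub>1 \<otimes> \<cdots> \<otimes> s b\<^sub>n\<close>.\<close>

definition sdeg :: "('v, 'b, 'k::zero) dgl_species \<Rightarrow> 'b \<Rightarrow> int" where
  "sdeg L b = deg L b + 1"

definition ce_words :: "('v, 'b, 'k::zero) dgl_species \<Rightarrow> int \<Rightarrow> 'v set \<Rightarrow> 'b list set" where
  "ce_words L m I = {w. w \<noteq> [] \<and> set w \<subseteq> basis L \<and>
     (\<forall>j<length w. \<forall>i<j. supp L (w ! i) \<inter> supp L (w ! j) = {}) \<and>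
     (\<Union>b\<in>set w. supp L b) = I \<and>
     (\<Sum>b\<leftarrow>w. sdeg L b) = m}"

text \<open>
  \<open>S\<^sup>n(sL)\<close> is the quotient of \<open>(sL)\<^sup>\<otimes>\<^sup>n\<close> by the Koszul-signed action of the symmetric group, which
  is generated by adjacent transpositions.
\<close>

definition ce_rel :: "('v, 'b, 'k::field) dgl_species \<Rightarrow> int \<Rightarrow> 'v set \<Rightarrow> ('b list \<Rightarrow>\<^sub>0 'k) set" where
  "ce_rel L m I = LinearCombinations.module.span class_ring (free_space (ce_words L m I))
     {Poly_Mapping.single w 1 -
        Poly_Mapping.single (w[i := w ! Suc i, Suc i := w ! i])
          ((-1) powi (sdeg L (w ! i) * sdeg L (w ! Suc i))) | w i.
      w \<in> ce_words L m I \<and> Suc i < length w}"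

definition ce_chains ::
  "('v, 'b, 'k::field) dgl_species \<Rightarrow> int \<Rightarrow> 'v set \<Rightarrow> ('k, ('b list \<Rightarrow>\<^sub>0 'k) set) module" where
  "ce_chains L m I = quot_space (free_space (ce_words L m I)) (ce_rel L m I)"

text \<open>
  The coderivation extending \<open>s b \<mapsto> - s (d b)\<close> (the differential of \<open>\<bbbk>s \<otimes> L\<close>); the sign of the
  \<open>i\<close>-th summand comes from moving the differential past the first \<open>i\<close> factors.
\<close>

definition ce_d1 :: "('v, 'b, 'k::field) dgl_species \<Rightarrow> 'b list \<Rightarrow> ('b list \<Rightarrow>\<^sub>0 'k)" where
  "ce_d1 L w = (\<Sum>i<length w.
     pm_scale (- ((-1) powi (\<Sum>k<i. sdeg L (w ! k))))
       (lin_map (\<lambda>c. w[i := c]) (diff L (w ! i))))"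

text \<open>
  The coderivation extending \<open>s b \<cdot> s c \<mapsto> (-1)\<^sup>|\<^sup>b\<^sup>| s [b, c]\<close>. The first sign is the Koszul sign
  of moving the factors \<open>i\<close> and \<open>j\<close> to the front. If all degrees in \<open>L\<close> are zero, the total sign
  is \<open>(-1)\<^sup>i\<^sup>+\<^sup>j\<^sup>-\<^sup>1\<close> for factors counted from one.
\<close>

definition ce_d2 :: "('v, 'b, 'k::field) dgl_species \<Rightarrow> 'b list \<Rightarrow> ('b list \<Rightarrow>\<^sub>0 'k)" where
  "ce_d2 L w = (\<Sum>j<length w. \<Sum>i<j.
     pm_scale
       ((-1) powi (sdeg L (w ! i) * (\<Sum>k<i. sdeg L (w ! k)) +
                   sdeg L (w ! j) * (\<Sum>k\<in>{..<j} - {i}. sdeg L (w ! k))) *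
        (-1) powi (deg L (w ! i)))
       (lin_map (\<lambda>c. c # nths w (- {i, j})) (brk L (w ! i) (w ! j))))"

definition ce_boundary ::
  "('v, 'b, 'k::field) dgl_species \<Rightarrow> int \<Rightarrow> 'v set \<Rightarrow> ('b list \<Rightarrow>\<^sub>0 'k) set \<Rightarrow> ('b list \<Rightarrow>\<^sub>0 'k) set" where
  "ce_boundary L m I =
     quot_map (free_space (ce_words L (m - 1) I)) (ce_rel L (m - 1) I)
       (lin_ext (\<lambda>w. ce_d1 L w + ce_d2 L w))"

definition ce_act ::
  "('v, 'b, 'k::field) dgl_species \<Rightarrow> int \<Rightarrow> 'v set \<Rightarrow> ('v \<Rightarrow> 'v) \<Rightarrow>
     ('b list \<Rightarrow>\<^sub>0 'k) set \<Rightarrow> ('b list \<Rightarrow>\<^sub>0 'k) set" where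
  "ce_act L m J \<sigma> =
     quot_map (free_space (ce_words L m J)) (ce_rel L m J) (lin_map (map (relabel L \<sigma>)))"

definition ce_cycles ::
  "('v, 'b, 'k::field) dgl_species \<Rightarrow> int \<Rightarrow> 'v set \<Rightarrow> ('k, ('b list \<Rightarrow>\<^sub>0 'k) set) module" where
  "ce_cycles L m I = (ce_chains L m I)
     \<lparr>carrier := {X \<in> carrier (ce_chains L m I). ce_boundary L m I X = \<zero>\<^bsub>ce_chains L (m - 1) I\<^esub>}\<rparr>"

definition ce_boundaries ::
  "('v, 'b, 'k::field) dgl_species \<Rightarrow> int \<Rightarrow> 'v set \<Rightarrow> ('b list \<Rightarrow>\<^sub>0 'k) set set" where
  "ce_boundaries L m I = ce_boundary L (m + 1) I ` carrier (ce_chains L (m + 1) I)"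

definition ce_homology ::
  "('v, 'b, 'k::field) dgl_species \<Rightarrow> int \<Rightarrow> ('v, 'k, ('b list \<Rightarrow>\<^sub>0 'k) set set) lin_species" where
  "ce_homology L m = \<lparr>
     sp_val = (\<lambda>I. quot_space (ce_cycles L m I) (ce_boundaries L m I)),
     sp_act = (\<lambda>I J \<sigma>. quot_map (ce_cycles L m J) (ce_boundaries L m J) (ce_act L m J \<sigma>))\<rparr>"


section \<open>Rooted trees and directed cycles of rooted trees\<close>

definition is_root :: "'v pair_pre_digraph \<Rightarrow> 'v \<Rightarrow> bool" where
  "is_root G r \<longleftrightarrow> r \<in> pverts G \<and> out_degree G r = 0 \<and>
     (\<forall>v\<in>pverts G - {r}. out_degree G v = 1) \<and> (\<forall>v\<in>pverts G. v \<rightarrow>\<^sup>*\<^bsub>G\<^esub> r)"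

definition rooted_tree :: "'v pair_pre_digraph \<Rightarrow> bool" where
  "rooted_tree G \<longleftrightarrow> pair_fin_digraph G \<and> (\<exists>r. is_root G r)"

definition root_of :: "'v pair_pre_digraph \<Rightarrow> 'v" where
  "root_of G = (THE r. is_root G r)"

definition cycle_of_trees :: "'v pair_pre_digraph \<Rightarrow> bool" where
  "cycle_of_trees G \<longleftrightarrow> pair_fin_digraph G \<and> connected G \<and> (\<forall>v\<in>pverts G. out_degree G v = 1)"

definition relabel_graph :: "('v \<Rightarrow> 'v) \<Rightarrow> 'v pair_pre_digraph \<Rightarrow> 'v pair_pre_digraph" where
  "relabel_graph \<sigma> G = \<lparr>pverts = \<sigma> ` pverts G, parcs = map_prod \<sigma> \<sigma> ` parcs G\<rparr>"

text \<open>\<open>graft G T\<close> is \<open>G \<triangleleft> T\<close> if \<open>G\<close> is a rooted tree and the right action of \<open>T\<close> on \<open>G\<close> if \<open>G\<close> is a cycle.\<close>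

definition graft :: "'v pair_pre_digraph \<Rightarrow> 'v pair_pre_digraph \<Rightarrow> ('v pair_pre_digraph \<Rightarrow>\<^sub>0 'k::field)" where
  "graft G T = (\<Sum>v\<in>pverts G. Poly_Mapping.single
     \<lparr>pverts = pverts G \<union> pverts T, parcs = insert (root_of T, v) (parcs G \<union> parcs T)\<rparr> 1)"

definition divergence :: "'v pair_pre_digraph \<Rightarrow> ('v pair_pre_digraph \<Rightarrow>\<^sub>0 'k::field)" where
  "divergence T = (\<Sum>v\<in>pverts T. Poly_Mapping.single
     \<lparr>pverts = pverts T, parcs = insert (root_of T, v) (parcs T)\<rparr> 1)"

text \<open>Basis elements of \<open>RT \<oplus> s\<^sup>-\<^sup>1 Cyc(RT)\<close>: \<open>Tree T\<close> is \<open>T\<close> and \<open>DCycle C\<close> is \<open>s\<^sup>-\<^sup>1 C\<close>.\<close>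

datatype 'v rt_gen = Tree "'v pair_pre_digraph" | DCycle "'v pair_pre_digraph"

fun rt_supp :: "'v rt_gen \<Rightarrow> 'v set" where
  "rt_supp (Tree T) = pverts T"
| "rt_supp (DCycle C) = pverts C"

fun rt_deg :: "'v rt_gen \<Rightarrow> int" where
  "rt_deg (Tree T) = 0"
| "rt_deg (DCycle C) = -1"

fun rt_relabel :: "('v \<Rightarrow> 'v) \<Rightarrow> 'v rt_gen \<Rightarrow> 'v rt_gen" where
  "rt_relabel \<sigma> (Tree T) = Tree (relabel_graph \<sigma> T)"
| "rt_relabel \<sigma> (DCycle C) = DCycle (relabel_graph \<sigma> C)"

fun rt_diff :: "'v rt_gen \<Rightarrow> ('v rt_gen \<Rightarrow>\<^sub>0 'k::field)" where
  "rt_diff (Tree T) = lin_map DCycle (divergence T)"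
| "rt_diff (DCycle C) = 0"

text \<open>The third equation is forced by graded antisymmetry.\<close>

fun rt_brk :: "'v rt_gen \<Rightarrow> 'v rt_gen \<Rightarrow> ('v rt_gen \<Rightarrow>\<^sub>0 'k::field)" where
  "rt_brk (Tree T1) (Tree T2) = lin_map Tree (graft T1 T2 - graft T2 T1)"
| "rt_brk (Tree T) (DCycle C) = - lin_map DCycle (graft C T)"
| "rt_brk (DCycle C) (Tree T) = lin_map DCycle (graft C T)"
| "rt_brk (DCycle C) (DCycle C') = 0"

definition rt_dgl :: "('v, 'v rt_gen, 'k::field) dgl_species" where
  "rt_dgl = \<lparr>basis = Tree ` {T. rooted_tree T} \<union> DCycle ` {C. cycle_of_trees C},
     supp = rt_supp, deg = rt_deg, relabel = rt_relabel, diff = rt_diff, brk = rt_brk\<rparr>"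


section \<open>Endofunctions without fixed points\<close>

text \<open>
  An endofunction of \<open>I\<close> is an element of \<open>I \<rightarrow>\<^sub>E I\<close>. For \<open>I = {}\<close> this set is a singleton, while
  the species is zero there.
\<close>

definition fpf_endos :: "'v set \<Rightarrow> ('v \<Rightarrow> 'v) set" where
  "fpf_endos I = {g \<in> I \<rightarrow>\<^sub>E I. I \<noteq> {} \<and> (\<forall>i\<in>I. g i \<noteq> i)}"

definition fpf_endo_species :: "('v, 'k::field, ('v \<Rightarrow> 'v) \<Rightarrow>\<^sub>0 'k) lin_species" where
  "fpf_endo_species = \<lparr>
     sp_val = (\<lambda>I. free_space (fpf_endos I)),
     sp_act = (\<lambda>I J \<sigma>. lin_map (\<lambda>g. \<lambda>j\<in>J. \<sigma> (g (inv_into I \<sigma> j))))\<rparr>"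

end

theory Submission
  imports Defs
begin

text \<open>
  A word in trees and cycles on disjoint vertex sets is a partial endofunction of \<open>I\<close> together with
  an ordering of its connected components. Trees have suspended degree one and cycles degree zero, so
  passing to the symmetric powers only remembers an orientation of the set of roots, that is, of the
  points where the function is undefined. Both parts of the Chevalley--Eilenberg differential add an
  edge starting at a root: the divergence adds those which stay in the component of the root, the
  bracket those which lead to another component. Hence the complex is the tensor product over
  \<open>i \<in> I\<close> of the complexes \<open>\<bbbk> \<rightarrow> \<bbbk>\<^sup>I\<close>, \<open>1 \<mapsto> \<Sum>\<^sub>v v\<close>. Its homology is the tensor product of the
  cokernels, each of which has the basis \<open>I - {i}\<close>.
\<close>

section \<open>Linear extensions and quotients\<close>

text \<open>The tensor product over points is never formed. One homotopy per point,
  \<open>unloop\<close>, takes its place: it changes a cycle within its homology class until the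
  edge at that point is defined and not a loop. After all points have been treated nothing is left
  in nonzero degree. The loop is the distinguished basis vector of each factor because every
  relabelling preserves loops; this makes the surviving values \<open>I - {i}\<close> natural.

  The obstacle is the signs. An orientation of the set of roots has no canonical generator, so each
  finite \<open>I\<close> gets an auxiliary injection \<open>h\<close> into the naturals and the
  roots of a word are compared with their order along \<open>h\<close>. The identification of the
  complexes therefore respects relabelling only up to sign. In degree zero there are no roots, the
  sign is one for every choice of \<open>h\<close>, and naturality holds exactly where it is
  claimed.

  Chains are a quotient by relations, homology is a quotient of a subspace of that quotient. Both
  are handled by a surjection with the right kernel, so that cosets become fibres and every map
  between quotients is computed on explicit representatives.\<close>

lemma lookup_pm_scale [simp]: "Poly_Mapping.lookup (pm_scale c x) b = c * Poly_Mapping.lookup x b"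
  by (simp add: pm_scale_def Poly_Mapping.map.rep_eq when_def)

lemma pm_scale_add: "pm_scale c (x + y) = pm_scale c x + pm_scale c y"
  and pm_scale_add_left: "pm_scale (c + d) x = pm_scale c x + pm_scale d x"
  and pm_scale_diff: "pm_scale c (x - y) = pm_scale c x - pm_scale c y"
  and pm_scale_minus_left: "pm_scale (- c) x = - pm_scale c x"
  and pm_scale_pm_scale [simp]: "pm_scale c (pm_scale d x) = pm_scale (c * d) x"
  and pm_scale_one [simp]: "pm_scale 1 x = x"
  and pm_scale_zero [simp]: "pm_scale c 0 = 0"
  and pm_scale_zero_left [simp]: "pm_scale 0 x = 0"
  by (rule poly_mapping_eqI; simp add: algebra_simps lookup_add lookup_minus)+

lemma pm_scale_single [simp]: "pm_scale c (Poly_Mapping.single b d) = Poly_Mapping.single b (c * d)"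
  by (rule poly_mapping_eqI) (simp add: lookup_single when_def)

lemma pm_scale_sum: "pm_scale c (sum f S) = (\<Sum>s\<in>S. pm_scale c (f s))"
  by (induction S rule: infinite_finite_induct) (auto simp: pm_scale_add)

lemma keys_pm_scale: "Poly_Mapping.keys (pm_scale c x) \<subseteq> Poly_Mapping.keys x"
  by (auto simp: in_keys_iff)

lemma lin_ext_superset:
  assumes "finite S" "Poly_Mapping.keys x \<subseteq> S"
  shows "lin_ext f x = (\<Sum>b\<in>S. pm_scale (Poly_Mapping.lookup x b) (f b))"
  unfolding lin_ext_def using assms
  by (intro sum.mono_neutral_left) (auto simp: in_keys_iff)

lemma lin_ext_add: "lin_ext f (x + y) = lin_ext f x + lin_ext f y"
proof -
  let ?S = "Poly_Mapping.keys x \<union> Poly_Mapping.keys y"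
  have "Poly_Mapping.keys (x + y) \<subseteq> ?S" by (rule Poly_Mapping.keys_add)
  then have "lin_ext f (x + y) = (\<Sum>b\<in>?S. pm_scale (Poly_Mapping.lookup (x + y) b) (f b))"
    by (intro lin_ext_superset) auto
  also have "\<dots> = lin_ext f x + lin_ext f y"
    by (subst (1 2) lin_ext_superset[of ?S])
      (auto simp: lookup_add pm_scale_add_left sum.distrib)
  finally show ?thesis .
qed

lemma lin_ext_scale: "lin_ext f (pm_scale c x) = pm_scale c (lin_ext f x)"
  by (subst lin_ext_superset[of "Poly_Mapping.keys x"])
    (auto simp: keys_pm_scale pm_scale_sum lin_ext_def intro: subsetD[OF keys_pm_scale])

lemma lin_ext_zero [simp]: "lin_ext f 0 = 0"
  by (simp add: lin_ext_def)

lemma lin_ext_uminus: "lin_ext f (- x) = - lin_ext f x"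
  using lin_ext_scale[of f "-1" x] by (simp add: pm_scale_minus_left)

lemma lin_ext_diff: "lin_ext f (x - y) = lin_ext f x - lin_ext f y"
  using lin_ext_add[of f x "- y"] by (simp add: lin_ext_uminus)

lemma lin_ext_sum: "lin_ext f (sum g S) = (\<Sum>s\<in>S. lin_ext f (g s))"
  by (induction S rule: infinite_finite_induct) (auto simp: lin_ext_add)

lemma lin_ext_single [simp]: "lin_ext f (Poly_Mapping.single b c) = pm_scale c (f b)"
  by (subst lin_ext_superset[of "{b}"]) auto

lemmas lin_ext_linear = lin_ext_add lin_ext_diff lin_ext_uminus lin_ext_sum lin_ext_scale

lemma lin_ext_cong: "(\<And>b. b \<in> Poly_Mapping.keys x \<Longrightarrow> f b = g b) \<Longrightarrow> lin_ext f x = lin_ext g x"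
  by (simp add: lin_ext_def)

lemma lin_ext_lin_ext: "lin_ext f (lin_ext g x) = lin_ext (\<lambda>b. lin_ext f (g b)) x"
  by (simp add: lin_ext_def[of g] lin_ext_def[of "\<lambda>b. lin_ext f (g b)"] lin_ext_sum lin_ext_scale)

lemma lin_ext_id [simp]: "lin_ext (\<lambda>b. Poly_Mapping.single b 1) x = x"
  by (rule poly_mapping_eqI)
    (simp add: lin_ext_def lookup_sum lookup_single when_def in_keys_iff)

lemma lin_ext_fun_add: "lin_ext (\<lambda>b. f b + g b) x = lin_ext f x + lin_ext g x"
  by (simp add: lin_ext_def pm_scale_add sum.distrib)

lemma lin_ext_fun_diff: "lin_ext (\<lambda>b. f b - g b) x = lin_ext f x - lin_ext g x"
  by (simp add: lin_ext_def pm_scale_diff sum_subtractf)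

lemma lin_ext_fun_zero [simp]: "lin_ext (\<lambda>b. 0) x = 0"
  by (simp add: lin_ext_def)

lemma keys_sum_subset:
  assumes "\<And>s. s \<in> S \<Longrightarrow> Poly_Mapping.keys (f s) \<subseteq> B"
  shows "Poly_Mapping.keys (sum f S) \<subseteq> B"
  using assms
proof (induction S rule: infinite_finite_induct)
  case (insert s S)
  then show ?case using Poly_Mapping.keys_add[of "f s" "sum f S"] by fastforce
qed auto

lemma keys_lin_ext_subset:
  assumes "\<And>b. b \<in> Poly_Mapping.keys x \<Longrightarrow> Poly_Mapping.keys (f b) \<subseteq> C"
  shows "Poly_Mapping.keys (lin_ext f x) \<subseteq> C"
  unfolding lin_ext_def using assms keys_pm_scale by (intro keys_sum_subset) fast

lemma lin_map_single [simp]: "lin_map f (Poly_Mapping.single b c) = Poly_Mapping.single (f b) c"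
  by (simp add: lin_map_def)

lemma lin_map_zero [simp]: "lin_map f 0 = 0"
  and lin_map_diff: "lin_map f (x - y) = lin_map f x - lin_map f y"
  and lin_map_uminus: "lin_map f (- x) = - lin_map f x"
  and lin_map_sum: "lin_map f (sum g S) = (\<Sum>s\<in>S. lin_map f (g s))"
  by (simp_all add: lin_map_def lin_ext_linear)

lemma keys_lin_map_subset: "f ` Poly_Mapping.keys x \<subseteq> C \<Longrightarrow> Poly_Mapping.keys (lin_map f x) \<subseteq> C"
  unfolding lin_map_def by (rule keys_lin_ext_subset) auto


section \<open>Free vector spaces and quotients presented by surjections\<close>

lemma free_space_simps [simp]:
  "carrier (free_space B) = {x. Poly_Mapping.keys x \<subseteq> B}"
  "zero (free_space B) = 0" "add (free_space B) = (+)" "module.smult (free_space B) = pm_scale"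
  by (auto simp: free_space_def)

lemma vectorspace_free_space: "vectorspace class_ring (free_space B :: ('k::field, 'b \<Rightarrow>\<^sub>0 'k) module)"
proof (rule vs_criteria)
  show "field (class_ring :: 'k ring)" by (rule class_field)
  show "\<forall>v w. v \<in> carrier (free_space B) \<and> w \<in> carrier (free_space B) \<longrightarrow>
      v \<oplus>\<^bsub>free_space B\<^esub> w \<in> carrier (free_space B :: ('k, 'b \<Rightarrow>\<^sub>0 'k) module)"
    using Poly_Mapping.keys_add by (auto dest!: subsetD[OF Poly_Mapping.keys_add])
  show "\<forall>v\<in>carrier (free_space B :: ('k, 'b \<Rightarrow>\<^sub>0 'k) module).
      \<exists>w\<in>carrier (free_space B). v \<oplus>\<^bsub>free_space B\<^esub> w = \<zero>\<^bsub>free_space B\<^esub>"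
  proof
    fix v :: "'b \<Rightarrow>\<^sub>0 'k" assume "v \<in> carrier (free_space B)"
    then show "\<exists>w\<in>carrier (free_space B). v \<oplus>\<^bsub>free_space B\<^esub> w = \<zero>\<^bsub>free_space B\<^esub>"
      by (intro bexI[of _ "- v"]) auto
  qed
qed (auto simp: pm_scale_add pm_scale_add_left add_ac dest: subsetD[OF keys_pm_scale])

text \<open>Every axiom is an equation between images and descends from \<open>V\<close>. Coset
  spaces and spaces of cycles obtain their vector space structure this way, without any arithmetic
  of cosets.\<close>

lemma vectorspace_transport:
  fixes V :: "('k::field, 'a, 'm) module_scheme"
  assumes V: "vectorspace class_ring V"
    and \<phi>: "carrier Q = \<phi> ` carrier V" "\<zero>\<^bsub>Q\<^esub> = \<phi> \<zero>\<^bsub>V\<^esub>"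
    and add: "\<And>x y. x \<in> carrier V \<Longrightarrow> y \<in> carrier V \<Longrightarrow> \<phi> x \<oplus>\<^bsub>Q\<^esub> \<phi> y = \<phi> (x \<oplus>\<^bsub>V\<^esub> y)"
    and smult: "\<And>c x. x \<in> carrier V \<Longrightarrow> c \<odot>\<^bsub>Q\<^esub> \<phi> x = \<phi> (c \<odot>\<^bsub>V\<^esub> x)"
  shows "vectorspace class_ring Q"
proof -
  interpret vectorspace class_ring V by fact
  note assms(2-)[simp]
  show ?thesis
  proof (rule vs_criteria)
    show "field (class_ring :: 'k ring)" by (rule class_field)
    show "\<forall>v\<in>carrier Q. \<exists>w\<in>carrier Q. v \<oplus>\<^bsub>Q\<^esub> w = \<zero>\<^bsub>Q\<^esub>"
    proof
      fix v assume "v \<in> carrier Q"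
      then obtain x where "x \<in> carrier V" "v = \<phi> x" by auto
      then show "\<exists>w\<in>carrier Q. v \<oplus>\<^bsub>Q\<^esub> w = \<zero>\<^bsub>Q\<^esub>"
        by (intro bexI[of _ "\<phi> (\<ominus>\<^bsub>V\<^esub> x)"]) (auto simp: M.r_neg)
    qed
  qed (auto simp: M.a_ac smult_l_distr[simplified] smult_r_distr[simplified] smult_assoc1[simplified]
      smult_one[simplified])
qed

text \<open>
  If \<open>T : V \<rightarrow> W\<close> is onto with kernel \<open>U\<close>, then the cosets of \<open>U\<close> are the fibres of \<open>T\<close>.
\<close>

locale quot_presentation =
  linear_map class_ring V W T
  for V :: "('k::field, 'a) module" and W :: "('k, 'b) module" and T +
  fixes U
  assumes onto: "T ` carrier V = carrier W"
    and kernel: "U = {x \<in> carrier V. T x = \<zero>\<^bsub>W\<^esub>}"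
begin

text \<open>As a function of \<open>w\<close> this inverts the isomorphism from the quotient to
  \<open>W\<close> induced by \<open>T\<close>, so \<open>W\<close> supplies coordinates for
  cosets.\<close>

definition fib where "fib w = {x \<in> carrier V. T x = w}"


lemma coset_eq_fib: "x \<in> carrier V \<Longrightarrow> U +>\<^bsub>V\<^esub> x = fib (T x)"
proof -
  assume x: "x \<in> carrier V"
  have "\<exists>u\<in>U. y = u \<oplus>\<^bsub>V\<^esub> x" if "y \<in> carrier V" "T y = T x" for y
    using that x
    by (intro bexI[of _ "y \<oplus>\<^bsub>V\<^esub> (\<ominus>\<^bsub>V\<^esub> x)"]) (auto simp: kernel V.module.M.a_assoc V.module.M.l_neg W.module.M.r_neg)
  with x show ?thesis
    by (auto simp: a_r_coset_def' fib_def kernel)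
qed

lemma fib_nonempty: "w \<in> carrier W \<Longrightarrow> \<exists>x\<in>carrier V. T x = w \<and> fib w = U +>\<^bsub>V\<^esub> x"
  unfolding onto[symmetric] by (auto simp: coset_eq_fib)

lemma inj_fib: "inj_on fib (carrier W)"
  by (rule inj_onI) (use fib_nonempty in \<open>fastforce simp: fib_def set_eq_iff\<close>)

lemma carrier_quot: "carrier (quot_space V U) = fib ` carrier W"
  by (auto simp: quot_space_def A_RCOSETS_def' coset_eq_fib onto[symmetric] intro!: image_eqI)

lemma zero_quot: "\<zero>\<^bsub>quot_space V U\<^esub> = fib \<zero>\<^bsub>W\<^esub>"
  by (simp add: quot_space_def fib_def kernel)

lemma add_quot:
  assumes "a \<in> carrier W" "b \<in> carrier W"
  shows "fib a \<oplus>\<^bsub>quot_space V U\<^esub> fib b = fib (a \<oplus>\<^bsub>W\<^esub> b)"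
proof -
  obtain x where x: "x \<in> carrier V" "T x = a" using assms fib_nonempty by blast
  have "\<exists>u\<in>fib a. \<exists>v\<in>fib b. y = u \<oplus>\<^bsub>V\<^esub> v" if y: "y \<in> carrier V" "T y = a \<oplus>\<^bsub>W\<^esub> b" for y
  proof (intro bexI)
    \<comment> \<open>One lift \<open>x\<close> of \<open>a\<close> serves every \<open>y\<close>
      over the sum: the remainder after subtracting \<open>x\<close> lies over
      \<open>b\<close>.\<close>
    show "y = x \<oplus>\<^bsub>V\<^esub> (\<ominus>\<^bsub>V\<^esub> x \<oplus>\<^bsub>V\<^esub> y)"
      using x y by (simp add: V.module.M.a_assoc[symmetric] V.module.M.r_neg)
    show "x \<in> fib a" using x by (simp add: fib_def)
    show "\<ominus>\<^bsub>V\<^esub> x \<oplus>\<^bsub>V\<^esub> y \<in> fib b"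
      using x y assms by (simp add: fib_def W.module.M.a_assoc[symmetric] W.module.M.l_neg)
  qed
  then show ?thesis
    by (auto simp: quot_space_def set_add_def' fib_def)
qed

lemma smult_quot:
  assumes "a \<in> carrier W"
  shows "c \<odot>\<^bsub>quot_space V U\<^esub> fib a = fib (c \<odot>\<^bsub>W\<^esub> a)"
proof -
  have "U +>\<^bsub>V\<^esub> (c \<odot>\<^bsub>V\<^esub> x) = fib (c \<odot>\<^bsub>W\<^esub> a)" if "x \<in> fib a" for x
    using that by (subst coset_eq_fib) (auto simp: fib_def)
  moreover have "fib a \<noteq> {}"
    using fib_nonempty[OF assms] by (auto simp: fib_def)
  ultimately show ?thesis by (simp add: quot_space_def)
qed

lemma vectorspace_quot: "vectorspace class_ring (quot_space V U)"
  by (rule vectorspace_transport[of W _ fib])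
    (simp_all add: W.vectorspace_axioms carrier_quot zero_quot add_quot smult_quot)

lemma the_inv_fib: "w \<in> carrier W \<Longrightarrow> the_inv_into (carrier W) fib (fib w) = w"
  by (rule the_inv_into_f_f[OF inj_fib])

lemma fib_linear: "linear_map class_ring W (quot_space V U) fib"
proof (intro linear_map.intro mod_hom.intro vectorspace_quot W.vectorspace_axioms)
  show "module class_ring W" "module class_ring (quot_space V U)"
    using vectorspace_quot W.vectorspace_axioms by (auto simp: vectorspace_def)
  show "mod_hom_axioms class_ring W (quot_space V U) fib"
    by (simp add: mod_hom_axioms_def module_hom_def carrier_quot add_quot smult_quot)
qed

lemma inv_fib_linear: "linear_map class_ring (quot_space V U) W (the_inv_into (carrier W) fib)"
proof (intro linear_map.intro mod_hom.intro vectorspace_quot W.vectorspace_axioms)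
  show "module class_ring W" "module class_ring (quot_space V U)"
    using vectorspace_quot W.vectorspace_axioms by (auto simp: vectorspace_def)
  show "mod_hom_axioms class_ring (quot_space V U) W (the_inv_into (carrier W) fib)"
    by (auto simp: mod_hom_axioms_def module_hom_def carrier_quot add_quot smult_quot the_inv_fib)
qed

lemma bij_inv_fib: "bij_betw (the_inv_into (carrier W) fib) (carrier (quot_space V U)) (carrier W)"
  by (rule bij_betw_the_inv_into) (simp add: bij_betw_def inj_fib carrier_quot)

lemma dim_quot:
  assumes "vectorspace.fin_dim class_ring W"
  shows "vectorspace.fin_dim class_ring (quot_space V U)"
    and "vectorspace.dim class_ring (quot_space V U) = vectorspace.dim class_ring W"
proof -
  interpret l: linear_map class_ring W "quot_space V U" fib by (rule fib_linear)
  show "vectorspace.fin_dim class_ring (quot_space V U)"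
    using assms by (rule l.surj_fin_dim) (simp add: carrier_quot)
  show "vectorspace.dim class_ring (quot_space V U) = vectorspace.dim class_ring W"
    by (rule l.dim_eq[symmetric]) (simp_all add: assms inj_fib carrier_quot)
qed

end

text \<open>The boundary, the relabelling of chains and the relabelling of homology are all of the
  form \<open>quot_map\<close>; each is computed by finding the map \<open>g\<close> that
  \<open>f\<close> induces on the presenting spaces.\<close>

lemma quot_map_fib:
  assumes "quot_presentation V1 W1 T1 U1" "quot_presentation V2 W2 T2 U2"
    and f: "\<And>x. x \<in> carrier V1 \<Longrightarrow> f x \<in> carrier V2 \<and> T2 (f x) = g (T1 x)"
    and w: "w \<in> carrier W1"
  shows "quot_map V2 U2 f (quot_presentation.fib V1 T1 w) = quot_presentation.fib V2 T2 (g w)"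
proof -
  interpret q1: quot_presentation V1 W1 T1 U1 by fact
  interpret q2: quot_presentation V2 W2 T2 U2 by fact
  have "U2 +>\<^bsub>V2\<^esub> f x = q2.fib (g w)" if "x \<in> q1.fib w" for x
    using that f by (subst q2.coset_eq_fib) (auto simp: q1.fib_def)
  moreover have "q1.fib w \<noteq> {}"
    using q1.fib_nonempty[OF w] by (auto simp: q1.fib_def)
  ultimately show ?thesis by (simp add: quot_map_def)
qed

lemma free_space_basis:
  assumes "finite B"
  shows "vectorspace.basis class_ring (free_space B :: ('k::field, 'b \<Rightarrow>\<^sub>0 'k) module)
    ((\<lambda>b. Poly_Mapping.single b 1) ` B)"
proof -
  let ?V = "free_space B :: ('k::field, 'b \<Rightarrow>\<^sub>0 'k) module" and ?s = "\<lambda>b. Poly_Mapping.single b (1::'k)"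
  interpret vectorspace class_ring ?V by (rule vectorspace_free_space)
  have inj: "inj_on ?s B" by (rule inj_onI) (metis lookup_single_eq lookup_single_not_eq zero_neq_one)
  have fs: "finsum ?V g S = sum g S" if "\<And>s. s \<in> S \<Longrightarrow> Poly_Mapping.keys (g s) \<subseteq> B" for g and S :: "('b \<Rightarrow>\<^sub>0 'k) set"
    using that by (induction S rule: infinite_finite_induct) (auto simp: M.finsum_insert Pi_def)
  have lc: "lincomb a (?s ` B) = (\<Sum>b\<in>B. Poly_Mapping.single b (a (?s b)))" for a
    unfolding lincomb_def by (subst fs) (auto simp: sum.reindex[OF inj] dest!: subsetD[OF keys_pm_scale])
  have lk: "Poly_Mapping.lookup (lincomb a (?s ` B)) b = (if b \<in> B then a (?s b) else 0)" for a b
    using assms by (auto simp: lc lookup_sum lookup_single when_def)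
  show ?thesis
  proof (subst basis_criterion)
    show "\<forall>v. v \<in> carrier ?V \<longrightarrow>
      (\<exists>!a. a \<in> ?s ` B \<rightarrow>\<^sub>E carrier class_ring \<and> lincomb a (?s ` B) = v)"
    proof (intro allI impI ex_ex1I)
      fix v assume v: "v \<in> carrier ?V"
      \<comment> \<open>\<open>basis_criterion\<close> indexes coefficients by the basis vectors, as
        extensional functions; the coordinate is read through \<open>inv_into\<close> and cut off
        outside the basis.\<close>
      let ?a = "restrict (\<lambda>x. Poly_Mapping.lookup v (inv_into B ?s x)) (?s ` B)"
      have "lincomb ?a (?s ` B) = v"
        using v by (intro poly_mapping_eqI) (auto simp: lk in_keys_iff inv_into_f_f[OF inj])
      then show "\<exists>a. a \<in> ?s ` B \<rightarrow>\<^sub>E carrier class_ring \<and> lincomb a (?s ` B) = v"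
        by (intro exI[of _ ?a]) auto
    next
      fix v a a'
      assume a: "a \<in> ?s ` B \<rightarrow>\<^sub>E carrier class_ring \<and> lincomb a (?s ` B) = v"
        and a': "a' \<in> ?s ` B \<rightarrow>\<^sub>E carrier class_ring \<and> lincomb a' (?s ` B) = v"
      have "a (?s b) = a' (?s b)" if "b \<in> B" for b
        using lk[of a b] lk[of a' b] a a' that by auto
      with a a' show "a = a'"
        by (intro PiE_ext[of a "?s ` B" "\<lambda>_. carrier class_ring"]) auto
    qed
  qed (use assms in auto)
qed

lemma free_space_dim:
  assumes "finite B"
  shows "vectorspace.fin_dim class_ring (free_space B :: ('k::field, 'b \<Rightarrow>\<^sub>0 'k) module)"
    and "vectorspace.dim class_ring (free_space B :: ('k::field, 'b \<Rightarrow>\<^sub>0 'k) module) = card B"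
proof -
  let ?V = "free_space B :: ('k::field, 'b \<Rightarrow>\<^sub>0 'k) module" and ?s = "\<lambda>b. Poly_Mapping.single b (1::'k)"
  interpret vectorspace class_ring ?V by (rule vectorspace_free_space)
  have inj: "inj_on ?s B" by (rule inj_onI) (metis lookup_single_eq lookup_single_not_eq zero_neq_one)
  note b = free_space_basis[OF assms, where 'k = 'k]
  show fin_dim using b assms unfolding fin_dim_def basis_def by blast
  show "dim = card B" using dim_basis[OF _ b] assms by (simp add: card_image inj)
qed

section \<open>The complex of partial endofunctions\<close>

text \<open>
  Partial endofunctions of \<open>I\<close> are encoded as single-valued relations. The points outside the
  domain are the odd generators; an injection \<open>h\<close> into the naturals orders them, so that the
  Koszul sign of a point is the parity of the number of its predecessors.
\<close>

definition pendo :: "'v set \<Rightarrow> int \<Rightarrow> 'v rel set" where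
  "pendo I m = {A. A \<subseteq> I \<times> I \<and> single_valued A \<and> I \<noteq> {} \<and> int (card (I - Domain A)) = m}"

definition rsgn :: "('v \<Rightarrow> nat) \<Rightarrow> 'v set \<Rightarrow> 'v \<Rightarrow> 'k::field" where
  "rsgn h U x = (-1) ^ card {y\<in>U. h y < h x}"

definition pendo_diff :: "('v \<Rightarrow> nat) \<Rightarrow> 'v set \<Rightarrow> 'v rel \<Rightarrow> ('v rel \<Rightarrow>\<^sub>0 'k::field)" where
  "pendo_diff h I A = (\<Sum>x\<in>I - Domain A. \<Sum>v\<in>I.
     Poly_Mapping.single (insert (x, v) A) (- rsgn h (I - Domain A) x))"

text \<open>The contraction of the factor at \<open>i\<close>. Its coefficient equals the one with
  which \<open>pendo_diff\<close> adds the loop back, since the sign at \<open>i\<close> ignores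
  whether \<open>i\<close> itself is counted; the two signs multiply to one.\<close>

definition unloop :: "('v \<Rightarrow> nat) \<Rightarrow> 'v set \<Rightarrow> 'v \<Rightarrow> 'v rel \<Rightarrow> ('v rel \<Rightarrow>\<^sub>0 'k::field)" where
  "unloop h I i A = (if (i, i) \<in> A
     then Poly_Mapping.single (A - {(i, i)}) (- rsgn h (I - Domain A) i) else 0)"

text \<open>The projection of the factor at \<open>i\<close> onto a copy of its homology inside it:
  \<open>1\<close> goes to zero, the vectors \<open>u \<noteq> i\<close> stay, and \<open>i\<close>
  goes to minus their sum, to which it is congruent modulo the image of \<open>1\<close>.\<close>

definition reroute :: "'v set \<Rightarrow> 'v \<Rightarrow> 'v rel \<Rightarrow> ('v rel \<Rightarrow>\<^sub>0 'k::field)" where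
  "reroute I i A =
     (if (i, i) \<in> A then - (\<Sum>u\<in>I - {i}. Poly_Mapping.single (insert (i, u) (A - {(i, i)})) 1)
      else if i \<in> Domain A then Poly_Mapping.single A 1 else 0)"

text \<open>At loops and at undefined points of \<open>A\<close> every value other than the point
  itself is allowed.\<close>

definition fpf_above :: "'v set \<Rightarrow> 'v rel \<Rightarrow> ('v \<Rightarrow> 'v) set" where
  "fpf_above I A = {g \<in> fpf_endos I. \<forall>(x, y)\<in>A. x \<noteq> y \<longrightarrow> g x = y}"

text \<open>
  The tensor product of the cokernel maps \<open>\<bbbk>\<^sup>I \<rightarrow> \<bbbk>\<^bsup>I - {i}\<^esup>\<close>: they send the basis vector \<open>i\<close> to
  \<open>- \<Sum>\<^bsub>v \<noteq> i\<^esub> v\<close>, which explains the sign and the sum over all values at the loops.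
\<close>

definition fpf_proj :: "'v set \<Rightarrow> 'v rel \<Rightarrow> (('v \<Rightarrow> 'v) \<Rightarrow>\<^sub>0 'k::field)" where
  "fpf_proj I A = (\<Sum>g\<in>fpf_above I A. Poly_Mapping.single g ((-1) ^ card {x. (x, x) \<in> A}))"

definition graph_rel :: "'v set \<Rightarrow> ('v \<Rightarrow> 'v) \<Rightarrow> 'v rel" where
  "graph_rel I g = (\<lambda>i. (i, g i)) ` I"

section \<open>Koszul signs of odd points ordered by an injection\<close>

lemma rsgn_square [simp]: "rsgn h U x * rsgn h U x = 1" "rsgn h U x * (rsgn h U x * c) = c"
  by (simp_all add: rsgn_def flip: power_mult_distrib mult.assoc)

lemma rsgn_delete_less: "h x < h y \<Longrightarrow> rsgn h (U - {y}) x = rsgn h U x"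
  unfolding rsgn_def by (rule arg_cong[of _ _ "\<lambda>S. (-1) ^ card S"]) auto

lemma rsgn_delete_greater:
  assumes "finite U" "x \<in> U" "h x < h y"
  shows "rsgn h (U - {x}) y = - rsgn h U y"
proof -
  have "{z\<in>U. h z < h y} = insert x {z\<in>U - {x}. h z < h y}" using assms by auto
  then have "card {z\<in>U. h z < h y} = Suc (card {z\<in>U - {x}. h z < h y})"
    using assms by simp
  then show ?thesis by (simp add: rsgn_def)
qed

lemma rsgn_delete_self [simp]: "rsgn h (U - {x}) x = rsgn h U x" "rsgn h (insert x U) x = rsgn h U x"
  unfolding rsgn_def by (rule arg_cong[of _ _ "\<lambda>S. (-1) ^ card S"]; auto)+

lemma rsgn_empty [simp]: "rsgn h {} x = 1"
  by (simp add: rsgn_def)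

text \<open>Removing one of two odd points flips the sign of the other only if the removed one comes
  first, so exactly one of the two products changes.\<close>

lemma rsgn_swap:
  assumes "finite U" "inj_on h U" "x \<in> U" "y \<in> U" "x \<noteq> y"
  shows "rsgn h U x * rsgn h (U - {x}) y = - (rsgn h U y * rsgn h (U - {y}) x)"
proof -
  have "h x < h y \<or> h y < h x" using assms by (metis inj_onD linorder_neqE_nat)
  then show ?thesis
    using assms by (auto simp: rsgn_delete_less rsgn_delete_greater mult.commute)
qed

lemma undef_insert: "I - Domain (insert (x, v) A) = I - Domain A - {x}"
  by auto

lemma pendo_insert:
  assumes "finite I" "A \<in> pendo I m" "x \<in> I - Domain A" "v \<in> I"
  shows "insert (x, v) A \<in> pendo I (m - 1)"
proof -
  have "card (I - Domain A) = Suc (card (I - Domain A - {x}))"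
    using assms by (intro card.remove) auto
  moreover have "single_valued (insert (x, v) A)"
    using assms by (auto simp: pendo_def single_valued_def)
  ultimately show ?thesis using assms unfolding pendo_def by (simp add: undef_insert del: Domain_insert)
qed

lemma pendo_remove:
  assumes "finite I" "A \<in> pendo I m" "(i, i) \<in> A"
  shows "A - {(i, i)} \<in> pendo I (m + 1)" "I - Domain (A - {(i, i)}) = insert i (I - Domain A)"
    "i \<notin> Domain (A - {(i, i)})"
proof -
  show 1: "I - Domain (A - {(i, i)}) = insert i (I - Domain A)" "i \<notin> Domain (A - {(i, i)})"
    using assms by (auto simp: pendo_def single_valued_def)
  have "single_valued (A - {(i, i)})"
    using assms by (auto simp: pendo_def single_valued_def)
  moreover have "i \<notin> I - Domain A" using assms by auto
  ultimately show "A - {(i, i)} \<in> pendo I (m + 1)"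
    using assms 1 by (auto simp: pendo_def)
qed

section \<open>The differential and its contraction at one point\<close>

lemma pendo_diff_closed:
  assumes "finite I" "A \<in> pendo I m"
  shows "Poly_Mapping.keys (pendo_diff h I A) \<subseteq> pendo I (m - 1)"
  unfolding pendo_diff_def using pendo_insert[OF assms] by (intro keys_sum_subset) auto

lemma lin_ext_pendo_diff_closed:
  assumes "finite I" "Poly_Mapping.keys z \<subseteq> pendo I m"
  shows "Poly_Mapping.keys (lin_ext (pendo_diff h I) z) \<subseteq> pendo I (m - 1)"
  using assms pendo_diff_closed by (intro keys_lin_ext_subset) blast

text \<open>Two edges starting at different odd points can be added in either order, and the two
  orders have opposite signs by \<open>rsgn_swap\<close>.\<close>

lemma pendo_diff_pendo_diff:
  fixes h :: "'v \<Rightarrow> nat"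
  assumes "finite I" "inj_on h I"
  shows "lin_ext (pendo_diff h I) (pendo_diff h I A) = (0 :: 'v rel \<Rightarrow>\<^sub>0 'k::field_char_0)"
proof -
  define U where "U = I - Domain A"
  define F :: "'v \<Rightarrow> 'v \<Rightarrow> 'v rel \<Rightarrow>\<^sub>0 'k" where "F x y = pm_scale (rsgn h U x * rsgn h (U - {x}) y)
    (\<Sum>v\<in>I. \<Sum>u\<in>I. Poly_Mapping.single (insert (y, u) (insert (x, v) A)) 1)" for x y
  let ?S = "SIGMA x:U. U - {x}"
  have U: "finite U" "inj_on h U" using assms by (auto simp: U_def inj_on_def)
  have "lin_ext (pendo_diff h I) (pendo_diff h I A) = (\<Sum>x\<in>U. \<Sum>v\<in>I. \<Sum>y\<in>U - {x}. \<Sum>u\<in>I.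
      Poly_Mapping.single (insert (y, u) (insert (x, v) A)) (rsgn h U x * rsgn h (U - {x}) y))"
    unfolding pendo_diff_def[of h I A] by (simp add: lin_ext_sum pm_scale_sum U_def del: Domain_insert) (simp add: pendo_diff_def pm_scale_sum undef_insert del: Domain_insert)
  also have "\<dots> = (\<Sum>x\<in>U. \<Sum>y\<in>U - {x}. F x y)"
    unfolding F_def by (subst sum.swap) (simp add: pm_scale_sum)
  also have "\<dots> = (\<Sum>(x, y)\<in>?S. F x y)"
    using U by (subst sum.Sigma) auto
  finally have s: "lin_ext (pendo_diff h I) (pendo_diff h I A) = (\<Sum>(x, y)\<in>?S. F x y)" .
  have "F x y = - F y x" if "x \<in> U" "y \<in> U" "x \<noteq> y" for x y
  proof -
    have "(\<Sum>v\<in>I. \<Sum>u\<in>I. Poly_Mapping.single (insert (y, u) (insert (x, v) A)) (1::'k))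
        = (\<Sum>v\<in>I. \<Sum>u\<in>I. Poly_Mapping.single (insert (x, u) (insert (y, v) A)) 1)"
      by (subst sum.swap) (simp add: insert_commute)
    then show ?thesis
      unfolding F_def rsgn_swap[OF U that] by (simp add: pm_scale_minus_left)
  qed
  \<comment> \<open>Exchanging the two points maps the index set to itself, so the sum equals its
    own negative.\<close>
  then have "(\<Sum>(x, y)\<in>?S. F x y) = (\<Sum>(x, y)\<in>?S. - F y x)"
    by (intro sum.cong) auto
  also have "\<dots> = (\<Sum>(x, y)\<in>?S. - F x y)"
    by (rule sum.reindex_bij_witness[where i = prod.swap and j = prod.swap]) auto
  also have "\<dots> = - (\<Sum>(x, y)\<in>?S. F x y)"
    by (simp add: sum_negf case_prod_unfold)
  finally have neg: "lin_ext (pendo_diff h I) (pendo_diff h I A) = - lin_ext (pendo_diff h I) (pendo_diff h I A :: 'v rel \<Rightarrow>\<^sub>0 'k)"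
    using s by simp
  show ?thesis
  \<comment> \<open>Characteristic zero enters here: a coefficient equal to its negative
    vanishes.\<close>
  proof (rule poly_mapping_eqI)
    fix B
    have "Poly_Mapping.lookup (lin_ext (pendo_diff h I) (pendo_diff h I A)) B
        = - Poly_Mapping.lookup (lin_ext (pendo_diff h I) (pendo_diff h I A :: 'v rel \<Rightarrow>\<^sub>0 'k)) B"
      by (subst neg) simp
    then show "Poly_Mapping.lookup (lin_ext (pendo_diff h I) (pendo_diff h I A)) B
        = Poly_Mapping.lookup (0 :: 'v rel \<Rightarrow>\<^sub>0 'k) B" by simp
  qed
qed

text \<open>Each point \<open>i\<close> contributes the factor \<open>\<bbbk> \<rightarrow> \<bbbk>\<^sup>I\<close>, contracted by sending the loop back to \<open>1\<close>.\<close>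

lemma pendo_diff_homotopy:
  assumes I: "finite I" "inj_on h I" and A: "A \<in> pendo I m" and i: "i \<in> I"
  shows "lin_ext (pendo_diff h I) (unloop h I i A) + lin_ext (unloop h I i) (pendo_diff h I A)
    = Poly_Mapping.single A (1 :: 'k::field_char_0) - reroute I i A"
proof -
  define U where "U = I - Domain A"
  have U: "finite U" "inj_on h U" using I by (auto simp: U_def inj_on_def)
  have hd: "lin_ext (unloop h I i) (pendo_diff h I A)
    = (\<Sum>x\<in>U. \<Sum>v\<in>I. pm_scale (- rsgn h U x) (unloop h I i (insert (x, v) A) :: _ \<Rightarrow>\<^sub>0 'k))" (is "_ = ?hd")
    unfolding pendo_diff_def by (simp add: lin_ext_sum U_def)
  consider (undefined) "i \<notin> Domain A" | (other) "i \<in> Domain A" "(i, i) \<notin> A" | (loop) "(i, i) \<in> A"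
    by blast
  then show ?thesis
  proof cases
    \<comment> \<open>\<open>unloop\<close> sees only the summand that adds the loop at
      \<open>i\<close>, and removing this loop returns \<open>A\<close>.\<close>
    case undefined
    then have nl: "(i, i) \<notin> A" and iU: "i \<in> U" using i by (auto simp: U_def)
    have "(\<Sum>v\<in>I. pm_scale (- rsgn h U x) (unloop h I i (insert (x, v) A)))
        = (if x = i then Poly_Mapping.single A (1::'k) else 0)" if x: "x \<in> U" for x
    proof -
      have "(\<Sum>v\<in>I. pm_scale (- rsgn h U x) (unloop h I i (insert (x, v) A)))
          = (\<Sum>v\<in>I. if v = i then (if x = i then Poly_Mapping.single A (1::'k) else 0) else 0)"
        using nl by (intro sum.cong) (auto simp: unloop_def undef_insert simp flip: U_def simp del: Domain_insert)
      then show ?thesis using i I by simp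
    qed
    then have "?hd = (\<Sum>x\<in>U. if x = i then Poly_Mapping.single A 1 else 0)"
      by (intro sum.cong refl)
    also have "\<dots> = Poly_Mapping.single A 1" using U iU by simp
    finally show ?thesis
      unfolding hd using nl undefined by (simp add: unloop_def reroute_def)
  next
    \<comment> \<open>The edge at \<open>i\<close> is not a loop and no summand changes it, so both
      sides vanish.\<close>
    case other
    have "?hd = 0"
      using other by (intro sum.neutral ballI) (auto simp: unloop_def U_def)
    then show ?thesis
      unfolding hd using other by (simp add: unloop_def reroute_def)
  next
    \<comment> \<open>Edges starting at points other than \<open>i\<close> occur in both composites
      with opposite signs; the edges starting at \<open>i\<close> give \<open>A\<close> plus its
      reroutings.\<close>
    case loop
    define A0 where "A0 = A - {(i, i)}"
    note rm = pendo_remove[OF I(1) A loop, folded A0_def U_def]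
    have iU: "i \<notin> U" using loop by (auto simp: U_def)
    have AA: "insert (i, i) A0 = A" using loop by (auto simp: A0_def)
    have "?hd = (\<Sum>x\<in>U. \<Sum>v\<in>I.
        Poly_Mapping.single (insert (x, v) A0) (rsgn h U x * rsgn h (U - {x}) i))"
    proof (intro sum.cong refl)
      fix x v assume x: "x \<in> U" "v \<in> I"
      then have "insert (x, v) A - {(i, i)} = insert (x, v) A0" using iU by (auto simp: A0_def)
      then show "pm_scale (- rsgn h U x) (unloop h I i (insert (x, v) A)) =
         Poly_Mapping.single (insert (x, v) A0) (rsgn h U x * rsgn h (U - {x}) i :: 'k)"
        using loop by (simp add: unloop_def undef_insert flip: U_def del: Domain_insert)
    qed
    moreover have "lin_ext (pendo_diff h I) (unloop h I i A) =
        (\<Sum>v\<in>I. Poly_Mapping.single (insert (i, v) A0) 1) +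
        (\<Sum>x\<in>U. \<Sum>v\<in>I. Poly_Mapping.single (insert (x, v) A0) (rsgn h U i * rsgn h (insert i U) x :: 'k))"
      using loop rm iU U
      by (simp add: unloop_def pendo_diff_def pm_scale_add pm_scale_sum flip: A0_def U_def)
    moreover have "(\<Sum>x\<in>U. \<Sum>v\<in>I.
        Poly_Mapping.single (insert (x, v) A0) (rsgn h U i * rsgn h (insert i U) x :: 'k)) =
        (\<Sum>x\<in>U. \<Sum>v\<in>I. Poly_Mapping.single (insert (x, v) A0) (- (rsgn h U x * rsgn h (U - {x}) i)))"
    proof (intro sum.cong refl arg_cong2[of _ _ _ _ Poly_Mapping.single])
      fix x assume x: "x \<in> U"
      have "inj_on h (insert i U)" using I i by (auto simp: U_def inj_on_def)
      then have "rsgn h (insert i U) i * rsgn h (insert i U - {i}) x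
          = - (rsgn h (insert i U) x * rsgn h (insert i U - {x}) i :: 'k)"
        using x iU U by (intro rsgn_swap) auto
      moreover have "insert i U - {i} = U" "insert i U - {x} = insert i (U - {x})"
        using x iU by auto
      ultimately have eq: "rsgn h U i * rsgn h U x = - (rsgn h (insert i U) x * rsgn h (U - {x}) i :: 'k)"
        by simp
      \<comment> \<open>As all four signs are their own inverses, \<open>a * b = - (c * d)\<close>
        can be rearranged to \<open>a * c = - (b * d)\<close>.\<close>
      define a b c d where "a = (rsgn h U i :: 'k)" and "b = (rsgn h U x :: 'k)"
        and "c = (rsgn h (insert i U) x :: 'k)" and "d = (rsgn h (U - {x}) i :: 'k)"
      have sq: "a * a = 1" "b * b = 1" "c * c = 1" "d * d = 1" by (simp_all add: a_def b_def c_def d_def)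
      have "a * b = - (c * d)" using eq by (simp add: a_def b_def c_def d_def)
      then have "a * (a * b) * (b * c) = - (a * (c * d) * (b * c))" by simp
      then have "(a * a) * (b * b) * c = - ((c * c) * (a * b * d))" by (simp add: mult_ac)
      then have "a * c = - (a * a * (b * d))" using sq by simp
      then show "rsgn h U i * rsgn h (insert i U) x = - (rsgn h U x * rsgn h (U - {x}) i :: 'k)"
        using sq by (simp add: a_def b_def c_def d_def)
    qed
    moreover have "(\<Sum>v\<in>I. Poly_Mapping.single (insert (i, v) A0) (1::'k))
        = Poly_Mapping.single A 1 - reroute I i A"
      using I(1) i loop by (subst sum.remove[of _ i]) (auto simp: reroute_def AA simp flip: A0_def)
    ultimately show ?thesis
      unfolding hd by (simp add: single_uminus sum_negf)
  qed
qed

lemma unloop_closed: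
  assumes "finite I" "A \<in> pendo I m"
  shows "Poly_Mapping.keys (unloop h I i A) \<subseteq> pendo I (m + 1)"
  using assms pendo_remove by (auto simp: unloop_def)

text \<open>Only the edge at \<open>i\<close> changes, so the points of \<open>S\<close> treated
  earlier stay defined and loop-free. This is what permits an induction over the points.\<close>

lemma reroute_closed:
  assumes "finite I" "A \<in> pendo I m" "\<forall>j\<in>S. j \<in> Domain A \<and> (j, j) \<notin> A"
  shows "Poly_Mapping.keys (reroute I i A) \<subseteq>
    {A \<in> pendo I m. \<forall>j\<in>insert i S. j \<in> Domain A \<and> (j, j) \<notin> A}"
proof (cases "(i, i) \<in> A")
  case True
  have "insert (i, u) (A - {(i, i)}) \<in> {A \<in> pendo I m. \<forall>j\<in>insert i S. j \<in> Domain A \<and> (j, j) \<notin> A}"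
    if "u \<in> I - {i}" for u
    using pendo_insert[OF assms(1) pendo_remove(1)[OF assms(1,2) True], of i u] that assms True
      pendo_remove(2,3)[OF assms(1,2) True] by (auto simp: pendo_def)
  then have "Poly_Mapping.keys (\<Sum>u\<in>I - {i}. Poly_Mapping.single (insert (i, u) (A - {(i, i)})) (1::'b)) \<subseteq>
    {A \<in> pendo I m. \<forall>j\<in>insert i S. j \<in> Domain A \<and> (j, j) \<notin> A}"
    by (intro keys_sum_subset) auto
  then show ?thesis using True by (simp add: reroute_def)
qed (use assms in \<open>auto simp: reroute_def\<close>)

text \<open>This replaces a Kuenneth argument. On a cycle the homotopy formula says that the
  identity and \<open>reroute I i\<close> differ by a boundary, so the points can be cleaned one
  after the other.\<close>

lemma pendo_diff_cycle_reduce: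
  fixes z :: "'v rel \<Rightarrow>\<^sub>0 'k::field_char_0"
  assumes I: "finite I" "inj_on h I" and z: "Poly_Mapping.keys z \<subseteq> pendo I m"
    and cyc: "lin_ext (pendo_diff h I) z = 0" and S: "finite S" "S \<subseteq> I"
  shows "\<exists>y. Poly_Mapping.keys y \<subseteq> pendo I (m + 1) \<and>
    Poly_Mapping.keys (z - lin_ext (pendo_diff h I) y) \<subseteq>
      {A \<in> pendo I m. \<forall>j\<in>S. j \<in> Domain A \<and> (j, j) \<notin> A}"
  using S
proof (induction S)
  case empty
  then show ?case using z by (intro exI[of _ 0]) auto
next
  case (insert i S)
  then obtain y where y: "Poly_Mapping.keys y \<subseteq> pendo I (m + 1)"
    and keys: "Poly_Mapping.keys (z - lin_ext (pendo_diff h I) y) \<subseteq>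
      {A \<in> pendo I m. \<forall>j\<in>S. j \<in> Domain A \<and> (j, j) \<notin> A}" by auto
  \<comment> \<open>The correction is \<open>unloop\<close> of what remains after the earlier
    points; the remainder is again a cycle because the differential squares to zero.\<close>
  let ?z = "z - lin_ext (pendo_diff h I) y" and ?y = "y + lin_ext (unloop h I i) (z - lin_ext (pendo_diff h I) y)"
  have "lin_ext (pendo_diff h I) (lin_ext (pendo_diff h I) y) = 0"
    by (simp add: lin_ext_lin_ext pendo_diff_pendo_diff[OF I])
  then have cyc': "lin_ext (pendo_diff h I) ?z = 0" by (simp add: lin_ext_diff cyc)
  have "lin_ext (\<lambda>A. lin_ext (pendo_diff h I) (unloop h I i A) + lin_ext (unloop h I i) (pendo_diff h I A)) ?z
      = lin_ext (\<lambda>A. Poly_Mapping.single A 1 - reroute I i A) ?z"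
    by (rule lin_ext_cong) (use keys pendo_diff_homotopy[OF I] insert.prems in blast)
  then have "lin_ext (pendo_diff h I) (lin_ext (unloop h I i) ?z) + lin_ext (unloop h I i) (lin_ext (pendo_diff h I) ?z)
      = ?z - lin_ext (reroute I i) ?z"
    by (simp only: lin_ext_fun_add lin_ext_fun_diff lin_ext_lin_ext lin_ext_id)
  then have eq: "z - lin_ext (pendo_diff h I) ?y = lin_ext (reroute I i) ?z"
    by (simp add: cyc' lin_ext_add algebra_simps)
  have "Poly_Mapping.keys (lin_ext (unloop h I i) ?z) \<subseteq> pendo I (m + 1)"
    using keys unloop_closed[OF I(1)] by (intro keys_lin_ext_subset) blast
  then have "Poly_Mapping.keys ?y \<subseteq> pendo I (m + 1)"
    using y by (intro order_trans[OF Poly_Mapping.keys_add] Un_least)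
  moreover have "Poly_Mapping.keys (lin_ext (reroute I i) ?z) \<subseteq>
      {A \<in> pendo I m. \<forall>j\<in>insert i S. j \<in> Domain A \<and> (j, j) \<notin> A}"
  proof (rule keys_lin_ext_subset)
    fix A assume "A \<in> Poly_Mapping.keys ?z"
    with keys have "A \<in> pendo I m" "\<forall>j\<in>S. j \<in> Domain A \<and> (j, j) \<notin> A" by auto
    then show "Poly_Mapping.keys (reroute I i A :: 'v rel \<Rightarrow>\<^sub>0 'k) \<subseteq>
        {A \<in> pendo I m. \<forall>j\<in>insert i S. j \<in> Domain A \<and> (j, j) \<notin> A}"
      by (rule reroute_closed[OF I(1)])
  qed
  ultimately show ?case by (intro exI[of _ ?y] conjI) (simp_all only: eq)
qed

text \<open>Once every point is defined, no odd point is left and the degree is zero; in any other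
  degree the reduced cycle has empty support.\<close>

lemma pendo_diff_exact:
  fixes z :: "'v rel \<Rightarrow>\<^sub>0 'k::field_char_0"
  assumes I: "finite I" "inj_on h I" and z: "Poly_Mapping.keys z \<subseteq> pendo I m" "lin_ext (pendo_diff h I) z = 0"
    and m: "m \<noteq> 0"
  shows "\<exists>y. Poly_Mapping.keys y \<subseteq> pendo I (m + 1) \<and> lin_ext (pendo_diff h I) y = z"
proof -
  obtain y where y: "Poly_Mapping.keys y \<subseteq> pendo I (m + 1)" "Poly_Mapping.keys (z - lin_ext (pendo_diff h I) y)
      \<subseteq> {A \<in> pendo I m. \<forall>j\<in>I. j \<in> Domain A \<and> (j, j) \<notin> A}"
    using pendo_diff_cycle_reduce[OF I z I(1) subset_refl] by blast
  have "{A \<in> pendo I m. \<forall>j\<in>I. j \<in> Domain A \<and> (j, j) \<notin> A} = {}"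
  proof (rule equals0I)
    fix A assume A: "A \<in> {A \<in> pendo I m. \<forall>j\<in>I. j \<in> Domain A \<and> (j, j) \<notin> A}"
    then have "I - Domain A = {}" by blast
    moreover have "m = int (card (I - Domain A))" using A by (simp add: pendo_def)
    ultimately show False using m by (simp only: card.empty of_nat_0)
  qed
  with y show ?thesis by (intro exI[of _ y]) auto
qed

section \<open>Degree zero: the cokernel and fixed-point-free endofunctions\<close>

lemma finite_fpf_endos [simp]: "finite I \<Longrightarrow> finite (fpf_endos I)"
  by (rule finite_subset[of _ "I \<rightarrow>\<^sub>E I"]) (auto simp: fpf_endos_def finite_PiE)

lemma finite_fpf_above [simp]: "finite I \<Longrightarrow> finite (fpf_above I A)"
  by (simp add: fpf_above_def)

lemma fpf_proj_closed: "Poly_Mapping.keys (fpf_proj I A) \<subseteq> fpf_endos I"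
  unfolding fpf_proj_def by (rule keys_sum_subset) (auto simp: fpf_above_def)

text \<open>This is the relation in the cokernel at \<open>i\<close>, that the sum over all values
  vanishes. The loop adds one sign and leaves the value at \<open>i\<close> free, and
  \<open>sum.group\<close> sorts the functions by that value.\<close>

lemma fpf_proj_loop:
  assumes I: "finite I" and A: "A \<subseteq> I \<times> I" "i \<notin> Domain A" "i \<in> I"
  shows "fpf_proj I (insert (i, i) A) = - (\<Sum>u\<in>I - {i}. fpf_proj I (insert (i, u) A))"
proof -
  let ?L = "\<lambda>A. {x. (x, x) \<in> A}"
  let ?s = "(-1) ^ card (?L A) :: 'b"
  have fin: "finite (?L A)" by (rule finite_subset[of _ I]) (use I A in auto)
  have "?L (insert (i, i) A) = insert i (?L A)" by auto
  moreover have "i \<notin> ?L A" using A by auto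
  ultimately have "card (?L (insert (i, i) A)) = Suc (card (?L A))"
    using fin by simp
  moreover have "fpf_above I (insert (i, i) A) = fpf_above I A" by (auto simp: fpf_above_def)
  ultimately have "fpf_proj I (insert (i, i) A) = - (\<Sum>g\<in>fpf_above I A. Poly_Mapping.single g ?s)"
    by (simp add: fpf_proj_def single_uminus sum_negf)
  also have "(\<Sum>g\<in>fpf_above I A. Poly_Mapping.single g ?s) =
      (\<Sum>u\<in>I - {i}. \<Sum>g\<in>{g\<in>fpf_above I A. g i = u}. Poly_Mapping.single g ?s)"
  proof (rule sum.group[symmetric])
    show "(\<lambda>g. g i) ` fpf_above I A \<subseteq> I - {i}"
      using A by (auto simp: fpf_above_def fpf_endos_def)
  qed (use I in simp_all)
  also have "\<dots> = (\<Sum>u\<in>I - {i}. fpf_proj I (insert (i, u) A))"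
  proof (rule sum.cong[OF refl])
    fix u assume u: "u \<in> I - {i}"
    have "?L (insert (i, u) A) = ?L A" using u by auto
    moreover have "{g\<in>fpf_above I A. g i = u} = fpf_above I (insert (i, u) A)"
      using u by (auto simp: fpf_above_def)
    ultimately show "(\<Sum>g\<in>{g\<in>fpf_above I A. g i = u}. Poly_Mapping.single g ?s)
        = fpf_proj I (insert (i, u) A)"
      by (simp add: fpf_proj_def)
  qed
  finally show ?thesis .
qed

text \<open>In degree one a single point is undefined and the differential sums over its possible
  values; the loop cancels the rest.\<close>

lemma fpf_proj_pendo_diff:
  assumes I: "finite I" and A: "A \<in> pendo I 1"
  shows "lin_ext (fpf_proj I) (pendo_diff h I A) = (0 :: ('v \<Rightarrow> 'v) \<Rightarrow>\<^sub>0 'k::field)"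
proof -
  have "card (I - Domain A) = 1" using A by (simp add: pendo_def)
  then obtain x where x: "I - Domain A = {x}" by (rule card_1_singletonE)
  then have xI: "x \<in> I" "x \<notin> Domain A" "A \<subseteq> I \<times> I" using A by (auto simp: pendo_def)
  have "(\<Sum>v\<in>I. fpf_proj I (insert (x, v) A)) = (0 :: ('v \<Rightarrow> 'v) \<Rightarrow>\<^sub>0 'k)"
    using I xI fpf_proj_loop[of I A x, where 'b = 'k] by (subst sum.remove[of _ x]) auto
  moreover have "lin_ext (fpf_proj I) (pendo_diff h I A)
      = pm_scale (- rsgn h {x} x) (\<Sum>v\<in>I. fpf_proj I (insert (x, v) A) :: _ \<Rightarrow>\<^sub>0 'k)"
    using x by (simp add: pendo_diff_def lin_ext_sum pm_scale_sum)
  ultimately show ?thesis by simp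
qed

lemma fpf_proj_graph:
  assumes "g \<in> fpf_endos I"
  shows "fpf_proj I (graph_rel I g) = Poly_Mapping.single g 1"
proof -
  have "{x. (x, x) \<in> graph_rel I g} = {}"
    using assms by (auto simp: graph_rel_def fpf_endos_def)
  moreover have "fpf_above I (graph_rel I g) = {g}"
  proof (intro equalityI subsetI)
    fix f assume "f \<in> fpf_above I (graph_rel I g)"
    then have "f \<in> I \<rightarrow>\<^sub>E I" "\<And>x. x \<in> I \<Longrightarrow> f x = g x" and "g \<in> I \<rightarrow>\<^sub>E I"
      using assms by (auto simp: fpf_above_def graph_rel_def fpf_endos_def)
    then show "f \<in> {g}" by (auto intro: PiE_ext)
  qed (use assms in \<open>auto simp: fpf_above_def graph_rel_def\<close>)
  ultimately show ?thesis by (simp add: fpf_proj_def)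
qed

lemma graph_rel_in_pendo: "g \<in> fpf_endos I \<Longrightarrow> graph_rel I g \<in> pendo I 0"
proof -
  assume g: "g \<in> fpf_endos I"
  then have "I - Domain (graph_rel I g) = {}" by (auto simp: graph_rel_def)
  then have "card (I - Domain (graph_rel I g)) = 0" by (metis card.empty)
  with g show ?thesis
    by (auto simp: pendo_def graph_rel_def fpf_endos_def single_valued_def)
qed

text \<open>Taking graphs is a section of \<open>fpf_proj\<close>, and modulo boundaries every total
  \<open>A\<close> is the section of its projection. The induction removes one loop at a time: the
  boundary of \<open>A\<close> without the loop trades it for proper edges.\<close>

lemma fpf_proj_split:
  assumes I: "finite I" and A: "A \<in> pendo I 0"
  shows "\<exists>y. Poly_Mapping.keys y \<subseteq> pendo I 1 \<and>
    Poly_Mapping.single A 1 - lin_map (graph_rel I) (fpf_proj I A) = lin_ext (pendo_diff h I) (y :: _ \<Rightarrow>\<^sub>0 'k::field)"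
  using A
proof (induction "card {x. (x, x) \<in> A}" arbitrary: A)
  case 0
  have dom: "Domain A = I" and A: "A \<subseteq> I \<times> I" "single_valued A" "I \<noteq> {}"
    using 0 I by (auto simp: pendo_def)
  have "finite {x. (x, x) \<in> A}" by (rule finite_subset[of _ I]) (use I A in auto)
  with 0 have nl: "(x, x) \<notin> A" for x by auto
  define g where "g = (\<lambda>x\<in>I. THE y. (x, y) \<in> A)"
  have g: "(x, y) \<in> A \<Longrightarrow> g x = y" for x y
    using A by (auto simp: g_def single_valued_def)
  have AI: "x \<in> I \<Longrightarrow> (x, g x) \<in> A" for x using dom g by blast
  have gA: "graph_rel I g = A" using A AI g by (auto simp: graph_rel_def)
  have "g \<in> fpf_endos I"
    unfolding fpf_endos_def using A nl AI by (fastforce simp: g_def)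
  with gA have "fpf_proj I A = Poly_Mapping.single g (1::'k)" using fpf_proj_graph by metis
  then show ?case by (intro exI[of _ 0]) (simp add: gA)
next
  case (Suc n)
  then obtain i where i: "(i, i) \<in> A" by fastforce
  define A0 where "A0 = A - {(i, i)}"
  note rm = pendo_remove[OF I Suc.prems i, folded A0_def]
  have dom: "Domain A = I" and A: "A \<subseteq> I \<times> I" using Suc I by (auto simp: pendo_def)
  have AA: "A = insert (i, i) A0" using i by (auto simp: A0_def)
  have iI: "i \<in> I" using A i by auto
  have card: "card {x. (x, x) \<in> insert (i, u) A0} = n" if "u \<in> I - {i}" for u
  proof -
    have "{x. (x, x) \<in> insert (i, u) A0} = {x. (x, x) \<in> A} - {i}" using that by (auto simp: A0_def)
    then show ?thesis using Suc.hyps(2) i by (simp add: card_Diff_singleton)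
  qed
  have "\<forall>u\<in>I - {i}. \<exists>y. Poly_Mapping.keys y \<subseteq> pendo I 1 \<and>
    Poly_Mapping.single (insert (i, u) A0) 1 - lin_map (graph_rel I) (fpf_proj I (insert (i, u) A0))
      = lin_ext (pendo_diff h I) (y :: _ \<Rightarrow>\<^sub>0 'k)"
    using pendo_insert[OF I rm(1)] rm(2) card
    by (intro ballI Suc.hyps(1)) auto
  then obtain Y :: "_ \<Rightarrow> _ \<Rightarrow>\<^sub>0 'k" where Y: "\<And>u. u \<in> I - {i} \<Longrightarrow> Poly_Mapping.keys (Y u) \<subseteq> pendo I 1"
    "\<And>u. u \<in> I - {i} \<Longrightarrow> lin_ext (pendo_diff h I) (Y u) =
      Poly_Mapping.single (insert (i, u) A0) 1 - lin_map (graph_rel I) (fpf_proj I (insert (i, u) A0))"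
    by metis
  \<comment> \<open>\<open>A0\<close> misses only \<open>i\<close>, so its differential has
    coefficient \<open>-1\<close> throughout and \<open>- A0\<close> contributes \<open>A\<close>
    plus its reroutings; each \<open>Y u\<close> then replaces a rerouting by the section of its
    projection.\<close>
  let ?y = "Poly_Mapping.single A0 (-1) - (\<Sum>u\<in>I - {i}. Y u)"
  have "Poly_Mapping.keys (\<Sum>u\<in>I - {i}. Y u) \<subseteq> pendo I 1"
    by (rule keys_sum_subset) (rule Y)
  moreover have "Poly_Mapping.keys (Poly_Mapping.single A0 (-1) :: _ \<Rightarrow>\<^sub>0 'k) \<subseteq> pendo I 1"
    using rm(1) by simp
  ultimately have 1: "Poly_Mapping.keys ?y \<subseteq> pendo I 1"
    by (intro order_trans[OF Poly_Mapping.keys_diff] Un_least)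
  have "I - Domain A0 = {i}" using rm(2) dom by auto
  then have "pendo_diff h I A0 = - (\<Sum>v\<in>I. Poly_Mapping.single (insert (i, v) A0) (1::'k))"
    by (simp add: pendo_diff_def single_uminus sum_negf)
  also have "(\<Sum>v\<in>I. Poly_Mapping.single (insert (i, v) A0) (1::'k)) =
      Poly_Mapping.single A 1 + (\<Sum>u\<in>I - {i}. Poly_Mapping.single (insert (i, u) A0) 1)"
    using I iI AA by (subst sum.remove[of _ i]) auto
  finally have "lin_ext (pendo_diff h I) ?y = Poly_Mapping.single A 1
      + (\<Sum>u\<in>I - {i}. lin_map (graph_rel I) (fpf_proj I (insert (i, u) A0)))"
    by (simp add: lin_ext_diff lin_ext_sum Y(2) sum_subtractf pm_scale_minus_left)
  also have "\<dots> = Poly_Mapping.single A 1 - lin_map (graph_rel I) (fpf_proj I A)"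
  proof -
    have "A0 \<subseteq> I \<times> I" using A by (auto simp: A0_def)
    then have "fpf_proj I A = - (\<Sum>u\<in>I - {i}. fpf_proj I (insert (i, u) A0) :: _ \<Rightarrow>\<^sub>0 'k)"
      unfolding AA using rm(3) iI by (rule fpf_proj_loop[OF I])
    then show ?thesis by (simp add: lin_map_uminus lin_map_sum)
  qed
  finally show ?case using 1 by metis
qed

text \<open>By \<open>fpf_proj_split\<close>, applied to each key, \<open>z\<close> minus the
  section of its projection is a boundary; a vanishing projection thus makes \<open>z\<close> itself
  one.\<close>

lemma fpf_proj_kernel:
  fixes z :: "'v rel \<Rightarrow>\<^sub>0 'k::field"
  assumes I: "finite I" and z: "Poly_Mapping.keys z \<subseteq> pendo I 0"
  shows "lin_ext (fpf_proj I) z = 0 \<longleftrightarrow>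
    (\<exists>y. Poly_Mapping.keys y \<subseteq> pendo I 1 \<and> lin_ext (pendo_diff h I) y = z)" (is "?L \<longleftrightarrow> ?R")
proof
  assume ?L
  have "\<forall>A\<in>pendo I 0. \<exists>y. Poly_Mapping.keys y \<subseteq> pendo I 1 \<and>
    Poly_Mapping.single A 1 - lin_map (graph_rel I) (fpf_proj I A) = lin_ext (pendo_diff h I) (y :: _ \<Rightarrow>\<^sub>0 'k)"
    using fpf_proj_split[OF I] by blast
  then obtain Y :: "_ \<Rightarrow> _ \<Rightarrow>\<^sub>0 'k" where Y: "\<And>A. A \<in> pendo I 0 \<Longrightarrow> Poly_Mapping.keys (Y A) \<subseteq> pendo I 1"
    "\<And>A. A \<in> pendo I 0 \<Longrightarrow>
      Poly_Mapping.single A 1 - lin_map (graph_rel I) (fpf_proj I A) = lin_ext (pendo_diff h I) (Y A)"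
    by metis
  have "lin_ext (pendo_diff h I) (lin_ext Y z)
      = lin_ext (\<lambda>A. Poly_Mapping.single A 1 - lin_map (graph_rel I) (fpf_proj I A)) z"
    unfolding lin_ext_lin_ext using z Y by (intro lin_ext_cong) auto
  also have "\<dots> = z - lin_map (graph_rel I) (lin_ext (fpf_proj I) z)"
    by (simp only: lin_ext_fun_diff lin_ext_id lin_map_def lin_ext_lin_ext)
  finally have "lin_ext (pendo_diff h I) (lin_ext Y z) = z" using \<open>?L\<close> by simp
  moreover have "Poly_Mapping.keys (lin_ext Y z) \<subseteq> pendo I 1"
    using z Y by (intro keys_lin_ext_subset) blast
  ultimately show ?R by blast
next
  assume ?R
  then obtain y where y: "Poly_Mapping.keys y \<subseteq> pendo I 1" "z = lin_ext (pendo_diff h I) y" by blast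
  have "lin_ext (fpf_proj I) z = lin_ext (\<lambda>A. 0) y"
    unfolding y(2) lin_ext_lin_ext using y(1) fpf_proj_pendo_diff[OF I] by (intro lin_ext_cong) auto
  then show ?L by simp
qed

lemma fpf_proj_onto:
  "lin_ext (fpf_proj I) ` {z. Poly_Mapping.keys z \<subseteq> pendo I 0}
    = {y :: ('v \<Rightarrow> 'v) \<Rightarrow>\<^sub>0 'k::field. Poly_Mapping.keys y \<subseteq> fpf_endos I}" (is "?L = ?R")
proof (intro equalityI subsetI)
  fix y :: "('v \<Rightarrow> 'v) \<Rightarrow>\<^sub>0 'k" assume y: "y \<in> ?R"
  have "lin_ext (fpf_proj I) (lin_map (graph_rel I) y) = lin_ext (\<lambda>g. Poly_Mapping.single g 1) y"
    unfolding lin_map_def lin_ext_lin_ext using y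
    by (intro lin_ext_cong) (auto simp: fpf_proj_graph)
  moreover have "Poly_Mapping.keys (lin_map (graph_rel I) y) \<subseteq> pendo I 0"
    using y graph_rel_in_pendo by (intro keys_lin_map_subset) blast
  ultimately show "y \<in> ?L" by (intro image_eqI[of _ _ "lin_map (graph_rel I) y"]) auto
next
  fix y :: "('v \<Rightarrow> 'v) \<Rightarrow>\<^sub>0 'k" assume "y \<in> ?L"
  then show "y \<in> ?R" using keys_lin_ext_subset[of _ "fpf_proj I"] fpf_proj_closed by blast
qed

lemma card_fpf_endos:
  assumes "finite I"
  shows "card (fpf_endos I) = (if card I \<ge> 2 then (card I - 1) ^ card I else 0)"
proof (cases "I = {}")
  case False
  have "fpf_endos I = (\<Pi>\<^sub>E i\<in>I. I - {i})"
    using False by (auto simp: fpf_endos_def PiE_def Pi_def extensional_def)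
  then have "card (fpf_endos I) = (\<Prod>i\<in>I. card (I - {i}))"
    using assms by (simp add: card_PiE)
  also have "\<dots> = (card I - 1) ^ card I" using assms by simp
  \<comment> \<open>A singleton fits the product formula because \<open>0 ^ 1 = 0\<close>.\<close>
  finally show ?thesis using False assms by (cases "card I = 1") (auto simp: Suc_le_eq neq0_conv nat_neq_iff)
qed (simp add: fpf_endos_def)

section \<open>Trees and cycles as connected partial endofunctions\<close>

text \<open>Connectedness is phrased by subsets closed along edges in both directions instead of by
  paths, so that edges can be added and graphs glued or relabelled without handling a path.\<close>

definition weakly_conn :: "'v set \<Rightarrow> 'v rel \<Rightarrow> bool" where
  "weakly_conn V A \<longleftrightarrow> V \<noteq> {} \<and>
     (\<forall>S\<subseteq>V. S \<noteq> {} \<longrightarrow> (\<forall>(x, y)\<in>A. x \<in> S \<longleftrightarrow> y \<in> S) \<longrightarrow> S = V)"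

lemma weakly_connD:
  assumes "weakly_conn V A" "S \<subseteq> V" "S \<noteq> {}" "\<And>x y. (x, y) \<in> A \<Longrightarrow> x \<in> S \<longleftrightarrow> y \<in> S"
  shows "S = V"
  using assms(1,2,3) assms(4) unfolding weakly_conn_def by blast

lemma weakly_conn_mono: "weakly_conn V A \<Longrightarrow> A \<subseteq> B \<Longrightarrow> weakly_conn V B"
  unfolding weakly_conn_def by (meson subsetD)

lemma weakly_conn_join:
  assumes V: "weakly_conn V A" "A \<subseteq> V \<times> V" and W: "weakly_conn W B" "B \<subseteq> W \<times> W"
    and r: "r \<in> W" and v: "v \<in> V"
  shows "weakly_conn (V \<union> W) (insert (r, v) (A \<union> B))"
  unfolding weakly_conn_def
proof (intro conjI allI impI)
  show "V \<union> W \<noteq> {}" using v by auto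
next
  fix S assume S: "S \<subseteq> V \<union> W" "S \<noteq> {}"
    and closed: "\<forall>(x, y)\<in>insert (r, v) (A \<union> B). x \<in> S \<longleftrightarrow> y \<in> S"
  have "V \<inter> S = V" if "V \<inter> S \<noteq> {}"
    using that closed V(2) by (intro weakly_connD[OF V(1)]) auto
  moreover have "W \<inter> S = W" if "W \<inter> S \<noteq> {}"
    using that closed W(2) by (intro weakly_connD[OF W(1)]) auto
  moreover have "r \<in> S \<longleftrightarrow> v \<in> S" using closed by auto
  ultimately show "S = V \<union> W" using S r v by blast
qed

lemma weakly_conn_image:
  assumes "inj_on \<sigma> V" "A \<subseteq> V \<times> V" "weakly_conn V A"
  shows "weakly_conn (\<sigma> ` V) (map_prod \<sigma> \<sigma> ` A)"
  unfolding weakly_conn_def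
proof (intro conjI allI impI)
  show "\<sigma> ` V \<noteq> {}" using assms(3) by (simp add: weakly_conn_def)
next
  fix S assume S: "S \<subseteq> \<sigma> ` V" "S \<noteq> {}"
    and closed: "\<forall>(x, y)\<in>map_prod \<sigma> \<sigma> ` A. x \<in> S \<longleftrightarrow> y \<in> S"
  have "{x \<in> V. \<sigma> x \<in> S} = V"
    using S closed assms(2) by (intro weakly_connD[OF assms(3)]) force+
  with S show "S = \<sigma> ` V" by blast
qed

section \<open>Rooted trees and cycles described by their edge relations\<close>

lemma out_degree_proj: "out_degree (with_proj G) v = card {e \<in> parcs G. fst e = v}"
  by (simp add: out_degree_def out_arcs_def)

lemma out_degree_proj_0:
  assumes "finite (parcs G)"
  shows "out_degree (with_proj G) v = 0 \<longleftrightarrow> v \<notin> Domain (parcs G)"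
  using assms by (auto simp: out_degree_proj)

lemma out_degree_proj_1:
  assumes "finite (parcs G)"
  shows "out_degree (with_proj G) v = 1 \<longleftrightarrow> (\<exists>!y. (v, y) \<in> parcs G)"
proof -
  have "{e \<in> parcs G. fst e = v} = Pair v ` {y. (v, y) \<in> parcs G}" by force
  then have "out_degree (with_proj G) v = card {y. (v, y) \<in> parcs G}"
    by (simp add: out_degree_proj card_image inj_on_def)
  then show ?thesis by (simp add: card_1_singleton_iff set_eq_iff) metis
qed

text \<open>From weak connectedness to reachability: the vertices with a path to \<open>r\<close>
  form a set closed along edges in both directions, because an edge leaving such a vertex is its
  only one and hence the first of the path.\<close>

lemma is_root_iff:
  assumes "pair_fin_digraph G"
  shows "is_root G r \<longleftrightarrow> single_valued (parcs G) \<and> pverts G - Domain (parcs G) = {r} \<and>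
    weakly_conn (pverts G) (parcs G)" (is "?L \<longleftrightarrow> ?R")
proof -
  interpret pair_fin_digraph G by fact
  let ?V = "pverts G" and ?A = "parcs G"
  note reach = reachable_conv and od = out_degree_proj_0[OF pair_finite_arcs]
    out_degree_proj_1[OF pair_finite_arcs]
  have sub: "?A \<subseteq> ?V \<times> ?V" using wellformed' by auto
  show ?thesis
  proof
    assume L: ?L
    then have r: "r \<in> ?V" "r \<notin> Domain ?A" and one: "\<And>v. v \<in> ?V - {r} \<Longrightarrow> \<exists>!y. (v, y) \<in> ?A"
      and path: "\<And>v. v \<in> ?V \<Longrightarrow> (v, r) \<in> ?A\<^sup>*"
      by (auto simp: is_root_def reach od simp del: One_nat_def)
    have "single_valued ?A"
    proof (rule single_valuedI)
      fix x y z assume xy: "(x, y) \<in> ?A" "(x, z) \<in> ?A"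
      then have "x \<in> ?V - {r}" using r sub by auto
      from one[OF this] xy show "y = z" by blast
    qed
    moreover have "?V - Domain ?A = {r}" using r one by blast
    moreover have "weakly_conn ?V ?A"
      unfolding weakly_conn_def
    proof (intro conjI allI impI)
      show "?V \<noteq> {}" using r by auto
    next
      fix S assume S: "S \<subseteq> ?V" "S \<noteq> {}" and closed: "\<forall>(x, y)\<in>?A. x \<in> S \<longleftrightarrow> y \<in> S"
      have iff: "x \<in> S \<longleftrightarrow> y \<in> S" if "(x, y) \<in> ?A\<^sup>*" for x y
        using that by induction (use closed in auto)
      show "S = ?V" using S iff path by blast
    qed
    ultimately show ?R by blast
  next
    assume R: ?R
    then have r: "r \<in> ?V" "r \<notin> Domain ?A" and sv: "single_valued ?A" by auto
    have "{v \<in> ?V. (v, r) \<in> ?A\<^sup>*} = ?V"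
    proof (rule weakly_connD)
      show "weakly_conn ?V ?A" using R by simp
      fix x y assume xy: "(x, y) \<in> ?A"
      have "(y, r) \<in> ?A\<^sup>*" if "(x, r) \<in> ?A\<^sup>*"
        using that
      proof (cases rule: converse_rtranclE)
        case base then show ?thesis using xy r by auto
      next
        case (step z) then show ?thesis using xy sv by (auto dest: single_valuedD)
      qed
      then show "x \<in> {v \<in> ?V. (v, r) \<in> ?A\<^sup>*} \<longleftrightarrow> y \<in> {v \<in> ?V. (v, r) \<in> ?A\<^sup>*}"
        using xy sub by (auto intro: converse_rtrancl_into_rtrancl)
    qed (use r in auto)
    moreover have "\<exists>!y. (v, y) \<in> ?A" if "v \<in> ?V - {r}" for v
      using that R by (auto simp: single_valued_def)
    ultimately show ?L
      using r by (auto simp: is_root_def reach od simp del: One_nat_def)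
  qed
qed

lemma cycle_of_trees_iff:
  assumes "pair_fin_digraph G"
  shows "cycle_of_trees G \<longleftrightarrow> single_valued (parcs G) \<and> pverts G - Domain (parcs G) = {} \<and>
    weakly_conn (pverts G) (parcs G)"
proof -
  interpret pair_fin_digraph G by fact
  let ?V = "pverts G" and ?A = "parcs G"
  \<comment> \<open>\<open>connected\<close> means strong connectedness of the symmetric closure, so
    paths may use edges in both directions.\<close>
  let ?B = "?A \<union> ?A\<inverse>"
  note od = out_degree_proj_1[OF pair_finite_arcs]
  have sub: "?A \<subseteq> ?V \<times> ?V" using wellformed' by auto
  have pm: "parcs (mk_symmetric (with_proj G)) = ?B" by (auto simp: parcs_mk_symmetric)
  have reach: "u \<rightarrow>\<^sup>*\<^bsub>with_proj (mk_symmetric (with_proj G))\<^esub> v \<longleftrightarrow> (u, v) \<in> ?B\<^sup>* \<inter> (?V \<times> ?V)" for u v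
  proof -
    interpret sym: pair_wf_digraph "mk_symmetric (with_proj G)" by (rule wellformed_mk_symmetric)
    show ?thesis by (simp add: sym.reachable_conv pm)
  qed
  have "connected (with_proj G) \<longleftrightarrow> weakly_conn ?V ?A"
  proof
    assume C: "connected (with_proj G)"
    then have path: "\<And>u v. u \<in> ?V \<Longrightarrow> v \<in> ?V \<Longrightarrow> (u, v) \<in> ?B\<^sup>*" and ne: "?V \<noteq> {}"
      by (auto simp: connected_def strongly_connected_def reach)
    show "weakly_conn ?V ?A"
      unfolding weakly_conn_def
    proof (intro conjI allI impI)
      fix S assume S: "S \<subseteq> ?V" "S \<noteq> {}" and closed: "\<forall>(x, y)\<in>?A. x \<in> S \<longleftrightarrow> y \<in> S"
      have iff: "x \<in> S \<longleftrightarrow> y \<in> S" if "(x, y) \<in> ?B\<^sup>*" for x y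
        using that by induction (use closed in auto)
      show "S = ?V" using S iff path by blast
    qed (rule ne)
  next
    assume W: "weakly_conn ?V ?A"
    have "{v \<in> ?V. (u, v) \<in> ?B\<^sup>*} = ?V" if "u \<in> ?V" for u
    proof (rule weakly_connD[OF W])
      fix x y assume xy: "(x, y) \<in> ?A"
      then have "(x, y) \<in> ?B" "(y, x) \<in> ?B" by auto
      then show "x \<in> {v \<in> ?V. (u, v) \<in> ?B\<^sup>*} \<longleftrightarrow> y \<in> {v \<in> ?V. (u, v) \<in> ?B\<^sup>*}"
        using xy sub by (auto intro: rtrancl_into_rtrancl)
    qed (use that in auto)
    then show "connected (with_proj G)"
      using W by (auto simp: connected_def strongly_connected_def reach weakly_conn_def)
  qed
  moreover have "(\<forall>v\<in>?V. out_degree (with_proj G) v = 1) \<longleftrightarrow> single_valued ?A \<and> ?V - Domain ?A = {}"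
    unfolding od single_valued_def using sub by blast
  ultimately show ?thesis
    using assms unfolding cycle_of_trees_def by blast
qed

lemma pair_fin_digraph_iff:
  "pair_fin_digraph G \<longleftrightarrow> finite (pverts G) \<and> parcs G \<subseteq> pverts G \<times> pverts G"
proof
  assume "finite (pverts G) \<and> parcs G \<subseteq> pverts G \<times> pverts G"
  moreover from this have "finite (parcs G)" using finite_subset finite_cartesian_product by blast
  ultimately show "pair_fin_digraph G" by unfold_locales auto
next
  assume "pair_fin_digraph G"
  then interpret pair_fin_digraph G .
  show "finite (pverts G) \<and> parcs G \<subseteq> pverts G \<times> pverts G"
    using pair_finite_verts wellformed' by auto
qed

section \<open>Generators, their roots, and the terms of grafting and divergence\<close>

fun garcs :: "'v rt_gen \<Rightarrow> 'v rel" where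
  "garcs (Tree T) = parcs T"
| "garcs (DCycle C) = parcs C"

text \<open>A list with at most one entry. Its length is the degree of the suspended generator, and
  concatenated along a word these lists record the order of the odd factors.\<close>

fun groots :: "'v rt_gen \<Rightarrow> 'v list" where
  "groots (Tree T) = [root_of T]"
| "groots (DCycle C) = []"

lemma root_of_eqI: "rooted_tree T \<Longrightarrow> pverts T - Domain (parcs T) = {r} \<Longrightarrow> root_of T = r"
  unfolding rooted_tree_def root_of_def by (rule the_equality) (auto simp: is_root_iff)

abbreviation "RT_basis \<equiv> Tree ` {T. rooted_tree T} \<union> DCycle ` {C. cycle_of_trees C}"

lemma Tree_in_basis_iff: "Tree T \<in> RT_basis \<longleftrightarrow> finite (pverts T) \<and> parcs T \<subseteq> pverts T \<times> pverts T \<and>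
    single_valued (parcs T) \<and> weakly_conn (pverts T) (parcs T) \<and>
    (\<exists>r. pverts T - Domain (parcs T) = {r})"
proof -
  have "Tree T \<in> RT_basis \<longleftrightarrow> rooted_tree T" by auto
  then show ?thesis
    using is_root_iff[of T] by (auto simp: rooted_tree_def pair_fin_digraph_iff)
qed

lemma DCycle_in_basis_iff: "DCycle C \<in> RT_basis \<longleftrightarrow> finite (pverts C) \<and> parcs C \<subseteq> pverts C \<times> pverts C \<and>
    single_valued (parcs C) \<and> weakly_conn (pverts C) (parcs C) \<and> pverts C - Domain (parcs C) = {}"
  using cycle_of_trees_iff[of C] by (auto simp: pair_fin_digraph_iff cycle_of_trees_def)

lemma basisD:
  assumes "g \<in> RT_basis"
  shows "finite (rt_supp g)" "garcs g \<subseteq> rt_supp g \<times> rt_supp g" "single_valued (garcs g)"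
    "weakly_conn (rt_supp g) (garcs g)" "rt_supp g - Domain (garcs g) = set (groots g)"
    "rt_supp g \<noteq> {}" "set (groots g) \<subseteq> rt_supp g"
proof -
  show a: "finite (rt_supp g)" "garcs g \<subseteq> rt_supp g \<times> rt_supp g" "single_valued (garcs g)"
    "weakly_conn (rt_supp g) (garcs g)"
    using assms by (cases g; simp only: Tree_in_basis_iff DCycle_in_basis_iff rt_supp.simps garcs.simps)+
  show b: "rt_supp g - Domain (garcs g) = set (groots g)"
  proof (cases g)
    case (Tree T)
    then obtain r where r: "pverts T - Domain (parcs T) = {r}"
      using assms by (auto simp only: Tree_in_basis_iff)
    moreover have "rooted_tree T" using assms Tree by auto
    ultimately have "root_of T = r" by (rule root_of_eqI[rotated])
    with r Tree show ?thesis by simp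
  next
    case (DCycle C)
    then show ?thesis using assms by (simp only: DCycle_in_basis_iff) simp
  qed
  show "rt_supp g \<noteq> {}" using a(4) by (simp add: weakly_conn_def)
  show "set (groots g) \<subseteq> rt_supp g" using b by blast
qed

lemma sdeg_rt [simp]: "sdeg rt_dgl g = int (length (groots g))"
  by (cases g) (simp_all add: sdeg_def rt_dgl_def)

text \<open>A single term of the pre-Lie product or of the right action, in one notation for both;
  \<open>gclose\<close> is a single term of the divergence.\<close>

fun gjoin :: "'v rt_gen \<Rightarrow> 'v pair_pre_digraph \<Rightarrow> 'v \<Rightarrow> 'v rt_gen" where
  "gjoin (Tree G) T v =
     Tree \<lparr>pverts = pverts G \<union> pverts T, parcs = insert (root_of T, v) (parcs G \<union> parcs T)\<rparr>"
| "gjoin (DCycle G) T v =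
     DCycle \<lparr>pverts = pverts G \<union> pverts T, parcs = insert (root_of T, v) (parcs G \<union> parcs T)\<rparr>"

definition gclose :: "'v pair_pre_digraph \<Rightarrow> 'v \<Rightarrow> 'v rt_gen" where
  "gclose T v = DCycle \<lparr>pverts = pverts T, parcs = insert (root_of T, v) (parcs T)\<rparr>"

lemma gclose_simps [simp]:
  "rt_supp (gclose T v) = pverts T" "garcs (gclose T v) = insert (root_of T, v) (parcs T)"
  "groots (gclose T v) = []"
  by (simp_all add: gclose_def)

lemma gjoin_simps [simp]:
  "rt_supp (gjoin g T v) = rt_supp g \<union> pverts T"
  "garcs (gjoin g T v) = insert (root_of T, v) (garcs g \<union> parcs T)"
  by (cases g; simp)+

lemma gclose_in_basis:
  assumes "Tree T \<in> RT_basis" "v \<in> pverts T"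
  shows "gclose T v \<in> RT_basis"
proof -
  note b = basisD[OF assms(1), simplified]
  have "single_valued (insert (root_of T, v) (parcs T))"
    using b(3,5) by (auto simp: single_valued_def)
  moreover have "weakly_conn (pverts T) (insert (root_of T, v) (parcs T))"
    using b(4) by (rule weakly_conn_mono) auto
  ultimately show ?thesis
    unfolding gclose_def DCycle_in_basis_iff using b assms(2) by auto
qed

text \<open>The new edge uses up the root of \<open>T\<close>, so precisely the roots of
  \<open>g\<close> remain and the kind of \<open>g\<close> is kept.\<close>

lemma gjoin_in_basis:
  assumes "g \<in> RT_basis" "Tree T \<in> RT_basis" "rt_supp g \<inter> pverts T = {}" "v \<in> rt_supp g"
  shows "gjoin g T v \<in> RT_basis" "groots (gjoin g T v) = groots g"
proof -
  let ?V = "rt_supp g \<union> pverts T" and ?A = "insert (root_of T, v) (garcs g \<union> parcs T)"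
  note b = basisD[OF assms(1)] basisD[OF assms(2), simplified]
  have sub: "?A \<subseteq> ?V \<times> ?V" using b assms(4) by auto
  have sv: "single_valued ?A"
  proof (rule single_valuedI)
    fix x y z assume "(x, y) \<in> ?A" "(x, z) \<in> ?A"
    then show "y = z"
      using b(2,3,9,10,12) assms(3) by (auto simp: single_valued_def)
  qed
  have wc: "weakly_conn ?V ?A"
    using b assms(4) by (intro weakly_conn_join) auto
  have dom: "?V - Domain ?A = set (groots g)"
    using b(2,5,9,12) assms(3) by auto
  show in_basis: "gjoin g T v \<in> RT_basis"
  proof (cases g)
    case (Tree G)
    with sub sv wc dom b(1,8) show ?thesis
      by (simp only: gjoin.simps Tree_in_basis_iff) simp
  next
    case (DCycle G)
    with sub sv wc dom b(1,8) show ?thesis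
      by (simp only: gjoin.simps DCycle_in_basis_iff) simp
  qed
  show "groots (gjoin g T v) = groots g"
  proof (cases g)
    case (Tree G)
    then show ?thesis using basisD(5)[OF in_basis] dom by simp
  qed simp
qed

lemma rt_relabel_simps [simp]:
  "rt_supp (rt_relabel \<sigma> g) = \<sigma> ` rt_supp g" "garcs (rt_relabel \<sigma> g) = map_prod \<sigma> \<sigma> ` garcs g"
  "length (groots (rt_relabel \<sigma> g)) = length (groots g)"
  by (cases g; simp add: relabel_graph_def)+

lemma rt_relabel_in_basis:
  assumes g: "g \<in> RT_basis" and inj: "inj_on \<sigma> (rt_supp g)"
  shows "rt_relabel \<sigma> g \<in> RT_basis"
proof -
  note b = basisD[OF g]
  let ?V = "\<sigma> ` rt_supp g" and ?A = "map_prod \<sigma> \<sigma> ` garcs g"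
  have sub: "?A \<subseteq> ?V \<times> ?V" using b(2) by auto
  have sv: "single_valued ?A"
  proof (rule single_valuedI)
    fix x y z assume "(x, y) \<in> ?A" "(x, z) \<in> ?A"
    then obtain a b a' b' where "(a, b) \<in> garcs g" "(a', b') \<in> garcs g" "\<sigma> a = \<sigma> a'"
      "y = \<sigma> b" "z = \<sigma> b'" "x = \<sigma> a" by auto
    moreover from this have "a = a'" using inj b(2) by (auto dest: inj_onD)
    ultimately show "y = z" using b(3) by (auto dest: single_valuedD)
  qed
  have "Domain ?A = \<sigma> ` Domain (garcs g)" by force
  then have dom: "?V - Domain ?A = \<sigma> ` set (groots g)"
    using inj_on_image_set_diff[OF inj, of "rt_supp g" "Domain (garcs g)"] b(2)
    by (auto simp flip: b(5))
  have wc: "weakly_conn ?V ?A" by (rule weakly_conn_image[OF inj b(2,4)])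
  show ?thesis
  proof (cases g)
    case (Tree G)
    with sub sv wc dom b(1) show ?thesis
      by (simp only: rt_relabel.simps Tree_in_basis_iff) (simp add: relabel_graph_def)
  next
    case (DCycle G)
    with sub sv wc dom b(1) show ?thesis
      by (simp only: rt_relabel.simps DCycle_in_basis_iff) (simp add: relabel_graph_def)
  qed
qed

text \<open>The constructor is recovered from the graph: a tree has a vertex without outgoing edge,
  a cycle has none.\<close>

lemma rt_gen_eqI:
  assumes "g \<in> RT_basis" "g' \<in> RT_basis" "rt_supp g = rt_supp g'" "garcs g = garcs g'"
  shows "g = g'"
proof -
  have "set (groots g) = set (groots g')" using basisD(5) assms by metis
  with assms(3,4) show ?thesis by (cases g; cases g') auto
qed

definition grafts :: "'v rt_gen \<Rightarrow> 'v rt_gen \<Rightarrow> ('v rt_gen \<Rightarrow>\<^sub>0 'k::field)" where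
  "grafts g g' = (case g' of Tree T \<Rightarrow> \<Sum>v\<in>rt_supp g. Poly_Mapping.single (gjoin g T v) 1 | DCycle C \<Rightarrow> 0)"

text \<open>A cycle has no root and is never grafted onto anything; with \<open>grafts\<close> zero
  in that case, all cases of the bracket and their signs become one difference.\<close>

lemma rt_brk_grafts: "rt_brk g g' = grafts g g' - grafts g' g"
  by (cases g; cases g') (simp_all add: grafts_def graft_def lin_map_diff lin_map_sum)

lemma rt_diff_Tree: "rt_diff (Tree T) = (\<Sum>v\<in>pverts T. Poly_Mapping.single (gclose T v) 1)"
  by (simp add: divergence_def lin_map_sum gclose_def)

section \<open>Words and oriented partial endofunctions\<close>

definition wf_word :: "'v rt_gen list \<Rightarrow> bool" where
  "wf_word w \<longleftrightarrow> set w \<subseteq> RT_basis \<and> sorted_wrt (\<lambda>a b. rt_supp a \<inter> rt_supp b = {}) w"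

definition wsupp :: "'v rt_gen list \<Rightarrow> 'v set" where
  "wsupp w = (\<Union>g\<in>set w. rt_supp g)"

definition warcs :: "'v rt_gen list \<Rightarrow> 'v rel" where
  "warcs w = (\<Union>g\<in>set w. garcs g)"

definition wroots :: "'v rt_gen list \<Rightarrow> 'v list" where
  "wroots w = concat (map groots w)"

lemma word_simps [simp]:
  "wsupp [] = {}" "wsupp (g # w) = rt_supp g \<union> wsupp w" "wsupp (u @ w) = wsupp u \<union> wsupp w"
  "warcs [] = {}" "warcs (g # w) = garcs g \<union> warcs w" "warcs (u @ w) = warcs u \<union> warcs w"
  "wroots [] = []" "wroots (g # w) = groots g @ wroots w" "wroots (u @ w) = wroots u @ wroots w"
  "wf_word []"
  by (auto simp: wsupp_def warcs_def wroots_def wf_word_def)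

lemma wf_word_Cons [simp]:
  "wf_word (g # w) \<longleftrightarrow> g \<in> RT_basis \<and> rt_supp g \<inter> wsupp w = {} \<and> wf_word w"
  by (auto simp: wf_word_def wsupp_def)

text \<open>The first argument of \<open>rt_words\<close> only fixes the field, which is invisible in the type of a word.\<close>

abbreviation rt_words :: "'k::field itself \<Rightarrow> int \<Rightarrow> 'v set \<Rightarrow> 'v rt_gen list set" where
  "rt_words K m I \<equiv> ce_words (rt_dgl :: ('v, 'v rt_gen, 'k::field) dgl_species) m I"

lemma sum_groots: "i \<le> length w \<Longrightarrow> (\<Sum>k<i. int (length (groots (w ! k)))) = int (length (wroots (take i w)))"
proof (induction i)
  case (Suc i)
  then show ?case by (simp add: take_Suc_conv_app_nth)
qed simp

lemma rt_words_iff: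
  "w \<in> rt_words TYPE('k::field) m I \<longleftrightarrow> w \<noteq> [] \<and> wf_word w \<and> wsupp w = I \<and> int (length (wroots w)) = m"
proof -
  have 1: "(\<Sum>b\<leftarrow>w. int (length (groots b))) = int (length (wroots w))"
    by (induction w) auto
  have 2: "(\<forall>j<length w. \<forall>i<j. rt_supp (w ! i) \<inter> rt_supp (w ! j) = {}) \<longleftrightarrow>
    sorted_wrt (\<lambda>a b. rt_supp a \<inter> rt_supp b = {}) w"
    unfolding sorted_wrt_iff_nth_less by blast
  have 3: "basis rt_dgl = RT_basis" "supp rt_dgl = rt_supp"
    by (simp_all add: rt_dgl_def)
  show ?thesis
    by (simp only: ce_words_def mem_Collect_eq sdeg_rt wf_word_def wsupp_def 1 2 3 conj_assoc)
qed

lemma wf_word_facts: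
  assumes "wf_word w"
  shows "finite (wsupp w)" "warcs w \<subseteq> wsupp w \<times> wsupp w" "single_valued (warcs w)"
    "wsupp w - Domain (warcs w) = set (wroots w)" "distinct (wroots w)" "set (wroots w) \<subseteq> wsupp w"
proof -
  have "finite (wsupp w) \<and> warcs w \<subseteq> wsupp w \<times> wsupp w \<and> single_valued (warcs w) \<and>
    wsupp w - Domain (warcs w) = set (wroots w) \<and> distinct (wroots w)"
    using assms
  proof (induction w)
    case (Cons g w)
    then have g: "g \<in> RT_basis" and disj: "rt_supp g \<inter> wsupp w = {}"
      and IH: "finite (wsupp w)" "warcs w \<subseteq> wsupp w \<times> wsupp w" "single_valued (warcs w)"
        "wsupp w - Domain (warcs w) = set (wroots w)" "distinct (wroots w)"
      by (simp_all only: wf_word_Cons)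
    note b = basisD[OF g]
    have "distinct (groots g)" by (cases g) auto
    moreover have "set (groots g) \<inter> set (wroots w) = {}" using b(7) IH(4) disj by blast
    moreover have "single_valued (garcs g \<union> warcs w)"
      using b(2,3) IH(2,3) disj by (intro single_valuedI) (auto dest: single_valuedD)
    moreover have "rt_supp g \<union> wsupp w - Domain (garcs g \<union> warcs w) = set (groots g) \<union> set (wroots w)"
      using b(2,5) IH(2,4) disj by blast
    ultimately show ?case using b(1,2) IH by auto
  qed simp
  then show "finite (wsupp w)" "warcs w \<subseteq> wsupp w \<times> wsupp w" "single_valued (warcs w)"
    "wsupp w - Domain (warcs w) = set (wroots w)" "distinct (wroots w)" "set (wroots w) \<subseteq> wsupp w"
    by blast+
qed

lemma wsupp_nonempty: "wf_word w \<Longrightarrow> w \<noteq> [] \<Longrightarrow> wsupp w \<noteq> {}"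
  by (cases w) (use basisD(6) in auto)

lemma warcs_in_pendo:
  assumes "w \<in> rt_words TYPE('k::field) m I"
  shows "warcs w \<in> pendo I m"
proof -
  have w: "w \<noteq> []" "wf_word w" "wsupp w = I" "int (length (wroots w)) = m"
    using assms by (auto simp: rt_words_iff)
  note f = wf_word_facts[OF w(2)]
  show ?thesis
    using f(2,3) wsupp_nonempty[OF w(2,1)] distinct_card[OF f(5)] w(4)
    by (simp add: pendo_def w(3)[symmetric] f(4))
qed

text \<open>Supports are non-empty, so disjointness also excludes repetitions. This form is visibly
  invariant under permutations of the word.\<close>

lemma wf_word_iff: "wf_word w \<longleftrightarrow> set w \<subseteq> RT_basis \<and> distinct w \<and>
    (\<forall>a\<in>set w. \<forall>b\<in>set w. a \<noteq> b \<longrightarrow> rt_supp a \<inter> rt_supp b = {})"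
proof (induction w)
  case (Cons g w)
  define P where "P a b \<longleftrightarrow> rt_supp a \<inter> rt_supp b = {}" for a b :: "'a rt_gen"
  define B where "B = (RT_basis :: 'a rt_gen set)"
  have "g \<in> B \<Longrightarrow> \<not> P g g" using basisD(6)[of g] by (simp add: P_def B_def)
  moreover have "P a b \<longleftrightarrow> P b a" for a b by (auto simp: P_def)
  moreover have "rt_supp g \<inter> wsupp w = {} \<longleftrightarrow> (\<forall>b\<in>set w. P g b)" by (auto simp: P_def wsupp_def)
  ultimately show ?case
    unfolding wf_word_Cons Cons.IH P_def[symmetric] B_def[symmetric] by auto
qed simp

text \<open>Allows the factors involved in an operation to be moved to the front of a word.\<close>

lemma rt_words_perm:
  fixes w w' :: "'v rt_gen list"
  assumes "w \<in> rt_words TYPE('k::field) m I" "mset w = mset w'"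
  shows "w' \<in> rt_words TYPE('k) m I" "warcs w' = warcs w"
proof -
  have s: "set w' = set w" using assms(2) by (metis set_mset_mset)
  have d: "distinct w' \<longleftrightarrow> distinct w" using assms(2) by (metis mset_eq_imp_distinct_iff)
  have l: "length (wroots u) = sum_mset (image_mset (\<lambda>g. length (groots g)) (mset u))"
    for u :: "'v rt_gen list"
    by (induction u) auto
  have ne: "w' = [] \<longleftrightarrow> w = []" using s by auto
  show "w' \<in> rt_words TYPE('k) m I"
    using assms unfolding rt_words_iff wf_word_iff l wsupp_def s d ne by simp
  show "warcs w' = warcs w" by (simp add: warcs_def s)
qed

lemma rt_words_close:
  assumes "Tree T # w \<in> rt_words TYPE('k::field) m I" "v \<in> pverts T"
  shows "gclose T v # w \<in> rt_words TYPE('k) (m - 1) I"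
  using assms gclose_in_basis[of T v] by (auto simp: rt_words_iff)

lemma rt_words_join:
  assumes "g # Tree T # w \<in> rt_words TYPE('k::field) m I" "v \<in> rt_supp g"
  shows "gjoin g T v # w \<in> rt_words TYPE('k) (m - 1) I"
proof -
  have a: "g \<in> RT_basis" "Tree T \<in> RT_basis" "rt_supp g \<inter> pverts T = {}"
    using assms by (simp_all add: rt_words_iff Int_Un_distrib)
  show ?thesis
    using assms(1) gjoin_in_basis[OF a assms(2)] unfolding rt_words_iff by auto
qed

text \<open>The sign of the permutation sorting a list along \<open>h\<close>.\<close>

fun lsgn :: "('v \<Rightarrow> nat) \<Rightarrow> 'v list \<Rightarrow> 'k::field" where
  "lsgn h [] = 1"
| "lsgn h (x # xs) = rsgn h (set xs) x * lsgn h xs"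

section \<open>Sorting signs of lists of roots\<close>

lemma lsgn_square [simp]: "lsgn h xs * lsgn h xs = 1" "lsgn h xs * (lsgn h xs * c) = c"
proof -
  show s: "lsgn h xs * lsgn h xs = 1"
    by (induction xs) (simp_all add: mult_ac)
  show "lsgn h xs * (lsgn h xs * c) = c" by (simp add: s flip: mult.assoc)
qed

text \<open>Moving \<open>x\<close> to the front passes each entry of \<open>xs\<close> once, at the
  cost of one sign per entry.\<close>

lemma lsgn_append_Cons:
  assumes "distinct (xs @ x # ys)" "inj_on h (set (xs @ x # ys))"
  shows "lsgn h (xs @ x # ys) = (-1) ^ length xs * rsgn h (set xs \<union> set ys) x * lsgn h (xs @ ys)"
  using assms
proof (induction xs)
  case (Cons a xs)
  let ?S = "set xs \<union> set ys"
  let ?U = "insert a (insert x ?S)"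
  have "rsgn h ?U x * rsgn h (?U - {x}) a = - (rsgn h ?U a * rsgn h (?U - {a}) x :: 'b)"
    using Cons.prems by (intro rsgn_swap) auto
  moreover have "?U - {x} = insert a ?S" "?U - {a} = insert x ?S" "?U = insert x (insert a ?S)"
    using Cons.prems by auto
  ultimately have sw: "rsgn h (insert a ?S) x * rsgn h ?S a = - (rsgn h (insert x ?S) a * rsgn h ?S x :: 'b)"
    by (metis rsgn_delete_self(2))
  have "lsgn h (xs @ x # ys) = (-1) ^ length xs * rsgn h ?S x * (lsgn h (xs @ ys) :: 'b)"
    using Cons.prems by (intro Cons.IH) (auto simp: inj_on_def)
  then have "lsgn h ((a # xs) @ x # ys)
      = (-1) ^ length xs * (rsgn h (insert x ?S) a * rsgn h ?S x) * (lsgn h (xs @ ys) :: 'b)"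
    by (simp add: mult_ac)
  also have "\<dots> = (-1) ^ length xs * (- (rsgn h (insert a ?S) x * rsgn h ?S a)) * (lsgn h (xs @ ys) :: 'b)"
    using sw by simp
  finally show ?case by (simp add: mult_ac)
qed simp

text \<open>The sign of \<open>x\<close> among all roots cancels its contribution to the sorting
  sign; what stays is the Koszul sign for passing the roots before it. This converts the signs of
  \<open>pendo_diff\<close> into those of the Chevalley--Eilenberg differential.\<close>

lemma lsgn_remove:
  assumes "distinct (xs @ x # ys)" "inj_on h (set (xs @ x # ys))"
  shows "lsgn h (xs @ x # ys) * rsgn h (set (xs @ x # ys)) x = (-1) ^ length xs * (lsgn h (xs @ ys) :: 'k::field)"
  unfolding lsgn_append_Cons[OF assms] by (simp add: mult_ac)

lemma lsgn_block:
  assumes "distinct (xs @ groots g @ ys)" "inj_on h (set (xs @ groots g @ ys))"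
  shows "lsgn h (xs @ groots g @ ys) = (-1) ^ (length (groots g) * length xs) * (lsgn h (groots g @ xs @ ys) :: 'k::field)"
proof (cases g)
  case (Tree T)
  then show ?thesis using assms by (simp add: lsgn_append_Cons mult_ac)
qed simp

text \<open>The sign of sorting the roots along \<open>h\<close> compensates the Koszul sign of
  permuting the word, so the linear extension descends to the symmetric power.\<close>

definition orient :: "('v \<Rightarrow> nat) \<Rightarrow> 'v rt_gen list \<Rightarrow> ('v rel \<Rightarrow>\<^sub>0 'k::field)" where
  "orient h w = Poly_Mapping.single (warcs w) (lsgn h (wroots w))"

text \<open>The divergence of one tree in the word accounts for the new edges that start at its root
  and end in the same component.\<close>

lemma diff_summand:
  assumes w: "w \<in> rt_words TYPE('k) m I" and split: "w = a @ Tree T # b" and h: "inj_on h I"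
  shows "lin_ext (orient h) (pm_scale (- ((-1) powi (\<Sum>k<length a. int (length (groots (w ! k))))))
      (lin_map (\<lambda>c. w[length a := c]) (rt_diff (Tree T))))
    = (\<Sum>v\<in>pverts T. Poly_Mapping.single (insert (root_of T, v) (warcs w))
        (- (lsgn h (wroots w) * rsgn h (set (wroots w)) (root_of T)) :: 'k::field))"
proof -
  have wf: "wf_word w" "wsupp w = I" using w by (auto simp: rt_words_iff)
  note f = wf_word_facts[OF wf(1)]
  have r: "wroots w = wroots a @ root_of T # wroots b" by (simp add: split)
  have inj: "inj_on h (set (wroots w))" using f(6) wf(2) h by (auto intro: inj_on_subset)
  have "lsgn h (wroots w) * rsgn h (set (wroots w)) (root_of T)
      = (-1) ^ length (wroots a) * (lsgn h (wroots a @ wroots b) :: 'k)"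
    unfolding r by (rule lsgn_remove) (use f(5) inj r in auto)
  moreover have "(\<Sum>k<length a. int (length (groots (w ! k)))) = int (length (wroots a))"
    by (subst sum_groots) (auto simp: split)
  moreover have "warcs (w[length a := gclose T v]) = insert (root_of T, v) (warcs w)" for v
    by (auto simp: split)
  moreover have "wroots (w[length a := gclose T v]) = wroots a @ wroots b" for v
    by (simp add: split)
  ultimately show ?thesis
    unfolding rt_diff_Tree by (simp add: lin_map_sum lin_ext_sum lin_ext_scale pm_scale_sum orient_def)
qed

lemma nths_compl_two: "nths (a @ g # b @ g' # c) (- {length a, length a + 1 + length b}) = a @ b @ c"
proof -
  have all: "nths xs A = xs" if "\<And>i. i < length xs \<Longrightarrow> i \<in> A" for xs :: "'a list" and A
    unfolding nths_def using that
    by (subst filter_True) (auto simp: set_zip map_fst_zip)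
  show ?thesis
    by (simp add: nths_append nths_Cons all)
qed

text \<open>The two halves of the bracket graft in opposite directions. The factor
  \<open>(-1) ^ length (groots g)\<close> is, in one half, the sign for moving the root of
  \<open>g'\<close> past \<open>g\<close>; in the other half it cancels the minus sign of the
  antisymmetrisation.\<close>

lemma bracket_summand:
  assumes w: "w \<in> rt_words TYPE('k) m I" and split: "w = a @ g # b @ g' # c" and h: "inj_on h I"
    and i: "i = length a" and j: "j = length a + 1 + length b"
  shows "lin_ext (orient h) (pm_scale
       ((-1) powi (int (length (groots (w ! i))) * (\<Sum>k<i. int (length (groots (w ! k)))) +
          int (length (groots (w ! j))) * (\<Sum>k\<in>{..<j} - {i}. int (length (groots (w ! k))))) *
        (-1) powi (rt_deg (w ! i)))
       (lin_map (\<lambda>c. c # nths w (- {i, j})) (rt_brk (w ! i) (w ! j))))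
    = (\<Sum>x\<in>set (groots g). \<Sum>v\<in>rt_supp g'. Poly_Mapping.single (insert (x, v) (warcs w))
        (- (lsgn h (wroots w) * rsgn h (set (wroots w)) x) :: 'k::field))
    + (\<Sum>x\<in>set (groots g'). \<Sum>v\<in>rt_supp g. Poly_Mapping.single (insert (x, v) (warcs w))
        (- (lsgn h (wroots w) * rsgn h (set (wroots w)) x)))"
proof -
  have wf: "wf_word w" "wsupp w = I" using w by (auto simp: rt_words_iff)
  note f = wf_word_facts[OF wf(1)]
  let ?a = "wroots a" and ?b = "wroots b" and ?c = "wroots c" and ?g = "groots g" and ?g' = "groots g'"
  let ?n = "length ?g * length ?a + length ?g' * (length ?a + length ?b)"
  define \<rho> where "\<rho> = wroots w"
  have r: "\<rho> = ?a @ ?g @ ?b @ ?g' @ ?c" by (simp add: split \<rho>_def)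
  have inj: "inj_on h (set \<rho>)" using f(6) wf(2) h by (auto intro: inj_on_subset simp: \<rho>_def)
  have dist: "distinct \<rho>" using f(5) by (simp add: \<rho>_def)
  have nth: "w ! i = g" "w ! j = g'" "i < j" "j < length w"
    using i j by (auto simp: split nth_append)
  have nths: "nths w (- {i, j}) = a @ b @ c" unfolding i j split by (rule nths_compl_two)
  have Pi: "(\<Sum>k<i. int (length (groots (w ! k)))) = int (length ?a)"
    by (subst sum_groots) (auto simp: split i)
  have "(\<Sum>k<j. int (length (groots (w ! k)))) = int (length ?a + length ?g + length ?b)"
    by (subst sum_groots) (auto simp: split j)
  then have Pj: "(\<Sum>k\<in>{..<j} - {i}. int (length (groots (w ! k)))) = int (length ?a + length ?b)"
    using nth by (simp add: sum_diff1)
  \<comment> \<open>The degree is one less than the suspended degree; the resulting minus sign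
    matches the one in \<open>pendo_diff\<close>.\<close>
  have deg: "(-1 :: 'k) powi (rt_deg g) = - ((-1) ^ length ?g)"
    by (cases g) (simp_all add: power_int_minus)
  have exponent: "int (length ?g) * int (length ?a) + int (length ?g') * int (length ?a + length ?b) = int ?n"
    by simp
  have coeff: "(-1) powi (int (length (groots (w ! i))) * (\<Sum>k<i. int (length (groots (w ! k)))) +
          int (length (groots (w ! j))) * (\<Sum>k\<in>{..<j} - {i}. int (length (groots (w ! k))))) *
        (-1) powi (rt_deg (w ! i)) = - ((-1) ^ (?n + length ?g) :: 'k)"
    unfolding nth Pi Pj deg exponent power_int_of_nat by (simp add: power_add)
  have sub: "set (?a @ ?g @ ?b @ ?c) \<subseteq> set \<rho>" "set (?a @ ?b @ ?g' @ ?c) \<subseteq> set \<rho>" using r by auto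
  have basis: "g \<in> RT_basis" "g' \<in> RT_basis" "rt_supp g \<inter> rt_supp g' = {}"
    using wf(1) unfolding wf_word_iff split by (auto simp: wf_word_def sorted_wrt_append)
  have 1: "lin_ext (orient h) (pm_scale (- ((-1) ^ (?n + length ?g))) (lin_map (\<lambda>u. u # a @ b @ c) (grafts g g')))
     = (\<Sum>x\<in>set ?g'. \<Sum>v\<in>rt_supp g. Poly_Mapping.single (insert (x, v) (warcs w))
        (- (lsgn h \<rho> * rsgn h (set \<rho>) x) :: 'k))"
  proof (cases g')
    case (Tree T)
    have "lsgn h \<rho> * rsgn h (set \<rho>) (root_of T)
        = (-1) ^ length (?a @ ?g @ ?b) * (lsgn h ((?a @ ?g @ ?b) @ ?c) :: 'k)"
      using lsgn_remove[where 'k = 'k, of "?a @ ?g @ ?b" "root_of T" ?c h] dist inj by (simp add: r Tree)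
    also have "lsgn h ((?a @ ?g @ ?b) @ ?c) = (-1) ^ (length ?g * length ?a) * (lsgn h (?g @ ?a @ ?b @ ?c) :: 'k)"
      using lsgn_block[where 'k = 'k, of ?a g "?b @ ?c" h] dist inj_on_subset[OF inj sub(1)] by (simp add: r Int_Un_distrib)
    finally have sgn: "lsgn h \<rho> * rsgn h (set \<rho>) (root_of T)
        = (-1) ^ (?n + length ?g) * (lsgn h (?g @ ?a @ ?b @ ?c) :: 'k)"
      by (simp add: Tree power_add mult_ac)
    have "groots (gjoin g T v) = ?g" if "v \<in> rt_supp g" for v
      using gjoin_in_basis(2)[OF basis(1) _ _ that] basis Tree by simp
    moreover have "insert (root_of T, v) (garcs g \<union> parcs T) \<union> (warcs a \<union> (warcs b \<union> warcs c))
        = insert (root_of T, v) (warcs w)" for v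
      using Tree by (auto simp: split)
    ultimately show ?thesis
      unfolding grafts_def
      by (simp add: Tree sgn lin_map_sum lin_ext_sum lin_ext_scale pm_scale_sum orient_def cong: sum.cong)
  qed (simp add: grafts_def)
  have 2: "lin_ext (orient h) (pm_scale (- ((-1) ^ (?n + length ?g))) (lin_map (\<lambda>u. u # a @ b @ c) (grafts g' g)))
     = - (\<Sum>x\<in>set ?g. \<Sum>v\<in>rt_supp g'. Poly_Mapping.single (insert (x, v) (warcs w))
        (- (lsgn h \<rho> * rsgn h (set \<rho>) x) :: 'k))"
  proof (cases g)
    case (Tree T)
    have "lsgn h \<rho> * rsgn h (set \<rho>) (root_of T)
        = (-1) ^ length ?a * (lsgn h (?a @ ?b @ ?g' @ ?c) :: 'k)"
      using lsgn_remove[where 'k = 'k, of ?a "root_of T" "?b @ ?g' @ ?c" h] dist inj by (simp add: r Tree)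
    also have "lsgn h (?a @ ?b @ ?g' @ ?c)
        = (-1) ^ (length ?g' * length (?a @ ?b)) * (lsgn h (?g' @ ?a @ ?b @ ?c) :: 'k)"
      using lsgn_block[where 'k = 'k, of "?a @ ?b" g' ?c h] dist inj_on_subset[OF inj sub(2)] by (simp add: r Int_Un_distrib Int_Un_distrib2)
    finally have sgn: "lsgn h \<rho> * rsgn h (set \<rho>) (root_of T)
        = - ((-1) ^ (?n + length ?g) * (lsgn h (?g' @ ?a @ ?b @ ?c) :: 'k))"
      by (simp add: Tree power_add mult_ac)
    have "groots (gjoin g' T v) = ?g'" if "v \<in> rt_supp g'" for v
      using gjoin_in_basis(2)[OF basis(2) _ _ that] basis Tree by (simp add: Int_commute)
    moreover have "insert (root_of T, v) (garcs g' \<union> parcs T) \<union> (warcs a \<union> (warcs b \<union> warcs c))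
        = insert (root_of T, v) (warcs w)" for v
      using Tree by (auto simp: split)
    ultimately show ?thesis
      unfolding grafts_def
      by (simp add: Tree sgn lin_map_sum lin_ext_sum lin_ext_scale pm_scale_sum orient_def
          single_uminus sum_negf cong: sum.cong)
  qed (simp add: grafts_def)
  show ?thesis
    unfolding coeff unfolding nth nths rt_brk_grafts lin_map_diff pm_scale_diff lin_ext_diff 1 2 \<rho>_def
    by simp
qed

text \<open>Sorts new edges by the components of their two ends: the diagonal is the divergence, the
  pairs off the diagonal form the bracket.\<close>

lemma sum_square_split:
  fixes t :: "nat \<Rightarrow> nat \<Rightarrow> 'a::comm_monoid_add"
  shows "(\<Sum>i<n. \<Sum>j<n. t i j) = (\<Sum>i<n. t i i) + (\<Sum>j<n. \<Sum>i<j. t i j + t j i)"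
  by (induction n) (simp_all add: sum.distrib ac_simps)

section \<open>Compatibility of the boundary with orientations\<close>

abbreviation rt_boundary :: "'v rt_gen list \<Rightarrow> ('v rt_gen list \<Rightarrow>\<^sub>0 'k::field)" where
  "rt_boundary w \<equiv> ce_d1 rt_dgl w + ce_d2 rt_dgl w"

lemma split_at_two:
  assumes "i < j" "j < length w"
  obtains a g b g' c where "w = a @ g # b @ g' # c" "i = length a" "j = length a + 1 + length b"
    "w ! i = g" "w ! j = g'"
proof
  let ?b = "take (j - Suc i) (drop (Suc i) w)"
  have "j - Suc i + Suc i = j" using assms by simp
  then have "drop (Suc i) w = ?b @ drop j w" by (metis append_take_drop_id drop_drop)
  also have "drop j w = w ! j # drop (Suc j) w"
    using assms by (simp add: Cons_nth_drop_Suc)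
  finally show "w = take i w @ w ! i # ?b @ w ! j # drop (Suc j) w"
    using assms id_take_nth_drop[of i w] by simp
qed (use assms in auto)

text \<open>The supports decompose \<open>I\<close> and the root lists decompose the odd points, so
  each edge added by \<open>pendo_diff\<close> belongs to exactly one ordered pair of components;
  \<open>sum_square_split\<close> then separates the two parts of the boundary.\<close>

lemma orient_boundary:
  assumes w: "w \<in> rt_words TYPE('k) m I" and h: "inj_on h I"
  shows "lin_ext (orient h) (rt_boundary w) = lin_ext (pendo_diff h I) (orient h w :: 'v rel \<Rightarrow>\<^sub>0 'k::field)"
proof -
  have wf: "wf_word w" "wsupp w = I" using w by (auto simp: rt_words_iff)
  note f = wf_word_facts[OF wf(1)]
  define F :: "'v \<Rightarrow> 'v \<Rightarrow> 'v rel \<Rightarrow>\<^sub>0 'k" where "F x v = Poly_Mapping.single (insert (x, v) (warcs w))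
        (- (lsgn h (wroots w) * rsgn h (set (wroots w)) x))" for x v
  define t where "t i j = (\<Sum>x\<in>set (groots (w ! i)). \<Sum>v\<in>rt_supp (w ! j). F x v)" for i j
  let ?L = "rt_dgl :: ('v, 'v rt_gen, 'k) dgl_species"
  let ?n = "length w"
  have d1: "lin_ext (orient h) (ce_d1 rt_dgl w) = (\<Sum>i<?n. t i i)"
    unfolding ce_d1_def lin_ext_sum
  proof (intro sum.cong refl)
    fix i assume "i \<in> {..<?n}"
    then have sp: "w = take i w @ w ! i # drop (Suc i) w" "length (take i w) = i"
      using id_take_nth_drop[of i w] by auto
    show "lin_ext (orient h) (pm_scale (- ((-1) powi (\<Sum>k<i. sdeg ?L (w ! k))))
         (lin_map (\<lambda>c. w[i := c]) (diff ?L (w ! i)))) = t i i"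
    proof (cases "w ! i")
      case (Tree T)
      have "diff ?L (w ! i) = (rt_diff (Tree T) :: _ \<Rightarrow>\<^sub>0 'k)" by (simp add: rt_dgl_def Tree)
      then show ?thesis
        using diff_summand[OF w sp(1)[unfolded Tree] h] sp(2) by (simp add: t_def F_def Tree)
    next
      case (DCycle C)
      then show ?thesis by (simp add: t_def rt_dgl_def)
    qed
  qed
  have d2: "lin_ext (orient h) (ce_d2 rt_dgl w) = (\<Sum>j<?n. \<Sum>i<j. t i j + t j i)"
    unfolding ce_d2_def lin_ext_sum
  proof (intro sum.cong refl)
    fix i j assume "j \<in> {..<?n}" "i \<in> {..<j}"
    then have "i < j" "j < ?n" by auto
    then obtain a g b g' c where sp: "w = a @ g # b @ g' # c" "i = length a" "j = length a + 1 + length b"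
      "w ! i = g" "w ! j = g'"
      by (rule split_at_two)
    have "deg ?L (w ! i) = rt_deg (w ! i)"
      "brk ?L (w ! i) (w ! j) = (rt_brk (w ! i) (w ! j) :: _ \<Rightarrow>\<^sub>0 'k)"
      by (simp_all add: rt_dgl_def)
    then show "lin_ext (orient h) (pm_scale
       ((-1) powi (sdeg ?L (w ! i) * (\<Sum>k<i. sdeg ?L (w ! k)) +
          sdeg ?L (w ! j) * (\<Sum>k\<in>{..<j} - {i}. sdeg ?L (w ! k))) * (-1) powi (deg ?L (w ! i)))
       (lin_map (\<lambda>c. c # nths w (- {i, j})) (brk ?L (w ! i) (w ! j)))) = t i j + t j i"
      using bracket_summand[OF w sp(1) h sp(2,3)] unfolding t_def F_def sdeg_rt sp(4,5) by simp
  qed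
  have disj: "rt_supp (w ! i) \<inter> rt_supp (w ! j) = {}" if "i < ?n" "j < ?n" "i \<noteq> j" for i j
    using wf(1) that unfolding wf_word_iff by (metis nth_eq_iff_index_eq nth_mem)
  have basis: "w ! i \<in> RT_basis" if "i < ?n" for i
    using wf(1) that unfolding wf_word_iff by (metis nth_mem subsetD)
  have W: "set w = (!) w ` {..<?n}" by (auto simp: set_conv_nth)
  have roots: "set (wroots w) = (\<Union>i<?n. set (groots (w ! i)))"
    by (simp add: wroots_def W)
  have I: "I = (\<Union>j<?n. rt_supp (w ! j))"
    unfolding wf(2)[symmetric] wsupp_def W by simp
  have "lin_ext (pendo_diff h I) (orient h w) = (\<Sum>x\<in>set (wroots w). \<Sum>v\<in>I. F x v)"
    using f(4) wf(2) by (simp add: orient_def pendo_diff_def F_def pm_scale_sum)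
  also have "\<dots> = (\<Sum>i<?n. \<Sum>x\<in>set (groots (w ! i)). \<Sum>v\<in>I. F x v)"
    unfolding roots
  proof (rule sum.UNION_disjoint)
    show "\<forall>i\<in>{..<?n}. \<forall>j\<in>{..<?n}. i \<noteq> j \<longrightarrow> set (groots (w ! i)) \<inter> set (groots (w ! j)) = {}"
    proof (intro ballI impI)
      fix i j assume ij: "i \<in> {..<?n}" "j \<in> {..<?n}" "i \<noteq> j"
      then have "set (groots (w ! i)) \<subseteq> rt_supp (w ! i)" "set (groots (w ! j)) \<subseteq> rt_supp (w ! j)"
        using basisD(7)[OF basis] by blast+
      with disj[of i j] ij show "set (groots (w ! i)) \<inter> set (groots (w ! j)) = {}" by blast
    qed
  qed auto
  also have "\<dots> = (\<Sum>i<?n. \<Sum>x\<in>set (groots (w ! i)). \<Sum>j<?n. \<Sum>v\<in>rt_supp (w ! j). F x v)"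
  proof (intro sum.cong refl)
    fix x
    show "(\<Sum>v\<in>I. F x v) = (\<Sum>j<?n. \<Sum>v\<in>rt_supp (w ! j). F x v)"
      unfolding I by (rule sum.UNION_disjoint) (simp_all add: disj basisD(1)[OF basis])
  qed
  also have "\<dots> = (\<Sum>i<?n. \<Sum>j<?n. t i j)"
    unfolding t_def by (intro sum.cong refl) (rule sum.swap)
  also have "\<dots> = lin_ext (orient h) (rt_boundary w)"
    unfolding sum_square_split lin_ext_add d1 d2 ..
  finally show ?thesis ..
qed

lemma boundary_in_words:
  assumes w: "w \<in> rt_words TYPE('k) m I"
  shows "Poly_Mapping.keys (rt_boundary w :: _ \<Rightarrow>\<^sub>0 'k::field) \<subseteq> rt_words TYPE('k) (m - 1) I"
proof -
  let ?L = "rt_dgl :: ('v, 'v rt_gen, 'k) dgl_species" and ?W = "rt_words TYPE('k) (m - 1) I"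
  have "Poly_Mapping.keys (lin_map (\<lambda>c. w[i := c]) (diff ?L (w ! i))) \<subseteq> ?W" if i: "i < length w" for i
  proof (cases "w ! i")
    case (Tree T)
    define a b where "a = take i w" and "b = drop (Suc i) w"
    have sp: "w = a @ Tree T # b" "length a = i"
      using i id_take_nth_drop[of i w] by (auto simp: a_def b_def Tree)
    \<comment> \<open>Membership is insensitive to order, so the tree is moved to the head of the
      word, closed there and moved back.\<close>
    have "Tree T # a @ b \<in> rt_words TYPE('k) m I"
      using w by (rule rt_words_perm) (simp add: sp)
    then have close: "gclose T v # a @ b \<in> ?W" if "v \<in> pverts T" for v
      using that by (rule rt_words_close)
    have "a @ gclose T v # b \<in> ?W" if "v \<in> pverts T" for v
      by (rule rt_words_perm(1)[OF close[OF that]]) simp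
    moreover have "w[i := c] = a @ c # b" for c using sp by auto
    moreover have "diff ?L (w ! i) = rt_diff (Tree T)" by (simp add: rt_dgl_def Tree)
    ultimately show ?thesis
      unfolding rt_diff_Tree by (auto simp: lin_map_sum intro!: keys_sum_subset)
  qed (simp add: rt_dgl_def)
  then have d1: "Poly_Mapping.keys (ce_d1 ?L w) \<subseteq> ?W"
    unfolding ce_d1_def by (intro keys_sum_subset order_trans[OF keys_pm_scale]) auto
  have "Poly_Mapping.keys (lin_map (\<lambda>c. c # nths w (- {i, j})) (brk ?L (w ! i) (w ! j))) \<subseteq> ?W"
    if "i < j" "j < length w" for i j
  proof -
    obtain a g b g' c where sp: "w = a @ g # b @ g' # c" "i = length a" "j = length a + 1 + length b"
      "w ! i = g" "w ! j = g'"
      using \<open>i < j\<close> \<open>j < length w\<close> by (rule split_at_two)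
    have nths: "nths w (- {i, j}) = a @ b @ c" unfolding sp(2,3) sp(1) by (rule nths_compl_two)
    have join: "Poly_Mapping.keys (lin_map (\<lambda>u. u # a @ b @ c) (grafts k k' :: _ \<Rightarrow>\<^sub>0 'k)) \<subseteq> ?W"
      if "k # k' # a @ b @ c \<in> rt_words TYPE('k) m I" for k k'
    proof (cases k')
      case (Tree T)
      show ?thesis
        unfolding grafts_def using rt_words_join[OF that[unfolded Tree]]
        by (auto simp: Tree lin_map_sum intro!: keys_sum_subset)
    qed (simp add: grafts_def)
    have "g # g' # a @ b @ c \<in> rt_words TYPE('k) m I" "g' # g # a @ b @ c \<in> rt_words TYPE('k) m I"
      using w by (rule rt_words_perm; simp add: sp(1))+
    then have "Poly_Mapping.keys (lin_map (\<lambda>u. u # a @ b @ c) (rt_brk g g' :: _ \<Rightarrow>\<^sub>0 'k)) \<subseteq> ?W"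
      unfolding rt_brk_grafts lin_map_diff
      by (intro order_trans[OF Poly_Mapping.keys_diff] Un_least join)
    moreover have "brk ?L (w ! i) (w ! j) = rt_brk g g'" by (simp add: rt_dgl_def sp(4,5))
    ultimately show ?thesis by (simp only: nths)
  qed
  then have d2: "Poly_Mapping.keys (ce_d2 ?L w) \<subseteq> ?W"
    unfolding ce_d2_def by (intro keys_sum_subset order_trans[OF keys_pm_scale]) auto
  show ?thesis
    using d1 d2 by (intro order_trans[OF Poly_Mapping.keys_add] Un_least)
qed

text \<open>
  The words of a partial endofunction are the orderings of its connected components.
\<close>

lemma warcs_determines_components:
  assumes "wf_word w" "wf_word w'" "wsupp w = wsupp w'" "warcs w = warcs w'"
  shows "set w \<subseteq> set w'"
proof
  have sub: "rt_supp g \<subseteq> rt_supp g'"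
    if "wf_word u" "wf_word u'" "warcs u = warcs u'" "g \<in> set u" "g' \<in> set u'"
      "rt_supp g \<inter> rt_supp g' \<noteq> {}" for u u' :: "'a rt_gen list" and g g'
  proof -
    note u = that(1)[unfolded wf_word_iff] and u' = that(2)[unfolded wf_word_iff]
    have bas: "k \<in> RT_basis" if "k \<in> set u \<or> k \<in> set u'" for k using that u u' by blast
    have gb: "weakly_conn (rt_supp g) (garcs g)" "garcs g \<subseteq> rt_supp g \<times> rt_supp g"
      by (rule basisD(4)[OF bas[OF disjI1[OF that(4)]]] basisD(2)[OF bas[OF disjI1[OF that(4)]]])+
    \<comment> \<open>Both words have the same edges, so an edge of a component of one never leaves
      a component of the other; weak connectedness does the rest.\<close>
    have "rt_supp g \<inter> rt_supp g' = rt_supp g"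
    proof (rule weakly_connD[OF gb(1)])
      fix x y assume xy: "(x, y) \<in> garcs g"
      then have "(x, y) \<in> warcs u'" using that(3,4) by (auto simp: warcs_def)
      then obtain k where k: "k \<in> set u'" "(x, y) \<in> garcs k" by (auto simp: warcs_def)
      then have xk: "x \<in> rt_supp k" "y \<in> rt_supp k" using basisD(2)[OF bas[of k]] by auto
      have "k = g' \<or> rt_supp k \<inter> rt_supp g' = {}" using u' k(1) that(5) by blast
      then show "x \<in> rt_supp g \<inter> rt_supp g' \<longleftrightarrow> y \<in> rt_supp g \<inter> rt_supp g'"
        using xk xy gb(2) by blast
    qed (use that(6) in auto)
    then show ?thesis by blast
  qed
  have arcs: "garcs g = warcs u \<inter> rt_supp g \<times> rt_supp g" if "wf_word u" "g \<in> set u" for u :: "'a rt_gen list" and g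
  proof -
    note u = that(1)[unfolded wf_word_iff]
    have bas: "k \<in> RT_basis" if "k \<in> set u" for k using that u by blast
    have "(x, y) \<in> garcs g" if "(x, y) \<in> garcs k" "k \<in> set u" "x \<in> rt_supp g" for x y k
    proof -
      have "x \<in> rt_supp k" using basisD(2)[OF bas[OF that(2)]] that(1) by auto
      then have "k = g" using u that(2,3) \<open>g \<in> set u\<close> by blast
      with that show ?thesis by simp
    qed
    then show ?thesis
      using basisD(2)[OF bas[OF that(2)]] that(2) by (auto simp: warcs_def)
  qed
  fix g assume g: "g \<in> set w"
  have bas: "k \<in> RT_basis" if "k \<in> set w \<or> k \<in> set w'" for k
    using that assms(1,2) unfolding wf_word_iff by blast
  obtain x where x: "x \<in> rt_supp g" using basisD(6)[OF bas] g by blast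
  then obtain g' where g': "g' \<in> set w'" "x \<in> rt_supp g'"
    using g assms(3) by (auto simp: wsupp_def)
  have "rt_supp g = rt_supp g'"
    using sub[OF assms(1,2,4) g g'(1)] sub[OF assms(2,1) assms(4)[symmetric] g'(1) g] x g'(2) by blast
  moreover from this have "garcs g = garcs g'"
    using arcs[OF assms(1) g] arcs[OF assms(2) g'(1)] assms(4) by simp
  ultimately have "g = g'" using bas g g'(1) by (intro rt_gen_eqI) auto
  with g' show "g \<in> set w'" by simp
qed

lemma warcs_determines_word:
  assumes "w \<in> rt_words TYPE('k::field) m I" "w' \<in> rt_words TYPE('k) m I" "warcs w = warcs w'"
  shows "mset w = mset w'"
proof -
  have wf: "wf_word w" "wf_word w'" "wsupp w = wsupp w'" using assms(1,2) by (auto simp: rt_words_iff)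
  have "set w = set w'"
    using warcs_determines_components[OF wf assms(3)]
      warcs_determines_components[OF wf(2,1) wf(3)[symmetric] assms(3)[symmetric]] by blast
  then show ?thesis
    using wf unfolding wf_word_iff by (simp add: set_eq_iff_mset_eq_distinct)
qed

text \<open>Built up edge by edge from isolated points. Before its edge is added, \<open>x\<close>
  is the root of a tree; the edge either closes this tree or joins it to the component of
  \<open>v\<close>.\<close>

lemma pendo_is_warcs:
  assumes I: "finite I"
  shows "A \<in> pendo I m \<Longrightarrow> \<exists>w\<in>rt_words TYPE('k::field) m I. warcs w = A"
proof (induction "card A" arbitrary: A m)
  case 0
  have "finite A" using 0 I by (auto simp: pendo_def intro: finite_subset[of _ "I \<times> I"])
  with 0 have A: "A = {}" by simp
  obtain xs where xs: "set xs = I" "distinct xs" using finite_distinct_list[OF I] by blast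
  let ?g = "\<lambda>x. Tree \<lparr>pverts = {x}, parcs = {}\<rparr>"
  have basis: "?g x \<in> RT_basis" for x :: 'a
    unfolding Tree_in_basis_iff weakly_conn_def by auto
  have "distinct ys \<Longrightarrow> wf_word (map ?g ys) \<and> wsupp (map ?g ys) = set ys \<and> warcs (map ?g ys) = {} \<and>
      length (wroots (map ?g ys)) = length ys" for ys :: "'a list"
    using basis by (induction ys) auto
  from this[OF xs(2)] have "map ?g xs \<in> rt_words TYPE('k) m I" "warcs (map ?g xs) = A"
    using 0 A xs by (auto simp: rt_words_iff pendo_def distinct_card)
  then show ?case by blast
next
  case (Suc n)
  have "A \<noteq> {}" using Suc.hyps(2) by auto
  then obtain x v where xv: "(x, v) \<in> A" by (metis ex_in_conv surj_pair)
  define A' where "A' = A - {(x, v)}"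
  have A: "A \<subseteq> I \<times> I" "single_valued A" "I \<noteq> {}" "int (card (I - Domain A)) = m"
    using Suc.prems by (auto simp: pendo_def)
  have fin: "finite A" using A(1) I by (auto intro: finite_subset[of _ "I \<times> I"])
  have x: "x \<in> I" "v \<in> I" "x \<notin> Domain A'" using xv A by (auto simp: A'_def single_valued_def)
  have "I - Domain A' = insert x (I - Domain A)"
    using xv A(1,2) by (auto simp: A'_def single_valued_def)
  moreover have "x \<notin> I - Domain A" using xv by auto
  ultimately have "card (I - Domain A') = Suc (card (I - Domain A))" using I by simp
  moreover have "single_valued A'" "A' \<subseteq> I \<times> I"
    using A(1,2) by (auto simp: A'_def single_valued_def)
  ultimately have A': "A' \<in> pendo I (m + 1)" using A(3,4) unfolding pendo_def by simp
  moreover have "n = card A'" using Suc.hyps(2) fin xv by (simp add: A'_def)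
  ultimately obtain w where w: "w \<in> rt_words TYPE('k) (m + 1) I" "warcs w = A'"
    using Suc.hyps(1)[of A' "m + 1"] by metis
  then have wf: "wf_word w" "wsupp w = I" by (auto simp: rt_words_iff)
  have "x \<in> set (wroots w)" using wf_word_facts(4)[OF wf(1)] wf(2) w(2) x by auto
  then obtain g where g: "g \<in> set w" "x \<in> set (groots g)" by (auto simp: wroots_def)
  obtain T where T: "Tree T \<in> set w" "root_of T = x"
  proof (cases g)
    case (Tree T)
    then show thesis using g that[of T] by simp
  qed (use g in simp)
  obtain k where k: "k \<in> set w" "v \<in> rt_supp k" using x wf(2) by (auto simp: wsupp_def)
  have AA: "A = insert (x, v) A'" using xv by (auto simp: A'_def)
  show ?case
  proof (cases "k = Tree T")
    case True
    obtain u where u: "mset w = mset (Tree T # u)"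
      using T(1) by (metis mset.simps(2) mset_remove1 insert_DiffM set_mset_mset)
    have tu: "Tree T # u \<in> rt_words TYPE('k) (m + 1) I" "warcs (Tree T # u) = A'"
      using rt_words_perm[OF w(1) u] w(2) by auto
    have "gclose T v # u \<in> rt_words TYPE('k) m I"
      using rt_words_close[OF tu(1), of v] k True by simp
    moreover have "warcs (gclose T v # u) = A" using tu(2) AA T(2) by auto
    ultimately show ?thesis by blast
  next
    case False
    obtain u where u: "mset w = mset (k # Tree T # u)"
    proof -
      have "Tree T \<in># mset w - {#k#}" using False T(1) by (simp add: in_diff_count)
      then have "mset w = add_mset k (add_mset (Tree T) (mset w - {#k#} - {#Tree T#}))"
        using k(1) by (simp only: insert_DiffM set_mset_mset)
      moreover obtain u where "mset u = mset w - {#k#} - {#Tree T#}" using ex_mset by blast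
      ultimately show ?thesis using that[of u] by simp
    qed
    have tu: "k # Tree T # u \<in> rt_words TYPE('k) (m + 1) I" "warcs (k # Tree T # u) = A'"
      using rt_words_perm[OF w(1) u] w(2) by auto
    have "gjoin k T v # u \<in> rt_words TYPE('k) m I"
      using rt_words_join[OF tu(1), of v] k by simp
    moreover have "warcs (gjoin k T v # u) = A" using tu(2) AA T(2) by auto
    ultimately show ?thesis by blast
  qed
qed

section \<open>The Chevalley--Eilenberg chains as oriented partial endofunctions\<close>

lemma linear_map_lin_ext:
  fixes f :: "'b \<Rightarrow> 'c \<Rightarrow>\<^sub>0 'k::field"
  assumes "\<And>b. b \<in> B \<Longrightarrow> Poly_Mapping.keys (f b) \<subseteq> C"
  shows "linear_map class_ring (free_space B) (free_space C) (lin_ext f)"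
proof (intro linear_map.intro mod_hom.intro vectorspace_free_space)
  show "module class_ring (free_space B :: ('k, 'b \<Rightarrow>\<^sub>0 'k) module)"
    "module class_ring (free_space C :: ('k, 'c \<Rightarrow>\<^sub>0 'k) module)"
    using vectorspace_free_space by (auto simp: vectorspace_def)
  show "mod_hom_axioms class_ring (free_space B) (free_space C) (lin_ext f)"
  proof
    have "Poly_Mapping.keys (lin_ext f x) \<subseteq> C" if "Poly_Mapping.keys x \<subseteq> B" for x
      using that assms by (intro keys_lin_ext_subset) blast
    then show "lin_ext f \<in> module_hom class_ring (free_space B) (free_space C)"
      by (simp add: module_hom_def lin_ext_add lin_ext_scale)
  qed
qed

section \<open>The Koszul relations as the kernel of the orientation map\<close>

context
  fixes m :: int and I :: "'v set" and h :: "'v \<Rightarrow> nat" and R :: "('v rt_gen list \<Rightarrow>\<^sub>0 'k::field) set"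
  assumes I: "finite I" and h: "inj_on h I" and R_def: "R = ce_rel rt_dgl m I"
begin

private definition "gens = {Poly_Mapping.single w 1 -
        Poly_Mapping.single (w[i := w ! Suc i, Suc i := w ! i])
          ((-1 :: 'k) powi (sdeg (rt_dgl :: ('v, 'v rt_gen, 'k) dgl_species) (w ! i) * sdeg (rt_dgl :: ('v, 'v rt_gen, 'k) dgl_species) (w ! Suc i))) | w i.
      w \<in> rt_words TYPE('k) m I \<and> Suc i < length w}"

private lemma swap_split:
  assumes "w \<in> rt_words TYPE('k) m I" "Suc i < length w"
  obtains u g g' v where "w = u @ g # g' # v" "length u = i"
    "w[i := w ! Suc i, Suc i := w ! i] = u @ g' # g # v" "w ! i = g" "w ! Suc i = g'"
proof
  show sp: "w = take i w @ w ! i # w ! Suc i # drop (Suc (Suc i)) w"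
    using assms(2) by (simp add: Cons_nth_drop_Suc)
  show l: "length (take i w) = i" using assms(2) by simp
  show "w[i := w ! Suc i, Suc i := w ! i] = take i w @ w ! Suc i # w ! i # drop (Suc (Suc i)) w"
    using assms(2) by (subst (1) sp) (simp add: list_update_append)
qed auto

private lemma swap_words: "u @ g # g' # v \<in> rt_words TYPE('k) m I \<Longrightarrow> u @ g' # g # v \<in> rt_words TYPE('k) m I"
  by (erule rt_words_perm(1)) simp

private lemma gens_sub: "gens \<subseteq> carrier (free_space (rt_words TYPE('k) m I))"
proof
  fix x assume "x \<in> gens"
  then obtain w i where w: "w \<in> rt_words TYPE('k) m I" "Suc i < length w" and x: "x = Poly_Mapping.single w 1 -
        Poly_Mapping.single (w[i := w ! Suc i, Suc i := w ! i])
          ((-1 :: 'k) powi (sdeg (rt_dgl :: ('v, 'v rt_gen, 'k) dgl_species) (w ! i) * sdeg (rt_dgl :: ('v, 'v rt_gen, 'k) dgl_species) (w ! Suc i)))"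
    unfolding gens_def by blast
  obtain u g g' v where s: "w = u @ g # g' # v" "w[i := w ! Suc i, Suc i := w ! i] = u @ g' # g # v"
    using swap_split[OF w] by metis
  have "w[i := w ! Suc i, Suc i := w ! i] \<in> rt_words TYPE('k) m I" using swap_words w(1) s by metis
  then show "x \<in> carrier (free_space (rt_words TYPE('k) m I))"
    unfolding x free_space_simps mem_Collect_eq using w(1)
    by (intro order_trans[OF Poly_Mapping.keys_diff] Un_least) auto
qed

private lemma R_span: "R = LinearCombinations.module.span class_ring (free_space (rt_words TYPE('k) m I)) gens"
  unfolding R_def ce_rel_def gens_def ..

private lemma mod_free: "module class_ring (free_space (rt_words TYPE('k) m I) :: ('k, _) module)"
  using vectorspace_free_space by (auto simp: vectorspace_def)

private lemma R_submodule: "submodule class_ring R (free_space (rt_words TYPE('k) m I))"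
  unfolding R_span by (rule module.span_is_submodule[OF mod_free gens_sub])

private lemma R_add: "x \<in> R \<Longrightarrow> y \<in> R \<Longrightarrow> x + y \<in> R"
  and R_zero: "0 \<in> R" and R_scale: "x \<in> R \<Longrightarrow> pm_scale c x \<in> R"
  using submodule.m_closed[OF R_submodule] submodule.zero_closed[OF R_submodule]
    submodule.smult_closed[OF R_submodule] by auto

private lemma R_lin_ext: "(\<And>b. b \<in> Poly_Mapping.keys x \<Longrightarrow> f b \<in> R) \<Longrightarrow> lin_ext f x \<in> R"
proof -
  assume "\<And>b. b \<in> Poly_Mapping.keys x \<Longrightarrow> f b \<in> R"
  then have "(\<Sum>b\<in>S. pm_scale (Poly_Mapping.lookup x b) (f b)) \<in> R" if "S \<subseteq> Poly_Mapping.keys x" for S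
    using that by (induction S rule: infinite_finite_induct) (auto intro: R_add R_zero R_scale)
  then show ?thesis unfolding lin_ext_def by blast
qed

text \<open>Both orders of the roots are compared with the one that has the roots of
  \<open>g'\<close> in front, so \<open>lsgn_block\<close> suffices.\<close>

private lemma lsgn_swap:
  assumes "u @ g # g' # v \<in> rt_words TYPE('k) m I"
  shows "lsgn h (wroots (u @ g # g' # v)) =
    (-1) ^ (length (groots g) * length (groots g')) * (lsgn h (wroots (u @ g' # g # v)) :: 'k)"
proof -
  have wf: "wf_word (u @ g # g' # v)" "wsupp (u @ g # g' # v) = I" using assms by (auto simp: rt_words_iff)
  note f = wf_word_facts[OF wf(1)]
  have d: "distinct (wroots u @ groots g @ groots g' @ wroots v)" using f(5) by simp
  have inj: "inj_on h (set (wroots u) \<union> (set (groots g) \<union> (set (groots g') \<union> set (wroots v))))"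
    using f(6) wf(2) by (intro inj_on_subset[OF h]) simp
  have 1: "lsgn h ((wroots u @ groots g) @ groots g' @ wroots v) =
     (-1) ^ (length (groots g') * length (wroots u @ groots g)) *
       (lsgn h (groots g' @ (wroots u @ groots g) @ wroots v) :: 'k)"
    using d inj by (intro lsgn_block) (auto simp: Un_ac)
  have 2: "lsgn h (wroots u @ groots g' @ groots g @ wroots v) =
     (-1) ^ (length (groots g') * length (wroots u)) *
       (lsgn h (groots g' @ wroots u @ groots g @ wroots v) :: 'k)"
    using d inj by (intro lsgn_block) (auto simp: Un_ac)
  show ?thesis
    using 1 2 by (simp add: power_add distrib_left mult_ac)
qed

private lemma gen_relation:
  assumes "u @ g # g' # v \<in> rt_words TYPE('k) m I"
  shows "Poly_Mapping.single (u @ g # g' # v) 1 - Poly_Mapping.single (u @ g' # g # v)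
      ((-1) ^ (length (groots g) * length (groots g'))) \<in> gens"
proof -
  let ?w = "u @ g # g' # v" and ?i = "length u"
  have a: "(-1 :: 'k) powi (int (length (groots g)) * int (length (groots g'))) =
    (-1) ^ (length (groots g) * length (groots g'))"
    by (metis of_nat_mult power_int_of_nat)
  have "?w ! ?i = g" "?w ! Suc ?i = g'" "?w[?i := g', Suc ?i := g] = u @ g' # g # v"
    by (auto simp: nth_append list_update_append)
  with assms a show ?thesis
    unfolding gens_def sdeg_rt by (intro CollectI exI[of _ ?w] exI[of _ ?i]) simp
qed

text \<open>Equality modulo the relations after scaling each word by its sorting sign. The scaling
  absorbs the Koszul signs, so this is an equivalence relation under which neighbours may be
  exchanged without a sign.\<close>

private definition "E w w' \<longleftrightarrow>
  Poly_Mapping.single w (lsgn h (wroots w)) - Poly_Mapping.single w' (lsgn h (wroots w')) \<in> R"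

private lemma E_refl: "E w w" by (simp add: E_def R_zero)

private lemma E_sym: "E w w' \<Longrightarrow> E w' w"
  unfolding E_def using R_scale[of _ "-1"] by (fastforce simp: pm_scale_minus_left)

private lemma E_trans: "E w w' \<Longrightarrow> E w' w'' \<Longrightarrow> E w w''"
  unfolding E_def by (drule (1) R_add) simp

private lemma E_swap:
  assumes "u @ g # g' # v \<in> rt_words TYPE('k) m I"
  shows "E (u @ g # g' # v) (u @ g' # g # v)"
proof -
  let ?w = "u @ g # g' # v" and ?w' = "u @ g' # g # v" and ?e = "(-1 :: 'k) ^ (length (groots g) * length (groots g'))"
  have "Poly_Mapping.single ?w 1 - Poly_Mapping.single ?w' ?e \<in> R"
    unfolding R_span by (rule subsetD[OF module.in_own_span[OF mod_free gens_sub]]) (rule gen_relation[OF assms])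
  from R_scale[OF this, of "lsgn h (wroots ?w)"]
  have "Poly_Mapping.single ?w (lsgn h (wroots ?w)) - Poly_Mapping.single ?w' (lsgn h (wroots ?w) * ?e) \<in> R"
    by (simp only: pm_scale_diff pm_scale_single mult_1_right)
  moreover have "lsgn h (wroots ?w) * ?e = lsgn h (wroots ?w')"
    unfolding lsgn_swap[OF assms] by (simp add: mult_ac flip: power_mult_distrib)
  ultimately show ?thesis by (simp only: E_def)
qed

private lemma E_move: "u @ x @ g # y \<in> rt_words TYPE('k) m I \<Longrightarrow> E (u @ x @ g # y) (u @ g # x @ y)"
proof (induction x arbitrary: u)
  case (Cons a x)
  have "E ((u @ [a]) @ x @ g # y) ((u @ [a]) @ g # x @ y)" using Cons.prems by (intro Cons.IH) simp
  moreover have "u @ a # g # x @ y \<in> rt_words TYPE('k) m I" using Cons.prems by (rule rt_words_perm) simp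
  then have "E (u @ a # g # x @ y) (u @ g # a # x @ y)" by (rule E_swap)
  ultimately show ?case using E_trans by simp
qed (simp add: E_refl)

private lemma E_perm: "u @ w \<in> rt_words TYPE('k) m I \<Longrightarrow> mset w = mset w' \<Longrightarrow> E (u @ w) (u @ w')"
proof (induction w arbitrary: u w')
  case Nil
  then show ?case by (simp add: E_refl)
next
  case (Cons g w)
  then have "g \<in> set w'" by (metis list.set_intros(1) set_mset_mset)
  then obtain x y where w': "w' = x @ g # y" by (meson split_list)
  have "E ((u @ [g]) @ w) ((u @ [g]) @ x @ y)" using Cons.prems w' by (intro Cons.IH) auto
  moreover have "u @ x @ g # y \<in> rt_words TYPE('k) m I"
    using Cons.prems(1) by (rule rt_words_perm) (use Cons.prems(2) w' in simp)
  then have "E (u @ g # x @ y) (u @ x @ g # y)" by (rule E_sym[OF E_move])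
  ultimately show ?case using E_trans w' by simp
qed

text \<open>One inclusion is the sign rule for adjacent exchanges. For the other, words with the
  same edges are permutations of each other and hence proportional modulo \<open>R\<close>; one
  chosen word per partial endofunction gives a section \<open>s\<close>, and every \<open>x\<close>
  is congruent to the section of its image.\<close>

private lemma kernel_eq: "R = {x \<in> carrier (free_space (rt_words TYPE('k) m I)). lin_ext (orient h) x = 0}"
proof
  have "linear_map class_ring (free_space (rt_words TYPE('k) m I)) (free_space (pendo I m)) (lin_ext (orient h :: _ \<Rightarrow> _ \<Rightarrow>\<^sub>0 'k))"
    by (rule linear_map_lin_ext) (auto simp: orient_def dest: warcs_in_pendo split: if_splits)
  then interpret lm: linear_map class_ring "free_space (rt_words TYPE('k) m I)" "free_space (pendo I m)"
    "lin_ext (orient h :: _ \<Rightarrow> _ \<Rightarrow>\<^sub>0 'k)" .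
  have ker: "lm.ker = {x \<in> carrier (free_space (rt_words TYPE('k) m I)). lin_ext (orient h) x = (0 :: _ \<Rightarrow>\<^sub>0 'k)}"
    by (simp add: lm.ker_def)
  have "gens \<subseteq> lm.ker"
  proof
    fix x assume x: "x \<in> gens"
    then obtain w i where w: "w \<in> rt_words TYPE('k) m I" "Suc i < length w" and xe: "x = Poly_Mapping.single w 1 -
          Poly_Mapping.single (w[i := w ! Suc i, Suc i := w ! i])
            ((-1 :: 'k) powi (sdeg (rt_dgl :: ('v, 'v rt_gen, 'k) dgl_species) (w ! i) * sdeg (rt_dgl :: ('v, 'v rt_gen, 'k) dgl_species) (w ! Suc i)))"
      unfolding gens_def by blast
    obtain u g g' v where s: "w = u @ g # g' # v" "w[i := w ! Suc i, Suc i := w ! i] = u @ g' # g # v"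
      "w ! i = g" "w ! Suc i = g'"
      using swap_split[OF w] by metis
    have a: "(-1 :: 'k) powi (int (length (groots g)) * int (length (groots g'))) =
      (-1) ^ (length (groots g) * length (groots g'))"
      by (metis of_nat_mult power_int_of_nat)
    have xe': "x = Poly_Mapping.single (u @ g # g' # v) 1 - Poly_Mapping.single (u @ g' # g # v)
      ((-1) ^ (length (groots g) * length (groots g')))"
      unfolding xe s(2) unfolding s(3,4) sdeg_rt a unfolding s(1) ..
    have "lin_ext (orient h) x = (0 :: _ \<Rightarrow>\<^sub>0 'k)"
      unfolding xe' lin_ext_diff lin_ext_single orient_def lsgn_swap[OF w(1)[unfolded s(1)]]
      by (simp add: Un_ac)
    then show "x \<in> lm.ker" using gens_sub x unfolding ker by blast
  qed
  then have "R \<subseteq> lm.ker"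
    unfolding R_span by (intro module.span_is_subset[OF mod_free] lm.ker_is_submodule)
  then show "R \<subseteq> {x \<in> carrier (free_space (rt_words TYPE('k) m I)). lin_ext (orient h) x = 0}" unfolding ker .
next
  have "\<forall>A\<in>pendo I m. \<exists>w\<in>rt_words TYPE('k) m I. warcs w = A" using pendo_is_warcs[OF I] by blast
  then obtain c where c: "\<And>A. A \<in> pendo I m \<Longrightarrow> c A \<in> rt_words TYPE('k) m I" "\<And>A. A \<in> pendo I m \<Longrightarrow> warcs (c A) = A"
    by metis
  define s where "s A = Poly_Mapping.single (c A) (lsgn h (wroots (c A)) :: 'k)" for A
  have rep: "Poly_Mapping.single w 1 - lin_ext s (orient h w) \<in> R" if w: "w \<in> rt_words TYPE('k) m I" for w
  proof -
    have A: "warcs w \<in> pendo I m" using w by (rule warcs_in_pendo)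
    have "mset w = mset (c (warcs w))"
      using warcs_determines_word[OF w c(1)[OF A]] c(2)[OF A] by simp
    then have "E w (c (warcs w))" using E_perm[of "[]" w] w by simp
    then have "pm_scale (lsgn h (wroots w)) (Poly_Mapping.single w (lsgn h (wroots w)) - s (warcs w)) \<in> R"
      unfolding E_def s_def by (rule R_scale)
    then show ?thesis by (simp add: pm_scale_diff orient_def)
  qed
  show "{x \<in> carrier (free_space (rt_words TYPE('k) m I)). lin_ext (orient h) x = 0} \<subseteq> R"
  proof
    fix x assume "x \<in> {x \<in> carrier (free_space (rt_words TYPE('k) m I)). lin_ext (orient h) x = (0 :: _ \<Rightarrow>\<^sub>0 'k)}"
    then have x: "Poly_Mapping.keys x \<subseteq> rt_words TYPE('k) m I" "lin_ext (orient h) x = (0 :: _ \<Rightarrow>\<^sub>0 'k)" by auto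
    have "lin_ext (\<lambda>w. Poly_Mapping.single w 1 - lin_ext s (orient h w)) x \<in> R"
      using x(1) rep by (intro R_lin_ext) blast
    then have "x - lin_ext s (lin_ext (orient h) x) \<in> R"
      by (simp only: lin_ext_fun_diff lin_ext_id lin_ext_lin_ext)
    then show "x \<in> R" by (simp add: x(2))
  qed
qed

lemma chains_presentation:
  "quot_presentation (free_space (rt_words TYPE('k) m I)) (free_space (pendo I m)) (lin_ext (orient h :: _ \<Rightarrow> _ \<Rightarrow>\<^sub>0 'k)) R"
proof (intro quot_presentation.intro quot_presentation_axioms.intro)
  show "linear_map class_ring (free_space (rt_words TYPE('k) m I)) (free_space (pendo I m)) (lin_ext (orient h :: _ \<Rightarrow> _ \<Rightarrow>\<^sub>0 'k))"
    by (rule linear_map_lin_ext) (auto simp: orient_def dest: warcs_in_pendo split: if_splits)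
  then interpret lm: linear_map class_ring "free_space (rt_words TYPE('k) m I)" "free_space (pendo I m)"
    "lin_ext (orient h :: _ \<Rightarrow> _ \<Rightarrow>\<^sub>0 'k)" .
  show "R = {x \<in> carrier (free_space (rt_words TYPE('k) m I)). lin_ext (orient h) x = \<zero>\<^bsub>free_space (pendo I m)\<^esub>}"
    using kernel_eq by simp
  show "lin_ext (orient h) ` carrier (free_space (rt_words TYPE('k) m I)) = carrier (free_space (pendo I m) :: ('k, _) module)"
  proof (intro equalityI subsetI)
    fix y assume "y \<in> carrier (free_space (pendo I m) :: ('k, _) module)"
    then have y: "Poly_Mapping.keys y \<subseteq> pendo I m" by simp
    have "\<forall>A\<in>pendo I m. \<exists>w\<in>rt_words TYPE('k) m I. warcs w = A" using pendo_is_warcs[OF I] by blast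
    then obtain c where c: "\<And>A. A \<in> pendo I m \<Longrightarrow> c A \<in> rt_words TYPE('k) m I" "\<And>A. A \<in> pendo I m \<Longrightarrow> warcs (c A) = A"
      by metis
    let ?s = "\<lambda>A. Poly_Mapping.single (c A) (lsgn h (wroots (c A)) :: 'k)"
    have "lin_ext (orient h) (lin_ext ?s y) = lin_ext (\<lambda>A. Poly_Mapping.single A 1) y"
      unfolding lin_ext_lin_ext using y c by (intro lin_ext_cong) (auto simp: orient_def)
    moreover have "Poly_Mapping.keys (lin_ext ?s y) \<subseteq> rt_words TYPE('k) m I"
      using y c(1) by (intro keys_lin_ext_subset) auto
    ultimately show "y \<in> lin_ext (orient h) ` carrier (free_space (rt_words TYPE('k) m I))"
      by (intro image_eqI[of _ _ "lin_ext ?s y"]) auto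
  next
    fix y assume "y \<in> lin_ext (orient h) ` carrier (free_space (rt_words TYPE('k) m I) :: ('k, _) module)"
    then show "y \<in> carrier (free_space (pendo I m))" using lm.T_im by blast
  qed
qed

end

section \<open>Cycles, boundaries and homology in terms of partial endofunctions\<close>

abbreviation rt_fib :: "('v \<Rightarrow> nat) \<Rightarrow> int \<Rightarrow> 'v set \<Rightarrow> ('v rel \<Rightarrow>\<^sub>0 'k::field) \<Rightarrow> ('v rt_gen list \<Rightarrow>\<^sub>0 'k) set" where
  "rt_fib h m I \<equiv> quot_presentation.fib (free_space (rt_words TYPE('k) m I)) (lin_ext (orient h))"

lemma linear_map_pendo_diff:
  assumes "finite I"
  shows "linear_map class_ring (free_space (pendo I m)) (free_space (pendo I (m - 1)))
    (lin_ext (pendo_diff h I :: _ \<Rightarrow> _ \<Rightarrow>\<^sub>0 'k::field))"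
  by (rule linear_map_lin_ext) (rule pendo_diff_closed[OF assms])

lemma boundary_fib:
  fixes z :: "'v rel \<Rightarrow>\<^sub>0 'k::field"
  assumes I: "finite I" and h: "inj_on h I" and z: "Poly_Mapping.keys z \<subseteq> pendo I m"
  shows "ce_boundary rt_dgl m I (rt_fib h m I z) = rt_fib h (m - 1) I (lin_ext (pendo_diff h I) z)"
  unfolding ce_boundary_def
proof (rule quot_map_fib[OF chains_presentation[OF I h refl] chains_presentation[OF I h refl]])
  fix x :: "'v rt_gen list \<Rightarrow>\<^sub>0 'k" assume "x \<in> carrier (free_space (rt_words TYPE('k) m I))"
  then have x: "Poly_Mapping.keys x \<subseteq> rt_words TYPE('k) m I" by simp
  have "Poly_Mapping.keys (lin_ext rt_boundary x) \<subseteq> rt_words TYPE('k) (m - 1) I"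
    using x boundary_in_words by (intro keys_lin_ext_subset) blast
  moreover have "lin_ext (orient h) (lin_ext rt_boundary x) = lin_ext (pendo_diff h I) (lin_ext (orient h) x)"
    unfolding lin_ext_lin_ext using x orient_boundary[OF _ h] by (intro lin_ext_cong) blast
  ultimately show "lin_ext rt_boundary x \<in> carrier (free_space (rt_words TYPE('k) (m - 1) I)) \<and>
      lin_ext (orient h) (lin_ext rt_boundary x) = lin_ext (pendo_diff h I) (lin_ext (orient h) x)"
    by simp
qed (use z in simp)

lemma cycles_fib:
  assumes I: "finite I" and h: "inj_on h I"
  shows "carrier (ce_cycles (rt_dgl :: ('v, 'v rt_gen, 'k::field) dgl_species) m I)
    = rt_fib h m I ` {z. Poly_Mapping.keys z \<subseteq> pendo I m \<and> lin_ext (pendo_diff h I) z = 0}" (is "?L = ?R")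
proof -
  interpret q: quot_presentation "free_space (rt_words TYPE('k) m I)" "free_space (pendo I m)"
    "lin_ext (orient h)" "ce_rel rt_dgl m I :: (_ \<Rightarrow>\<^sub>0 'k) set" by (rule chains_presentation[OF I h refl])
  interpret q': quot_presentation "free_space (rt_words TYPE('k) (m - 1) I)" "free_space (pendo I (m - 1))"
    "lin_ext (orient h)" "ce_rel rt_dgl (m - 1) I :: (_ \<Rightarrow>\<^sub>0 'k) set" by (rule chains_presentation[OF I h refl])
  have "rt_fib h (m - 1) I (lin_ext (pendo_diff h I) z) = rt_fib h (m - 1) I 0 \<longleftrightarrow> lin_ext (pendo_diff h I) z = (0 :: _ \<Rightarrow>\<^sub>0 'k)"
    if "Poly_Mapping.keys z \<subseteq> pendo I m" for z
    using lin_ext_pendo_diff_closed[OF I that] by (intro inj_on_eq_iff[OF q'.inj_fib]) auto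
  then show ?thesis
    unfolding ce_cycles_def ce_chains_def
    using q'.zero_quot by (auto simp: q.carrier_quot boundary_fib[OF I h])
qed

lemma boundaries_fib:
  assumes I: "finite I" and h: "inj_on h I"
  shows "ce_boundaries (rt_dgl :: ('v, 'v rt_gen, 'k::field) dgl_species) m I
    = rt_fib h m I ` lin_ext (pendo_diff h I) ` {z. Poly_Mapping.keys z \<subseteq> pendo I (m + 1)}"
proof -
  interpret q: quot_presentation "free_space (rt_words TYPE('k) (m + 1) I)" "free_space (pendo I (m + 1))"
    "lin_ext (orient h)" "ce_rel rt_dgl (m + 1) I :: (_ \<Rightarrow>\<^sub>0 'k) set" by (rule chains_presentation[OF I h refl])
  show ?thesis
    unfolding ce_boundaries_def ce_chains_def q.carrier_quot image_image
    using boundary_fib[OF I h, of _ "m + 1", where 'k = 'k] by (intro image_cong) auto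
qed

text \<open>The empty basis away from degree zero encodes the vanishing, so that one presentation
  covers every degree.\<close>

definition homology_basis :: "int \<Rightarrow> 'v set \<Rightarrow> ('v \<Rightarrow> 'v) set" where
  "homology_basis m I = (if m = 0 then fpf_endos I else {})"

text \<open>A coset is first decoded into a combination of partial endofunctions, on which
  \<open>fpf_proj\<close> is available.\<close>

definition homology_proj :: "('v \<Rightarrow> nat) \<Rightarrow> int \<Rightarrow> 'v set \<Rightarrow> ('v rt_gen list \<Rightarrow>\<^sub>0 'k::field) set \<Rightarrow> (('v \<Rightarrow> 'v) \<Rightarrow>\<^sub>0 'k)" where
  "homology_proj h m I X = (if m = 0
     then lin_ext (fpf_proj I) (the_inv_into (carrier (free_space (pendo I m))) (rt_fib h m I) X) else 0)"

lemma homology_proj_fib: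
  fixes z :: "'v rel \<Rightarrow>\<^sub>0 'k::field"
  assumes I: "finite I" and h: "inj_on h I" and z: "Poly_Mapping.keys z \<subseteq> pendo I m"
  shows "homology_proj h m I (rt_fib h m I z) = (if m = 0 then lin_ext (fpf_proj I) z else 0)"
proof -
  have "the_inv_into (carrier (free_space (pendo I m))) (rt_fib h m I) (rt_fib h m I z) = z"
    by (rule quot_presentation.the_inv_fib[OF chains_presentation[OF I h refl]]) (simp add: z)
  then show ?thesis unfolding homology_proj_def by (simp only:)
qed

text \<open>Exactness enters through the kernel condition: in nonzero degree all cycles are
  boundaries, in degree zero the boundaries are the kernel of \<open>fpf_proj\<close>.\<close>

lemma homology_presentation:
  assumes I: "finite I" and h: "inj_on h I"
  shows "quot_presentation (ce_cycles (rt_dgl :: ('v, 'v rt_gen, 'k::field_char_0) dgl_species) m I)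
    (free_space (homology_basis m I)) (homology_proj h m I) (ce_boundaries rt_dgl m I)"
proof -
  let ?L = "rt_dgl :: ('v, 'v rt_gen, 'k) dgl_species"
  let ?W = "free_space (pendo I m) :: ('k, 'v rel \<Rightarrow>\<^sub>0 'k) module"
  let ?Z = "{z :: 'v rel \<Rightarrow>\<^sub>0 'k. Poly_Mapping.keys z \<subseteq> pendo I m \<and> lin_ext (pendo_diff h I) z = 0}"
  interpret q: quot_presentation "free_space (rt_words TYPE('k) m I)" ?W
    "lin_ext (orient h)" "ce_rel rt_dgl m I :: (_ \<Rightarrow>\<^sub>0 'k) set" by (rule chains_presentation[OF I h refl])
  interpret d: linear_map class_ring ?W "free_space (pendo I (m - 1))" "lin_ext (pendo_diff h I :: _ \<Rightarrow> _ \<Rightarrow>\<^sub>0 'k)"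
    by (rule linear_map_pendo_diff[OF I])
  have "d.ker = ?Z" by (simp add: d.ker_def)
  \<comment> \<open>The kernel of the differential is a subspace of the partial endofunctions;
    transport along \<open>rt_fib\<close> turns this into the vector space structure on cycles of
    cosets.\<close>
  then have vZ: "vectorspace class_ring (?W\<lparr>carrier := ?Z\<rparr>)"
    using q.W.subspace_is_vs[OF d.kerT_is_subspace] by simp
  note cyc = cycles_fib[OF I h, of m, where 'k = 'k]
  have ops: "\<zero>\<^bsub>ce_cycles ?L m I\<^esub> = rt_fib h m I 0"
    "\<And>a b. a \<in> ?Z \<Longrightarrow> b \<in> ?Z \<Longrightarrow>
      rt_fib h m I a \<oplus>\<^bsub>ce_cycles ?L m I\<^esub> rt_fib h m I b = rt_fib h m I (a + b)"
    "\<And>c a. a \<in> ?Z \<Longrightarrow> c \<odot>\<^bsub>ce_cycles ?L m I\<^esub> rt_fib h m I a = rt_fib h m I (pm_scale c a)"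
    using q.zero_quot q.add_quot q.smult_quot by (auto simp: ce_cycles_def ce_chains_def)
  have vC: "vectorspace class_ring (ce_cycles ?L m I)"
    by (rule vectorspace_transport[OF vZ, of _ "rt_fib h m I"]) (simp_all add: cyc ops)
  have vF: "vectorspace class_ring (free_space (homology_basis m I) :: ('k, _) module)"
    by (rule vectorspace_free_space)
  have Zclosed: "a + b \<in> ?Z" "pm_scale c a \<in> ?Z" if "a \<in> ?Z" "b \<in> ?Z" for a b c
    using that by (auto simp: lin_ext_add lin_ext_scale
        dest!: subsetD[OF Poly_Mapping.keys_add] subsetD[OF keys_pm_scale])
  have T: "homology_proj h m I (rt_fib h m I z) = (if m = 0 then lin_ext (fpf_proj I) z else 0)"
    if "z \<in> ?Z" for z using homology_proj_fib[OF I h] that by blast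
  have "mod_hom_axioms class_ring (ce_cycles ?L m I) (free_space (homology_basis m I)) (homology_proj h m I)"
  proof
    define Z where "Z = ?Z"
    define Q where "Q z = (if m = 0 then lin_ext (fpf_proj I) z else 0 :: _ \<Rightarrow>\<^sub>0 'k)" for z
    note ops = ops[folded Z_def] and T = T[folded Z_def Q_def] and Zclosed = Zclosed[folded Z_def]
    have Q: "Poly_Mapping.keys (Q z) \<subseteq> homology_basis m I" "Q (a + b) = Q a + Q b"
      "Q (pm_scale c a) = pm_scale c (Q a)" for a b c z
      using keys_lin_ext_subset[of z "fpf_proj I :: _ \<Rightarrow> _ \<Rightarrow>\<^sub>0 'k"] fpf_proj_closed
      by (auto simp: Q_def homology_basis_def lin_ext_add lin_ext_scale)
    show "homology_proj h m I \<in> module_hom class_ring (ce_cycles ?L m I) (free_space (homology_basis m I))"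
      unfolding module_hom_def cyc Z_def[symmetric]
      by (auto simp: ops T Zclosed Q dest: subsetD[OF Q(1)])
  qed
  then have lin: "linear_map class_ring (ce_cycles ?L m I) (free_space (homology_basis m I)) (homology_proj h m I)"
    using vC vF by (auto simp: linear_map_def mod_hom_def vectorspace_def)
  have onto: "homology_proj h m I ` carrier (ce_cycles ?L m I) = carrier (free_space (homology_basis m I))"
  proof (cases "m = 0")
    case True
    \<comment> \<open>A cardinality is never negative, so everything in degree zero is a
      cycle.\<close>
    have "pendo I (- 1) = {}" by (auto simp: pendo_def)
    then have "lin_ext (pendo_diff h I) z = 0" if "Poly_Mapping.keys z \<subseteq> pendo I 0" for z :: "_ \<Rightarrow>\<^sub>0 'k"
      using lin_ext_pendo_diff_closed[OF I that, of h] by simp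
    then have "?Z = {z. Poly_Mapping.keys z \<subseteq> pendo I 0}" using True by auto
    then have "homology_proj h m I ` carrier (ce_cycles ?L m I) =
        lin_ext (fpf_proj I) ` {z :: _ \<Rightarrow>\<^sub>0 'k. Poly_Mapping.keys z \<subseteq> pendo I 0}"
      unfolding cyc image_image using T True by (intro image_cong) auto
    then show ?thesis using True by (simp add: fpf_proj_onto homology_basis_def)
  next
    case False
    have "0 \<in> ?Z" by simp
    with False show ?thesis
      unfolding cyc image_image using T by (auto simp: homology_basis_def image_iff intro!: exI[of _ 0])
  qed
  have "ce_boundaries ?L m I = rt_fib h m I ` {z \<in> ?Z. (if m = 0 then lin_ext (fpf_proj I) z else 0) = (0 :: _ \<Rightarrow>\<^sub>0 'k)}"
    unfolding boundaries_fib[OF I h]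
  proof (rule arg_cong[of _ _ "(`) (rt_fib h m I)"], intro equalityI subsetI)
    fix z assume "z \<in> lin_ext (pendo_diff h I) ` {y :: _ \<Rightarrow>\<^sub>0 'k. Poly_Mapping.keys y \<subseteq> pendo I (m + 1)}"
    then obtain y where y: "Poly_Mapping.keys y \<subseteq> pendo I (m + 1)" "z = lin_ext (pendo_diff h I) y" by blast
    have "z \<in> ?Z"
      using lin_ext_pendo_diff_closed[OF I y(1), of h] by (simp add: y(2) lin_ext_lin_ext pendo_diff_pendo_diff[OF I h])
    moreover have "lin_ext (fpf_proj I) z = (0 :: _ \<Rightarrow>\<^sub>0 'k)" if "m = 0"
      using fpf_proj_kernel[OF I, of z h] calculation y that by auto
    ultimately show "z \<in> {z \<in> ?Z. (if m = 0 then lin_ext (fpf_proj I) z else 0) = (0 :: _ \<Rightarrow>\<^sub>0 'k)}"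
      by simp
  next
    fix z assume "z \<in> {z \<in> ?Z. (if m = 0 then lin_ext (fpf_proj I) z else 0) = (0 :: _ \<Rightarrow>\<^sub>0 'k)}"
    then have z: "Poly_Mapping.keys z \<subseteq> pendo I m" "lin_ext (pendo_diff h I) z = 0"
      "m = 0 \<Longrightarrow> lin_ext (fpf_proj I) z = (0 :: _ \<Rightarrow>\<^sub>0 'k)" by auto
    have "\<exists>y. Poly_Mapping.keys y \<subseteq> pendo I (m + 1) \<and> lin_ext (pendo_diff h I) y = z"
    proof (cases "m = 0")
      case True
      then show ?thesis using fpf_proj_kernel[OF I, of z h] z by simp
    next
      case False
      then show ?thesis using pendo_diff_exact[OF I h z(1,2)] by blast
    qed
    then show "z \<in> lin_ext (pendo_diff h I) ` {y :: _ \<Rightarrow>\<^sub>0 'k. Poly_Mapping.keys y \<subseteq> pendo I (m + 1)}" by blast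
  qed
  also have "\<dots> = {X \<in> carrier (ce_cycles ?L m I). homology_proj h m I X = \<zero>\<^bsub>free_space (homology_basis m I)\<^esub>}"
    unfolding cyc using T by auto
  finally show ?thesis
    using lin onto by (intro quot_presentation.intro quot_presentation_axioms.intro) auto
qed

section \<open>Naturality\<close>

text \<open>Conjugation by \<open>\<sigma>\<close> is a bijection from the functions above
  \<open>A\<close> to those above its image, and it preserves the number of loops, hence the
  sign.\<close>

lemma fpf_proj_relabel:
  assumes \<sigma>: "bij_betw \<sigma> I J" and A: "A \<subseteq> I \<times> I"
  shows "fpf_proj J (map_prod \<sigma> \<sigma> ` A)
    = lin_map (\<lambda>g. \<lambda>j\<in>J. \<sigma> (g (inv_into I \<sigma> j))) (fpf_proj I A :: _ \<Rightarrow>\<^sub>0 'k::field)"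
proof -
  let ?\<tau> = "inv_into I \<sigma>" and ?c = "\<lambda>g. \<lambda>j\<in>J. \<sigma> (g (inv_into I \<sigma> j))"
  have inj: "inj_on \<sigma> I" and img: "\<sigma> ` I = J" using \<sigma> by (auto simp: bij_betw_def)
  have \<tau>: "i \<in> I \<Longrightarrow> ?\<tau> (\<sigma> i) = i" "j \<in> J \<Longrightarrow> \<sigma> (?\<tau> j) = j" "j \<in> J \<Longrightarrow> ?\<tau> j \<in> I" "i \<in> I \<Longrightarrow> \<sigma> i \<in> J" for i j
    using \<sigma> img by (auto simp: inv_into_f_f[OF inj] f_inv_into_f inv_into_into)
  have eq: "\<sigma> x = \<sigma> y \<longleftrightarrow> x = y" if "x \<in> I" "y \<in> I" for x y using inj that by (auto dest: inj_onD)
  have "{x. (x, x) \<in> map_prod \<sigma> \<sigma> ` A} = \<sigma> ` {x. (x, x) \<in> A}"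
    using A eq by fastforce
  moreover have "inj_on \<sigma> {x. (x, x) \<in> A}" using inj A by (auto intro: inj_on_subset)
  ultimately have card: "card {x. (x, x) \<in> map_prod \<sigma> \<sigma> ` A} = card {x. (x, x) \<in> A}"
    by (simp add: card_image)
  have bij: "bij_betw ?c (fpf_above I A) (fpf_above J (map_prod \<sigma> \<sigma> ` A))"
  proof (rule bij_betw_byWitness[where f' = "\<lambda>g. \<lambda>i\<in>I. ?\<tau> (g (\<sigma> i))"])
    show "\<forall>g\<in>fpf_above I A. (\<lambda>i\<in>I. ?\<tau> (?c g (\<sigma> i))) = g"
    proof
      fix g assume "g \<in> fpf_above I A"
      then have "g \<in> I \<rightarrow>\<^sub>E I" by (auto simp: fpf_above_def fpf_endos_def)
      moreover from this have "\<And>i. i \<in> I \<Longrightarrow> g i \<in> I" by auto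
      ultimately show "(\<lambda>i\<in>I. ?\<tau> (?c g (\<sigma> i))) = g"
        using \<tau> by (intro PiE_ext[of _ I "\<lambda>_. I"]) auto
    qed
    show "\<forall>g\<in>fpf_above J (map_prod \<sigma> \<sigma> ` A). ?c (\<lambda>i\<in>I. ?\<tau> (g (\<sigma> i))) = g"
    proof
      fix g assume "g \<in> fpf_above J (map_prod \<sigma> \<sigma> ` A)"
      then have "g \<in> J \<rightarrow>\<^sub>E J" by (auto simp: fpf_above_def fpf_endos_def)
      moreover from this have "\<And>j. j \<in> J \<Longrightarrow> g j \<in> J" by auto
      ultimately show "?c (\<lambda>i\<in>I. ?\<tau> (g (\<sigma> i))) = g"
        using \<tau> by (intro PiE_ext[of _ J "\<lambda>_. J"]) auto
    qed
    show "?c ` fpf_above I A \<subseteq> fpf_above J (map_prod \<sigma> \<sigma> ` A)"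
    proof
      fix f assume "f \<in> ?c ` fpf_above I A"
      then obtain g where f: "f = ?c g" and "g \<in> fpf_above I A" by blast
      then have g: "g \<in> I \<rightarrow>\<^sub>E I" "I \<noteq> {}" "\<And>i. i \<in> I \<Longrightarrow> g i \<noteq> i"
        "\<And>x y. (x, y) \<in> A \<Longrightarrow> x \<noteq> y \<Longrightarrow> g x = y" by (auto simp: fpf_above_def fpf_endos_def)
      have gI: "i \<in> I \<Longrightarrow> g i \<in> I" for i using g(1) by auto
      have "f j \<noteq> j" if "j \<in> J" for j
        using that g(3)[OF \<tau>(3)[OF that]] eq[OF gI[OF \<tau>(3)[OF that]] \<tau>(3)[OF that]] \<tau>(2)[OF that] f by auto
      moreover have "f (\<sigma> x) = \<sigma> y" if "(x, y) \<in> A" "\<sigma> x \<noteq> \<sigma> y" for x y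
      proof -
        have "x \<in> I" using A that(1) by auto
        then have "f (\<sigma> x) = \<sigma> (g x)" using \<tau>(1,4) by (simp add: f)
        moreover have "g x = y" using g(4)[OF that(1)] that(2) by blast
        ultimately show ?thesis by simp
      qed
      moreover have "f \<in> J \<rightarrow>\<^sub>E J" using f gI \<tau>(3,4) by auto
      moreover have "J \<noteq> {}" using g(2) img by auto
      ultimately show "f \<in> fpf_above J (map_prod \<sigma> \<sigma> ` A)" by (auto simp: fpf_above_def fpf_endos_def)
    qed
    show "(\<lambda>g. \<lambda>i\<in>I. ?\<tau> (g (\<sigma> i))) ` fpf_above J (map_prod \<sigma> \<sigma> ` A) \<subseteq> fpf_above I A"
    proof
      fix f assume "f \<in> (\<lambda>g. \<lambda>i\<in>I. ?\<tau> (g (\<sigma> i))) ` fpf_above J (map_prod \<sigma> \<sigma> ` A)"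
      then obtain g where f: "f = (\<lambda>i\<in>I. ?\<tau> (g (\<sigma> i)))"
        and "g \<in> fpf_above J (map_prod \<sigma> \<sigma> ` A)" by blast
      then have g: "g \<in> J \<rightarrow>\<^sub>E J" "J \<noteq> {}"
        "\<And>j. j \<in> J \<Longrightarrow> g j \<noteq> j" "\<And>x y. (x, y) \<in> A \<Longrightarrow> \<sigma> x \<noteq> \<sigma> y \<Longrightarrow> g (\<sigma> x) = \<sigma> y"
        by (auto simp: fpf_above_def fpf_endos_def)
      have gJ: "j \<in> J \<Longrightarrow> g j \<in> J" for j using g(1) by auto
      have "f i \<noteq> i" if "i \<in> I" for i
      proof
        assume "f i = i"
        then have "\<sigma> (?\<tau> (g (\<sigma> i))) = \<sigma> i" using that f by simp
        then show False using g(3)[OF \<tau>(4)[OF that]] \<tau>(2)[OF gJ[OF \<tau>(4)[OF that]]] by simp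
      qed
      moreover have "f x = y" if "(x, y) \<in> A" "x \<noteq> y" for x y
      proof -
        have xy: "x \<in> I" "y \<in> I" using A that by auto
        then have "g (\<sigma> x) = \<sigma> y" using g(4)[OF that(1)] that(2) eq by blast
        then show ?thesis using xy \<tau>(1) f by simp
      qed
      moreover have "f \<in> I \<rightarrow>\<^sub>E I" using f gJ \<tau>(3,4) by auto
      moreover have "I \<noteq> {}" using g(2) img by auto
      ultimately show "f \<in> fpf_above I A" by (auto simp: fpf_above_def fpf_endos_def)
    qed
  qed
  show ?thesis
    unfolding fpf_proj_def card lin_map_sum lin_map_single
    by (rule sum.reindex_bij_betw[OF bij, symmetric])
qed

lemma map_relabel_word:
  assumes w: "w \<in> rt_words TYPE('k::field) m I" and \<sigma>: "bij_betw \<sigma> I J"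
  shows "map (rt_relabel \<sigma>) w \<in> rt_words TYPE('k) m J"
    and "warcs (map (rt_relabel \<sigma>) w) = map_prod \<sigma> \<sigma> ` warcs w"
proof -
  have inj: "inj_on \<sigma> I" and img: "\<sigma> ` I = J" using \<sigma> by (auto simp: bij_betw_def)
  have wf: "w \<noteq> []" "wf_word w" "wsupp w = I" "int (length (wroots w)) = m"
    using w by (auto simp: rt_words_iff)
  have supp: "wsupp (map (rt_relabel \<sigma>) u) = \<sigma> ` wsupp u" for u
    by (induction u) (auto simp: image_Un)
  have "wf_word u \<Longrightarrow> inj_on \<sigma> (wsupp u) \<Longrightarrow> wf_word (map (rt_relabel \<sigma>) u)" for u
  proof (induction u)
    case (Cons g u)
    then have u: "g \<in> RT_basis" "rt_supp g \<inter> wsupp u = {}" "wf_word u"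
      and inj: "inj_on \<sigma> (rt_supp g \<union> wsupp u)" by (simp_all only: wf_word_Cons word_simps)
    have "\<sigma> ` rt_supp g \<inter> \<sigma> ` wsupp u = {}"
      using inj_on_image_Int[OF inj, of "rt_supp g" "wsupp u"] u(2) by simp
    moreover have "rt_relabel \<sigma> g \<in> RT_basis"
      using u(1) inj_on_subset[OF inj Un_upper1] by (rule rt_relabel_in_basis)
    moreover have "wf_word (map (rt_relabel \<sigma>) u)"
      using u(3) inj_on_subset[OF inj Un_upper2] by (rule Cons.IH)
    ultimately show ?case
      unfolding list.map wf_word_Cons supp rt_relabel_simps by (intro conjI)
  qed simp
  moreover have "length (wroots (map (rt_relabel \<sigma>) u)) = length (wroots u)" for u
    by (induction u) auto
  ultimately show "map (rt_relabel \<sigma>) w \<in> rt_words TYPE('k) m J"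
    using wf inj img by (simp add: rt_words_iff supp)
  show "warcs (map (rt_relabel \<sigma>) w) = map_prod \<sigma> \<sigma> ` warcs w"
    by (auto simp: warcs_def)
qed

text \<open>Words of degree zero have no roots, so the orientation sign is one for both injections.
  Even unrelated \<open>h\<close> and \<open>h'\<close> are therefore compatible with
  \<open>\<sigma>\<close>, and relabelling chains becomes relabelling edges.\<close>

lemma act_fib:
  fixes z :: "'v rel \<Rightarrow>\<^sub>0 'k::field"
  assumes I: "finite I" "inj_on h I" and J: "finite J" "inj_on h' J" and \<sigma>: "bij_betw \<sigma> I J"
    and z: "Poly_Mapping.keys z \<subseteq> pendo I 0"
  shows "ce_act rt_dgl 0 J \<sigma> (rt_fib h 0 I z) = rt_fib h' 0 J (lin_map (\<lambda>A. map_prod \<sigma> \<sigma> ` A) z)"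
proof -
  have r: "relabel (rt_dgl :: ('v, 'v rt_gen, 'k) dgl_species) = rt_relabel" by (simp add: rt_dgl_def)
  show ?thesis
    unfolding ce_act_def r
  proof (rule quot_map_fib[OF chains_presentation[OF I refl] chains_presentation[OF J refl]])
    fix x :: "'v rt_gen list \<Rightarrow>\<^sub>0 'k" assume "x \<in> carrier (free_space (rt_words TYPE('k) 0 I))"
    then have x: "Poly_Mapping.keys x \<subseteq> rt_words TYPE('k) 0 I" by simp
    have "Poly_Mapping.keys (lin_map (map (rt_relabel \<sigma>)) x) \<subseteq> rt_words TYPE('k) 0 J"
      using x map_relabel_word(1)[OF _ \<sigma>] by (intro keys_lin_map_subset) blast
    moreover have "orient h' (map (rt_relabel \<sigma>) w) = (lin_map (\<lambda>A. map_prod \<sigma> \<sigma> ` A) (orient h w) :: _ \<Rightarrow>\<^sub>0 'k)"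
      if "w \<in> rt_words TYPE('k) 0 I" for w
    proof -
      have "wroots w = []" "wroots (map (rt_relabel \<sigma>) w) = []"
        using that map_relabel_word(1)[OF that \<sigma>] unfolding rt_words_iff by auto
      then show ?thesis by (simp add: orient_def map_relabel_word(2)[OF that \<sigma>])
    qed
    then have "lin_ext (orient h') (lin_map (map (rt_relabel \<sigma>)) x)
        = lin_map (\<lambda>A. map_prod \<sigma> \<sigma> ` A) (lin_ext (orient h) x)"
      unfolding lin_map_def lin_ext_lin_ext using x by (intro lin_ext_cong) (auto simp: lin_map_def)
    ultimately show "lin_map (map (rt_relabel \<sigma>)) x \<in> carrier (free_space (rt_words TYPE('k) 0 J)) \<and>
       lin_ext (orient h') (lin_map (map (rt_relabel \<sigma>)) x)
        = lin_map (\<lambda>A. map_prod \<sigma> \<sigma> ` A) (lin_ext (orient h) x)"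
      by simp
  qed (use z in simp)
qed

lemma relabel_pendo:
  fixes \<sigma> :: "'v \<Rightarrow> 'v"
  assumes "A \<in> pendo I 0" "bij_betw \<sigma> I J" "finite I" "finite J"
  shows "map_prod \<sigma> \<sigma> ` A \<in> pendo J 0"
proof -
  \<comment> \<open>The field only fixes a type here; \<open>rat\<close> is an arbitrary
    choice.\<close>
  obtain w where w: "w \<in> rt_words TYPE(rat) 0 I" "warcs w = A" using pendo_is_warcs[OF assms(3,1)] by blast
  show ?thesis
    using warcs_in_pendo[OF map_relabel_word(1)[OF w(1) assms(2)]]
    unfolding map_relabel_word(2)[OF w(1) assms(2)] w(2) .
qed

section \<open>The natural isomorphism with fixed-point-free endofunctions\<close>

definition order_inj :: "'v set \<Rightarrow> 'v \<Rightarrow> nat" where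
  "order_inj I = (SOME h. inj_on h I)"

lemma order_inj: "finite I \<Longrightarrow> inj_on (order_inj I) I"
proof -
  assume "finite I"
  then obtain h :: "'a \<Rightarrow> nat" where "inj_on h I" using finite_imp_inj_to_nat_seg by blast
  then show ?thesis unfolding order_inj_def by (rule someI[of "\<lambda>h. inj_on h I"])
qed

text \<open>The injections are chosen for each \<open>I\<close> separately and without
  compatibility. In degree zero the signs they produce are all one, so the family is still
  natural.\<close>

definition homology_iso :: "'v set \<Rightarrow> ('v rt_gen list \<Rightarrow>\<^sub>0 'k::field_char_0) set set \<Rightarrow> (('v \<Rightarrow> 'v) \<Rightarrow>\<^sub>0 'k)" where
  "homology_iso I = the_inv_into (carrier (free_space (fpf_endos I)))
     (quot_presentation.fib (ce_cycles rt_dgl 0 I) (homology_proj (order_inj I) 0 I))"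

text \<open>A class is represented by a cycle and the cycle by partial endofunctions; on these the
  action relabels edges, where \<open>fpf_proj_relabel\<close> applies.\<close>

lemma homology_iso_natural:
  fixes X :: "('v rt_gen list \<Rightarrow>\<^sub>0 'k::field_char_0) set set"
  assumes I: "finite I" and J: "finite J" and \<sigma>: "bij_betw \<sigma> I J"
    and X: "X \<in> carrier (sp_val (ce_homology rt_dgl 0) I)"
  shows "homology_iso J (sp_act (ce_homology rt_dgl 0) I J \<sigma> X) = sp_act fpf_endo_species I J \<sigma> (homology_iso I X)"
proof -
  let ?L = "rt_dgl :: ('v, 'v rt_gen, 'k) dgl_species"
  let ?c = "lin_map (\<lambda>g. \<lambda>j\<in>J. \<sigma> (g (inv_into I \<sigma> j))) :: _ \<Rightarrow> _ \<Rightarrow>\<^sub>0 'k"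
  note hI = order_inj[OF I] and hJ = order_inj[OF J]
  have basis: "homology_basis 0 I = fpf_endos I" "homology_basis 0 J = fpf_endos J" by (simp_all add: homology_basis_def)
  note pI = homology_presentation[OF I hI, of 0, where 'k = 'k, unfolded basis]
  note pJ = homology_presentation[OF J hJ, of 0, where 'k = 'k, unfolded basis]
  interpret qI: quot_presentation "ce_cycles ?L 0 I" "free_space (fpf_endos I)" "homology_proj (order_inj I) 0 I"
    "ce_boundaries ?L 0 I" by (rule pI)
  interpret qJ: quot_presentation "ce_cycles ?L 0 J" "free_space (fpf_endos J)" "homology_proj (order_inj J) 0 J"
    "ce_boundaries ?L 0 J" by (rule pJ)
  obtain y where y: "y \<in> carrier (free_space (fpf_endos I))" "X = qI.fib y"
    using X unfolding ce_homology_def by (auto simp: qI.carrier_quot)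
  have act: "ce_act ?L 0 J \<sigma> Z \<in> carrier (ce_cycles ?L 0 J) \<and>
      homology_proj (order_inj J) 0 J (ce_act ?L 0 J \<sigma> Z) = ?c (homology_proj (order_inj I) 0 I Z)"
    if Z: "Z \<in> carrier (ce_cycles ?L 0 I)" for Z
  proof -
    let ?r = "lin_map (\<lambda>A. map_prod \<sigma> \<sigma> ` A) :: _ \<Rightarrow> 'v rel \<Rightarrow>\<^sub>0 'k"
    obtain z where z: "Poly_Mapping.keys z \<subseteq> pendo I 0" "Z = rt_fib (order_inj I) 0 I z"
      using Z unfolding cycles_fib[OF I hI] by blast
    have rz: "Poly_Mapping.keys (?r z) \<subseteq> pendo J 0"
      using z(1) relabel_pendo[OF _ \<sigma> I J] by (intro keys_lin_map_subset) blast
    have "pendo J (- 1) = {}" by (auto simp: pendo_def)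
    then have "lin_ext (pendo_diff (order_inj J) J) (?r z) = 0"
      using lin_ext_pendo_diff_closed[OF J rz, of "order_inj J"] by simp
    moreover have a: "ce_act ?L 0 J \<sigma> Z = rt_fib (order_inj J) 0 J (?r z)"
      unfolding z(2) by (rule act_fib[OF I hI J hJ \<sigma> z(1)])
    ultimately have "ce_act ?L 0 J \<sigma> Z \<in> carrier (ce_cycles ?L 0 J)"
      unfolding cycles_fib[OF J hJ] using rz by blast
    moreover have "lin_ext (fpf_proj J) (?r z) = ?c (lin_ext (fpf_proj I) z)"
      unfolding lin_map_def lin_ext_lin_ext
    proof (rule lin_ext_cong)
      fix A assume "A \<in> Poly_Mapping.keys z"
      then have "A \<subseteq> I \<times> I" using z(1) by (auto simp: pendo_def)
      then show "lin_ext (fpf_proj J) (Poly_Mapping.single (map_prod \<sigma> \<sigma> ` A) 1) =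
        lin_ext (\<lambda>g. Poly_Mapping.single (\<lambda>j\<in>J. \<sigma> (g (inv_into I \<sigma> j))) 1) (fpf_proj I A :: _ \<Rightarrow>\<^sub>0 'k)"
        using fpf_proj_relabel[OF \<sigma>, where 'k = 'k] by (simp add: lin_map_def)
    qed
    ultimately show ?thesis
      unfolding a unfolding z(2) homology_proj_fib[OF J hJ rz] homology_proj_fib[OF I hI z(1)] by simp
  qed
  have "sp_act (ce_homology ?L 0) I J \<sigma> X = qJ.fib (?c y)"
    unfolding ce_homology_def y(2)
    using quot_map_fib[OF pI pJ, where f = "ce_act ?L 0 J \<sigma>" and g = ?c, OF act y(1)] by simp
  moreover have "?c y \<in> carrier (free_space (fpf_endos J))"
  proof -
    obtain Z where "Z \<in> carrier (ce_cycles ?L 0 I)" "homology_proj (order_inj I) 0 I Z = y"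
      using qI.fib_nonempty[OF y(1)] by blast
    then show ?thesis using act[of Z] qJ.T_im[of "ce_act ?L 0 J \<sigma> Z"] by simp
  qed
  ultimately show ?thesis
    unfolding homology_iso_def y(2) using qJ.the_inv_fib qI.the_inv_fib[OF y(1)]
    by (simp add: fpf_endo_species_def)
qed

theorem theorem6p1:
  shows "(\<forall>(I :: 'v set) m. finite I \<and> m \<noteq> 0 \<longrightarrow>
            carrier (sp_val (ce_homology (rt_dgl :: ('v, 'v rt_gen, 'k::field_char_0) dgl_species) m) I)
            = {\<zero>\<^bsub>sp_val (ce_homology (rt_dgl :: ('v, 'v rt_gen, 'k) dgl_species) m) I\<^esub>})
    \<and> (\<forall>n. vectorspace.fin_dim class_ring
              (sp_val (ce_homology (rt_dgl :: (nat, nat rt_gen, 'k) dgl_species) 0) {1..n})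
          \<and> vectorspace.dim class_ring
              (sp_val (ce_homology (rt_dgl :: (nat, nat rt_gen, 'k) dgl_species) 0) {1..n})
            = (if n \<ge> 2 then (n - 1) ^ n else 0))
    \<and> (\<exists>\<Phi>. species_iso
              (ce_homology (rt_dgl :: ('v, 'v rt_gen, 'k) dgl_species) 0) fpf_endo_species \<Phi>)"
proof (intro conjI allI impI)
  fix I :: "'v set" and m :: int
  assume Im: "finite I \<and> m \<noteq> 0"
  then have I: "finite I" and m: "m \<noteq> 0" by simp_all
  interpret q: quot_presentation "ce_cycles (rt_dgl :: ('v, 'v rt_gen, 'k) dgl_species) m I"
    "free_space (homology_basis m I)" "homology_proj (order_inj I) m I" "ce_boundaries rt_dgl m I"
    by (rule homology_presentation[OF I order_inj[OF I]])
  \<comment> \<open>The basis is empty in this degree, so the presenting space is zero and the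
    homology consists of a single fibre.\<close>
  show "carrier (sp_val (ce_homology (rt_dgl :: ('v, 'v rt_gen, 'k) dgl_species) m) I)
    = {\<zero>\<^bsub>sp_val (ce_homology (rt_dgl :: ('v, 'v rt_gen, 'k) dgl_species) m) I\<^esub>}"
    using m q.carrier_quot q.zero_quot by (simp add: ce_homology_def homology_basis_def)
next
  fix n :: nat
  let ?I = "{1..n}"
  have I: "finite ?I" by simp
  have basis: "homology_basis 0 ?I = fpf_endos ?I" by (simp add: homology_basis_def)
  interpret q: quot_presentation "ce_cycles (rt_dgl :: (nat, nat rt_gen, 'k) dgl_species) 0 ?I"
    "free_space (fpf_endos ?I)" "homology_proj (order_inj ?I) 0 ?I" "ce_boundaries rt_dgl 0 ?I"
    by (rule homology_presentation[OF I order_inj[OF I], of 0, unfolded basis])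
  note dim = free_space_dim[OF finite_fpf_endos[OF I], where 'k = 'k]
  show "vectorspace.fin_dim class_ring
      (sp_val (ce_homology (rt_dgl :: (nat, nat rt_gen, 'k) dgl_species) 0) ?I)"
    using q.dim_quot(1)[OF dim(1)] by (simp add: ce_homology_def)
  show "vectorspace.dim class_ring
      (sp_val (ce_homology (rt_dgl :: (nat, nat rt_gen, 'k) dgl_species) 0) ?I)
      = (if n \<ge> 2 then (n - 1) ^ n else 0)"
    using q.dim_quot(2)[OF dim(1)] card_fpf_endos[OF I] unfolding dim(2)
    by (simp add: ce_homology_def del: One_nat_def)
next
  have "species_iso (ce_homology (rt_dgl :: ('v, 'v rt_gen, 'k) dgl_species) 0) fpf_endo_species homology_iso"
    unfolding species_iso_def
  proof (intro conjI allI impI ballI)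
    fix I :: "'v set" assume I: "finite I"
    have basis: "homology_basis 0 I = fpf_endos I" by (simp add: homology_basis_def)
    interpret q: quot_presentation "ce_cycles (rt_dgl :: ('v, 'v rt_gen, 'k) dgl_species) 0 I"
      "free_space (fpf_endos I)" "homology_proj (order_inj I) 0 I" "ce_boundaries rt_dgl 0 I"
      by (rule homology_presentation[OF I order_inj[OF I], of 0, unfolded basis])
    show "linear_map class_ring (sp_val (ce_homology (rt_dgl :: ('v, 'v rt_gen, 'k) dgl_species) 0) I)
        (sp_val fpf_endo_species I) (homology_iso I)"
      using q.inv_fib_linear by (simp add: ce_homology_def fpf_endo_species_def homology_iso_def)
    show "bij_betw (homology_iso I) (carrier (sp_val (ce_homology (rt_dgl :: ('v, 'v rt_gen, 'k) dgl_species) 0) I))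
        (carrier (sp_val fpf_endo_species I))"
      using q.bij_inv_fib unfolding ce_homology_def fpf_endo_species_def homology_iso_def by simp
  qed (use homology_iso_natural in blast)
  then show "\<exists>\<Phi>. species_iso (ce_homology (rt_dgl :: ('v, 'v rt_gen, 'k) dgl_species) 0) fpf_endo_species \<Phi>"
    by blast
qed

end
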